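(* Let $\Omega\subset\mathbb{C}^n$ be open, let $T$ be a positive plurisubharmonic current of bi-dimension $(p,p)$ on $\Omega$, and let $g\in Psh^{-}(\Omega)\cap\mathcal{C}^{1}(\Omega\setminus L_{g})$. If the current $g\,d^{c}T$ is well defined and $\mathcal{H}_{2p-1}(L_{g}\cap \operatorname{Supp} T)=0$, then the current $dd^{c}g\wedge T$ is well defined, i.e. for every sequence $(g_j)$ of smooth plurisubharmonic functions on $\Omega$ decreasing to $g$ and converging to $g$ in $\mathcal{C}^1(\Omega\setminus L_g)$, the currents $dd^cg_j\wedge T$ converge weakly$^*$ to a current denoted $dd^cg\wedge T$.
   Context: $Psh^{-}(\Omega)$ is the set of negative plurisubharmonic functions on $\Omega$. For $g\in Psh^{-}(\Omega)$, $L_g$ is the set of points $z\in\Omega$ such that $g$ is unbounded in every neighborhood of $z$. A current $T$ is plurisubharmonic if $dd^{c}T\geq 0$. $\mathcal{H}_{s}$ denotes $s$-dimensional Hausdorff measure. "$g\,d^cT$ is well defined" means: for every sequence $(g_j)$ as in the claim, the currents $g_j\,d^cT$ converge weakly$^*$. *)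

theory Defs
  imports "HOL-Analysis.Analysis"
begin

coinductive smooth_on :: "'a::real_normed_vector set \<Rightarrow> ('a \<Rightarrow> 'b::real_normed_vector) \<Rightarrow> bool"
  for U where
  "f differentiable_on U \<Longrightarrow> (\<forall>v. smooth_on U (\<lambda>x. frechet_derivative f (at x) v))
     \<Longrightarrow> smooth_on U f"

text \<open>A pointwise complex differential form on C^n: the coefficient of
 dz_I wedge dzbar_J, with I, J listed increasingly w.r.t. the order on the index type.\<close>
type_synonym 'n pform = "'n set \<times> 'n set \<Rightarrow> complex"
type_synonym 'n form = "(complex, 'n) vec \<Rightarrow> 'n pform"

definition perm_sign :: "('n::linorder) set \<Rightarrow> 'n set \<Rightarrow> complex" where
  "perm_sign A B = (-1) ^ card {(a,b). a \<in> A \<and> b \<in> B \<and> b < a}"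

definition pf_wedge :: "('n::{finite,linorder}) pform \<Rightarrow> 'n pform \<Rightarrow> 'n pform" where
  "pf_wedge u v = (\<lambda>(I,J). \<Sum>I1\<in>Pow I. \<Sum>J1\<in>Pow J.
      (-1) ^ (card J1 * card (I - I1)) * perm_sign I1 (I - I1) * perm_sign J1 (J - J1)
      * u (I1,J1) * v (I - I1, J - J1))"

definition wedge :: "('n::{finite,linorder}) form \<Rightarrow> 'n form \<Rightarrow> 'n form" where
  "wedge u v = (\<lambda>z. pf_wedge (u z) (v z))"

definition pf_one :: "('n::{finite,linorder}) pform" where
  "pf_one = (\<lambda>IJ. if IJ = ({},{}) then 1 else 0)"

definition fun_form :: "((complex, 'n::{finite,linorder}) vec \<Rightarrow> complex) \<Rightarrow> 'n form" where
  "fun_form f = (\<lambda>z IJ. if IJ = ({},{}) then f z else 0)"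

definition mult_form :: "((complex, 'n::{finite,linorder}) vec \<Rightarrow> complex) \<Rightarrow> 'n form \<Rightarrow> 'n form" where
  "mult_form f u = (\<lambda>z IJ. f z * u z IJ)"

definition pp_part :: "nat \<Rightarrow> ('n::{finite,linorder}) form \<Rightarrow> 'n form" where
  "pp_part p u = (\<lambda>z (I,J). if card I = p \<and> card J = p then u z (I,J) else 0)"

definition wirt_z :: "('n::{finite,linorder}) \<Rightarrow> ((complex, 'n) vec \<Rightarrow> complex) \<Rightarrow> (complex, 'n) vec \<Rightarrow> complex" where
  "wirt_z k f z = (frechet_derivative f (at z) (axis k 1)
                   - \<i> * frechet_derivative f (at z) (axis k \<i>)) / 2"

definition wirt_zbar :: "('n::{finite,linorder}) \<Rightarrow> ((complex, 'n) vec \<Rightarrow> complex) \<Rightarrow> (complex, 'n) vec \<Rightarrow> complex" where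
  "wirt_zbar k f z = (frechet_derivative f (at z) (axis k 1)
                   + \<i> * frechet_derivative f (at z) (axis k \<i>)) / 2"

definition del :: "('n::{finite,linorder}) form \<Rightarrow> 'n form" where
  "del u = (\<lambda>z (I,J). \<Sum>k\<in>I. perm_sign {k} (I - {k}) * wirt_z k (\<lambda>w. u w (I - {k}, J)) z)"

definition delbar :: "('n::{finite,linorder}) form \<Rightarrow> 'n form" where
  "delbar u = (\<lambda>z (I,J). \<Sum>k\<in>J. (-1) ^ card I * perm_sign {k} (J - {k})
                  * wirt_zbar k (\<lambda>w. u w (I, J - {k})) z)"

definition dform :: "('n::{finite,linorder}) form \<Rightarrow> 'n form" where
  "dform u = (\<lambda>z IJ. del u z IJ + delbar u z IJ)"

text \<open>d^c = i (delbar - del), so that d d^c = 2 i del delbar (a positive multiple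
 of the usual normalisation).\<close>
definition dcform :: "('n::{finite,linorder}) form \<Rightarrow> 'n form" where
  "dcform u = (\<lambda>z IJ. \<i> * (delbar u z IJ - del u z IJ))"

definition ddcform :: "('n::{finite,linorder}) form \<Rightarrow> 'n form" where
  "ddcform u = dform (dcform u)"

definition form_supp :: "('n::{finite,linorder}) form \<Rightarrow> ((complex, 'n) vec) set" where
  "form_supp u = closure {z. u z \<noteq> (\<lambda>_. 0)}"

definition test_form :: "((complex, 'n::{finite,linorder}) vec) set \<Rightarrow> 'n form \<Rightarrow> bool" where
  "test_form \<Omega> u \<longleftrightarrow> (\<forall>IJ. smooth_on \<Omega> (\<lambda>z. u z IJ))
      \<and> compact (form_supp u) \<and> form_supp u \<subseteq> \<Omega>"

definition pf10 :: "(complex, 'n::{finite,linorder}) vec \<Rightarrow> 'n pform" where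
  "pf10 a = (\<lambda>(I,J). if J = {} \<and> (\<exists>k. I = {k}) then a $ (THE k. I = {k}) else 0)"

definition pf01 :: "(complex, 'n::{finite,linorder}) vec \<Rightarrow> 'n pform" where
  "pf01 a = (\<lambda>(I,J). if I = {} \<and> (\<exists>k. J = {k}) then cnj (a $ (THE k. J = {k})) else 0)"

definition elem_pos :: "((complex, 'n::{finite,linorder}) vec) list \<Rightarrow> 'n pform" where
  "elem_pos as = foldr (\<lambda>a w. pf_wedge (\<lambda>IJ. \<i> * pf_wedge (pf10 a) (pf01 a) IJ) w) as pf_one"

definition strongly_pos :: "nat \<Rightarrow> ('n::{finite,linorder}) pform \<Rightarrow> bool" where
  "strongly_pos q w \<longleftrightarrow> (\<exists>F :: (real \<times> ((complex, 'n) vec) list) list.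
      (\<forall>(c,as)\<in>set F. c \<ge> 0 \<and> length as = q)
      \<and> w = (\<lambda>IJ. sum_list (map (\<lambda>(c,as). complex_of_real c * elem_pos as IJ) F)))"

definition nonneg_real :: "complex \<Rightarrow> bool" where
  "nonneg_real c \<longleftrightarrow> c \<in> \<real> \<and> 0 \<le> Re c"

type_synonym 'n current = "'n form \<Rightarrow> complex"

text \<open>A current of bidimension (p,p) on Omega: a linear functional on test forms
 that only sees the (p,p)-component.  (Continuity is not required here: positive
 currents, the only ones considered, are automatically of order 0.)\<close>
definition is_current :: "((complex, 'n::{finite,linorder}) vec) set \<Rightarrow> nat \<Rightarrow> 'n current \<Rightarrow> bool" where
  "is_current \<Omega> p T \<longleftrightarrow>
     (\<forall>u v. test_form \<Omega> u \<longrightarrow> test_form \<Omega> v \<longrightarrow> T (\<lambda>z IJ. u z IJ + v z IJ) = T u + T v)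
   \<and> (\<forall>c u. test_form \<Omega> u \<longrightarrow> T (\<lambda>z IJ. c * u z IJ) = c * T u)
   \<and> (\<forall>u. test_form \<Omega> u \<longrightarrow> T u = T (pp_part p u))"

definition positive_current :: "((complex, 'n::{finite,linorder}) vec) set \<Rightarrow> nat \<Rightarrow> 'n current \<Rightarrow> bool" where
  "positive_current \<Omega> p T \<longleftrightarrow>
     (\<forall>u. test_form \<Omega> u \<and> (\<forall>z. strongly_pos p (u z)) \<longrightarrow> nonneg_real (T u))"

definition ddc_current :: "('n::{finite,linorder}) current \<Rightarrow> 'n current" where
  "ddc_current T = (\<lambda>u. T (ddcform u))"

definition psh_current :: "((complex, 'n::{finite,linorder}) vec) set \<Rightarrow> nat \<Rightarrow> 'n current \<Rightarrow> bool" where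
  "psh_current \<Omega> p T \<longleftrightarrow> positive_current \<Omega> (p - 1) (ddc_current T)"

definition current_supp :: "((complex, 'n::{finite,linorder}) vec) set \<Rightarrow> 'n current \<Rightarrow> ((complex, 'n) vec) set" where
  "current_supp \<Omega> T = \<Omega> - \<Union>{V. open V \<and> V \<subseteq> \<Omega> \<and>
       (\<forall>u. test_form \<Omega> u \<and> form_supp u \<subseteq> V \<longrightarrow> T u = 0)}"

definition weak_star_convergent :: "((complex, 'n::{finite,linorder}) vec) set \<Rightarrow> (nat \<Rightarrow> 'n current) \<Rightarrow> bool" where
  "weak_star_convergent \<Omega> S \<longleftrightarrow> (\<forall>u. test_form \<Omega> u \<longrightarrow> convergent (\<lambda>j. S j u))"

text \<open>For smooth h: the currents h d^c T and dd^c h /\ T.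
 <d^c T, psi> = - <T, d^c psi> (T has even degree); <h d^c T, psi> = <d^c T, h psi>.\<close>
definition fun_dc_current :: "((complex, 'n::{finite,linorder}) vec \<Rightarrow> real) \<Rightarrow> 'n current \<Rightarrow> 'n current" where
  "fun_dc_current h T = (\<lambda>u. - T (dcform (mult_form (\<lambda>z. complex_of_real (h z)) u)))"

definition ddc_fun_wedge :: "((complex, 'n::{finite,linorder}) vec \<Rightarrow> real) \<Rightarrow> 'n current \<Rightarrow> 'n current" where
  "ddc_fun_wedge h T = (\<lambda>u. T (wedge (ddcform (fun_form (\<lambda>z. complex_of_real (h z)))) u))"

definition circle_pt :: "(complex, 'n::{finite,linorder}) vec \<Rightarrow> (complex, 'n) vec \<Rightarrow> real \<Rightarrow> (complex, 'n) vec" where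
  "circle_pt a b \<theta> = a + exp (\<i> * complex_of_real \<theta>) *s b"

definition disc_in :: "((complex, 'n::{finite,linorder}) vec) set \<Rightarrow> (complex, 'n) vec \<Rightarrow> (complex, 'n) vec \<Rightarrow> bool" where
  "disc_in \<Omega> a b \<longleftrightarrow> (\<forall>\<zeta>. cmod \<zeta> \<le> 1 \<longrightarrow> a + \<zeta> *s b \<in> \<Omega>)"

definition psh_real :: "((complex, 'n::{finite,linorder}) vec) set \<Rightarrow> ((complex, 'n) vec \<Rightarrow> real) \<Rightarrow> bool" where
  "psh_real \<Omega> f \<longleftrightarrow>
     (\<forall>c. openin (top_of_set \<Omega>) {x\<in>\<Omega>. f x < c})
   \<and> (\<forall>a b. disc_in \<Omega> a b \<longrightarrow>
          f a \<le> (1 / (2*pi)) * integral {0..2*pi} (\<lambda>\<theta>. f (circle_pt a b \<theta>)))"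

text \<open>Psh^-(Omega): negative plurisubharmonic functions with values in [-inf,0],
 upper semicontinuous, not identically -inf on any connected component, with the
 sub-mean-value property (stated for -g >= 0 via the nonnegative integral).\<close>
definition neg_psh :: "((complex, 'n::{finite,linorder}) vec) set \<Rightarrow> ((complex, 'n) vec \<Rightarrow> ereal) \<Rightarrow> bool" where
  "neg_psh \<Omega> g \<longleftrightarrow>
     (\<forall>x\<in>\<Omega>. g x \<le> 0)
   \<and> (\<forall>c. openin (top_of_set \<Omega>) {x\<in>\<Omega>. g x < c})
   \<and> (\<forall>C\<in>components \<Omega>. \<exists>z\<in>C. g z \<noteq> -\<infinity>)
   \<and> (\<forall>a b. disc_in \<Omega> a b \<longrightarrow>
          ennreal (1 / (2*pi)) * (\<integral>\<^sup>+ \<theta>. indicator {0..2*pi} \<theta> * e2ennreal (- g (circle_pt a b \<theta>)) \<partial>lborel)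
            \<le> e2ennreal (- g a))"

definition unbdd_locus :: "((complex, 'n::{finite,linorder}) vec) set \<Rightarrow> ((complex, 'n) vec \<Rightarrow> ereal) \<Rightarrow> ((complex, 'n) vec) set" where
  "unbdd_locus \<Omega> g = {z\<in>\<Omega>. \<forall>e>0. \<forall>M::real. \<exists>y\<in>ball z e \<inter> \<Omega>. g y < ereal M}"

definition C1_on :: "((complex, 'n::{finite,linorder}) vec) set \<Rightarrow> ((complex, 'n) vec \<Rightarrow> real) \<Rightarrow> bool" where
  "C1_on U f \<longleftrightarrow> f differentiable_on U
     \<and> (\<forall>v. continuous_on U (\<lambda>x. frechet_derivative f (at x) v))"

definition C1_conv :: "((complex, 'n::{finite,linorder}) vec) set \<Rightarrow> (nat \<Rightarrow> (complex, 'n) vec \<Rightarrow> real) \<Rightarrow> ((complex, 'n) vec \<Rightarrow> real) \<Rightarrow> bool" where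
  "C1_conv U G f \<longleftrightarrow> (\<forall>K. compact K \<and> K \<subseteq> U \<longrightarrow>
       uniform_limit K G f sequentially
     \<and> (\<forall>v. uniform_limit K (\<lambda>j x. frechet_derivative (G j) (at x) v)
                            (\<lambda>x. frechet_derivative f (at x) v) sequentially))"

definition admissible_seq :: "((complex, 'n::{finite,linorder}) vec) set \<Rightarrow> ((complex, 'n) vec \<Rightarrow> ereal) \<Rightarrow> (nat \<Rightarrow> (complex, 'n) vec \<Rightarrow> real) \<Rightarrow> bool" where
  "admissible_seq \<Omega> g G \<longleftrightarrow>
     (\<forall>j. smooth_on \<Omega> (G j) \<and> psh_real \<Omega> (G j))
   \<and> (\<forall>j. \<forall>z\<in>\<Omega>. G (Suc j) z \<le> G j z)
   \<and> (\<forall>z\<in>\<Omega>. (\<lambda>j. ereal (G j z)) \<longlonglongrightarrow> g z)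
   \<and> C1_conv (\<Omega> - unbdd_locus \<Omega> g) G (\<lambda>z. real_of_ereal (g z))"

definition gdcT_well_defined :: "((complex, 'n::{finite,linorder}) vec) set \<Rightarrow> ((complex, 'n) vec \<Rightarrow> ereal) \<Rightarrow> 'n current \<Rightarrow> bool" where
  "gdcT_well_defined \<Omega> g T \<longleftrightarrow> (\<forall>G. admissible_seq \<Omega> g G \<longrightarrow>
       weak_star_convergent \<Omega> (\<lambda>j. fun_dc_current (G j) T))"

definition ddcgT_well_defined :: "((complex, 'n::{finite,linorder}) vec) set \<Rightarrow> ((complex, 'n) vec \<Rightarrow> ereal) \<Rightarrow> 'n current \<Rightarrow> bool" where
  "ddcgT_well_defined \<Omega> g T \<longleftrightarrow> (\<forall>G. admissible_seq \<Omega> g G \<longrightarrow>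
       weak_star_convergent \<Omega> (\<lambda>j. ddc_fun_wedge (G j) T))"

text \<open>s-dimensional Hausdorff (outer) measure, up to the normalising constant.\<close>
definition hausdorff_measure :: "nat \<Rightarrow> 'a::metric_space set \<Rightarrow> ennreal" where
  "hausdorff_measure s A = (SUP \<delta>\<in>{0<..}. INF U\<in>{U :: nat \<Rightarrow> 'a set.
        A \<subseteq> (\<Union>i. U i) \<and> (\<forall>i. bounded (U i) \<and> diameter (U i) \<le> \<delta>)}.
        (\<Sum>i. ennreal (diameter (U i) ^ s)))"

end

theory Submission
  imports Defs
begin

text \<open>
Write \<open>h = G\<^sub>j\<close> and \<open>S = dd\<^sup>c T \<ge> 0\<close>. For a test form \<open>\<phi>\<close> of bidegree \<open>(p-1,p-1)\<close>,
\<open>\<langle>dd\<^sup>c h \<and> T, \<phi>\<rangle> = \<langle>S, h \<phi>\<rangle> - 2 \<langle>h d\<^sup>c T, d\<phi>\<rangle> + \<langle>T, h dd\<^sup>c \<phi>\<rangle>\<close>, and the middle term converges by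
hypothesis. So it suffices that \<open>h T\<close> and \<open>h S\<close> converge; since \<open>h\<close> decreases, for positive test
forms only lower bounds are needed, and only near points \<open>a\<close> of \<open>E = L\<^sub>g \<inter> Supp T\<close>.

Because \<open>E\<close> is null for the \<open>(2p-1)\<close>-dimensional Hausdorff measure, generic covectors \<open>\<lambda>\<^sub>1, \<dots>, \<lambda>\<^bsub>p-1\<^esub>\<close> admit arbitrarily small
spheres around \<open>a\<close> whose intersection with the common kernel misses \<open>E\<close>. Let \<open>w\<close> be the product of the
forms \<open>\<i> \<lambda>\<^sub>i \<and> \<lambda>\<^sub>i\<^sup>*\<close> and \<open>F\<close> a product of cutoffs in \<open>|\<lambda>\<^sub>i|\<^sup>2\<close> and in \<open>|z - a|\<^sup>2\<close>. Derivatives of the former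
are killed by \<open>w\<close>, hence \<open>dd\<^sup>c(F q) \<and> w - F dd\<^sup>c q \<and> w\<close> is supported off \<open>E\<close>, where convergence is clear.
Inserting \<open>\<phi> = F q w\<close> and using \<open>dd\<^sup>c h \<and> T \<ge> 0\<close> bounds \<open>\<langle>S, h F q w\<rangle> + \<langle>T, h F dd\<^sup>c q \<and> w\<rangle>\<close> from below.
With \<open>q = 1\<close> this bounds \<open>h S\<close> on \<open>w\<close>; with \<open>q\<close> the squared modulus of a linear form it bounds \<open>h T\<close>.
As the admissible \<open>w\<close> are dense among the decomposable forms, they span all forms.
\<close>

subsection \<open>Smooth functions\<close>

text \<open>The term with \<open>d^c T\<close> has no sign and cannot be estimated; it is under
  control only by hypothesis. All lower bounds must therefore come from positivity, tested on a
  positive form whose cutoff does no harm. A purely radial cutoff fails: its derivatives live on a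
  whole shell, which meets E in general. The extra cutoffs in the moduli of the covectors confine
  the harmful region to a thin neighbourhood of the sphere inside the common kernel, and that
  compact set can be kept away from E. The dimension 2p - 1 is a count of parameters. Fix a covering
  set of diameter d away from the centre. The tuples of p - 1 covectors and a radius that are bad
  because of it have volume of order d^(2(p-1)+1): each complex equation costs d^2 and the radius
  costs d. A cover with small sum thus cannot exhaust any box of parameters. The passage from
  generic covectors to all of them needs no limit inside the current: for a fixed point the good
  constant forms make up a linear subspace of a finite-dimensional space, hence a closed set, and
  density already gives everything.\<close>

primrec Ck :: "nat \<Rightarrow> 'a::real_normed_vector set \<Rightarrow> ('a \<Rightarrow> 'b::real_normed_vector) \<Rightarrow> bool" where
  "Ck 0 U f \<longleftrightarrow> True"
| "Ck (Suc n) U f \<longleftrightarrow> f differentiable_on U \<and> (\<forall>v. Ck n U (\<lambda>x. frechet_derivative f (at x) v))"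

text \<open>Derivatives of products and composites are sums of products, which is not the shape that
  coinduction on \<open>smooth_on\<close> wants. At a finite order \<open>n\<close> the same closure
  properties are plain inductions, so they are proved for \<open>Ck\<close> and transferred through
  this equivalence.\<close>

lemma smooth_on_iff_Ck: "smooth_on U f \<longleftrightarrow> (\<forall>n. Ck n U f)"
proof
  assume "smooth_on U f"
  moreover have "smooth_on U h \<Longrightarrow> Ck n U h" for n and h :: "'a \<Rightarrow> 'b"
    by (induction n arbitrary: h) (auto elim: smooth_on.cases)
  ultimately show "\<forall>n. Ck n U f" by blast
next
  assume "\<forall>n. Ck n U f"
  then show "smooth_on U f"
  proof (coinduction arbitrary: f)
    case (smooth_on h)
    have "h differentiable_on U" using smooth_on[rule_format, of 1] by simp
    moreover have "\<forall>v n. Ck n U (\<lambda>x. frechet_derivative h (at x) v)"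
      using smooth_on[rule_format, of "Suc n" for n] by simp
    ultimately show ?case by blast
  qed
qed

lemma smooth_on_differentiable: "smooth_on U f \<Longrightarrow> f differentiable_on U"
  by (auto elim: smooth_on.cases)

lemma smooth_on_differentiable_at: "smooth_on U f \<Longrightarrow> open U \<Longrightarrow> x \<in> U \<Longrightarrow> f differentiable (at x)"
  using smooth_on_differentiable differentiable_on_eq_differentiable_at by blast

lemma smooth_on_frechet: "smooth_on U f \<Longrightarrow> smooth_on U (\<lambda>x. frechet_derivative f (at x) v)"
  by (auto elim: smooth_on.cases)

lemma Ck_cong:
  assumes "open U" "Ck n U f" "\<And>x. x \<in> U \<Longrightarrow> f x = h x"
  shows "Ck n U h"
  using assms(2,3)
proof (induction n arbitrary: f h)
  case (Suc n)
  have d: "frechet_derivative f (at x) = frechet_derivative h (at x)" if "x \<in> U" for x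
    using Suc.prems assms(1) that differentiable_on_eq_differentiable_at
    by (intro frechet_derivative_transform_within_open[of f x U h]) auto
  have "h differentiable_on U"
    unfolding differentiable_on_eq_differentiable_at[OF assms(1)]
  proof
    fix x assume "x \<in> U"
    then have "f differentiable (at x)"
      using Suc.prems(1) assms(1) differentiable_on_eq_differentiable_at by auto
    then obtain D where "(f has_derivative D) (at x)" by (auto simp: differentiable_def)
    then have "(h has_derivative D) (at x)"
      by (rule has_derivative_transform_within_open[OF _ assms(1) \<open>x \<in> U\<close>]) (use Suc.prems in auto)
    then show "h differentiable (at x)" by (auto simp: differentiable_def)
  qed
  moreover have "Ck n U (\<lambda>x. frechet_derivative h (at x) v)" for v
    by (rule Suc.IH[of "\<lambda>x. frechet_derivative f (at x) v"]) (use Suc.prems d in auto)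
  ultimately show ?case by simp
qed simp

lemma smooth_on_cong:
  "open U \<Longrightarrow> smooth_on U f \<Longrightarrow> (\<And>x. x \<in> U \<Longrightarrow> f x = h x) \<Longrightarrow> smooth_on U h"
  unfolding smooth_on_iff_Ck using Ck_cong by blast

lemma Ck_SucI:
  assumes "open U" "\<And>x. x \<in> U \<Longrightarrow> (f has_derivative D x) (at x)" "\<And>v. Ck n U (\<lambda>x. D x v)"
  shows "Ck (Suc n) U f"
proof -
  have "f differentiable_on U"
    using assms(1,2) differentiable_on_eq_differentiable_at differentiable_def by blast
  moreover have "Ck n U (\<lambda>x. frechet_derivative f (at x) v)" for v
    by (rule Ck_cong[OF assms(1) assms(3)[of v]]) (simp add: frechet_derivative_at[OF assms(2), symmetric])
  ultimately show ?thesis by simp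
qed

lemma Ck_SucD:
  assumes "open U" "Ck (Suc n) U f"
  shows "\<And>x. x \<in> U \<Longrightarrow> (f has_derivative frechet_derivative f (at x)) (at x)"
    "\<And>v. Ck n U (\<lambda>x. frechet_derivative f (at x) v)"
  using assms by (auto simp: differentiable_on_eq_differentiable_at simp flip: frechet_derivative_works)

lemma Ck_mono: "Ck (Suc n) U f \<Longrightarrow> Ck n U f"
proof (induction n arbitrary: f)
  case (Suc n)
  then show ?case unfolding Ck.simps(2)[of "Suc n"] Ck.simps(2)[of n] by blast
qed simp

lemma Ck_const: "Ck n U (\<lambda>x. c)"
  by (induction n arbitrary: c) auto

lemma Ck_bounded_linear:
  assumes "open U" "bounded_linear L"
  shows "Ck n U L"
proof (cases n)
  case (Suc m)
  show ?thesis unfolding Suc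
    by (rule Ck_SucI[OF assms(1), where D = "\<lambda>x. L"])
       (use assms in \<open>auto intro: bounded_linear_imp_has_derivative Ck_const\<close>)
qed simp

lemma Ck_add: "open U \<Longrightarrow> Ck n U f \<Longrightarrow> Ck n U h \<Longrightarrow> Ck n U (\<lambda>x. f x + h x)"
proof (induction n arbitrary: f h)
  case (Suc n)
  note 1 = Ck_SucD[OF Suc.prems(1) Suc.prems(2)] and 2 = Ck_SucD[OF Suc.prems(1) Suc.prems(3)]
  show ?case
    by (rule Ck_SucI[OF Suc.prems(1) has_derivative_add[OF 1(1) 2(1)]]) (auto intro!: Suc.IH 1 2 Suc.prems)
qed simp

lemma Ck_bilinear:
  assumes B: "bounded_bilinear B" and "open U"
  shows "Ck n U f \<Longrightarrow> Ck n U h \<Longrightarrow> Ck n U (\<lambda>x. B (f x) (h x))"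
proof (induction n arbitrary: f h)
  case (Suc n)
  note 1 = Ck_SucD[OF assms(2) Suc.prems(1)] and 2 = Ck_SucD[OF assms(2) Suc.prems(2)]
  show ?case
    by (rule Ck_SucI[OF assms(2) bounded_bilinear.FDERIV[OF B 1(1) 2(1)]])
       (assumption | rule Ck_add[OF assms(2) Suc.IH[OF Ck_mono[OF Suc.prems(1)] 2(2)]
          Suc.IH[OF 1(2) Ck_mono[OF Suc.prems(2)]]])+
qed simp

lemma Ck_linear_comp:
  assumes L: "bounded_linear L" and "open U"
  shows "Ck n U f \<Longrightarrow> Ck n U (\<lambda>x. L (f x))"
proof (induction n arbitrary: f)
  case (Suc n)
  note 1 = Ck_SucD[OF assms(2) Suc.prems(1)]
  show ?case
    by (rule Ck_SucI[OF assms(2) bounded_linear.has_derivative[OF L 1(1)]])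
       (auto intro!: Suc.IH 1)
qed simp

lemma Ck_real_comp:
  fixes s :: "real \<Rightarrow> real"
  assumes "open U"
  shows "Ck n UNIV s \<Longrightarrow> Ck n U f \<Longrightarrow> Ck n U (\<lambda>x. s (f x))"
proof (induction n arbitrary: f s)
  case (Suc n)
  note 1 = Ck_SucD[OF assms Suc.prems(2)] and 2 = Ck_SucD[OF open_UNIV Suc.prems(1)]
  define s' where "s' t = frechet_derivative s (at t) 1" for t
  have lin: "frechet_derivative s (at t) c = s' t * c" for t c
  proof -
    have "linear (frechet_derivative s (at t))"
      using has_derivative_linear[OF 2(1)] by simp
    then have "frechet_derivative s (at t) (c *\<^sub>R 1) = c *\<^sub>R s' t"
      unfolding s'_def by (rule linear_cmul)
    then show ?thesis by simp
  qed
  show ?case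
  proof (rule Ck_SucI[OF assms, where D = "\<lambda>x v. s' (f x) * frechet_derivative f (at x) v"])
    fix x assume "x \<in> U"
    from has_derivative_compose[OF 1(1)[OF this] 2(1)] 
    show "((\<lambda>x. s (f x)) has_derivative (\<lambda>v. s' (f x) * frechet_derivative f (at x) v)) (at x)"
      by (simp add: lin)
  next
    fix v
    have "Ck n U (\<lambda>x. s' (f x))"
      by (rule Suc.IH) (use 2(2)[of 1] Ck_mono[OF Suc.prems(2)] in \<open>auto simp: s'_def[abs_def]\<close>)
    then show "Ck n U (\<lambda>x. s' (f x) * frechet_derivative f (at x) v)"
      by (rule Ck_bilinear[OF bounded_bilinear_mult assms]) (rule 1)
  qed
qed simp

lemma smooth_on_const: "smooth_on U (\<lambda>x. c)"
  by (simp add: smooth_on_iff_Ck Ck_const)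

lemma smooth_on_bounded_linear: "open U \<Longrightarrow> bounded_linear L \<Longrightarrow> smooth_on U L"
  by (simp add: smooth_on_iff_Ck Ck_bounded_linear)

lemma smooth_on_add: "open U \<Longrightarrow> smooth_on U f \<Longrightarrow> smooth_on U h \<Longrightarrow> smooth_on U (\<lambda>x. f x + h x)"
  by (simp add: smooth_on_iff_Ck Ck_add)

lemma smooth_on_linear_comp:
  "bounded_linear L \<Longrightarrow> open U \<Longrightarrow> smooth_on U f \<Longrightarrow> smooth_on U (\<lambda>x. L (f x))"
  by (simp add: smooth_on_iff_Ck Ck_linear_comp)

lemma smooth_on_mult:
  fixes f h :: "'a::real_normed_vector \<Rightarrow> 'b::real_normed_algebra"
  shows "open U \<Longrightarrow> smooth_on U f \<Longrightarrow> smooth_on U h \<Longrightarrow> smooth_on U (\<lambda>x. f x * h x)"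
  by (simp add: smooth_on_iff_Ck Ck_bilinear[OF bounded_bilinear_mult])

lemma smooth_on_real_comp:
  fixes s :: "real \<Rightarrow> real"
  shows "open U \<Longrightarrow> smooth_on UNIV s \<Longrightarrow> smooth_on U f \<Longrightarrow> smooth_on U (\<lambda>x. s (f x))"
  by (simp add: smooth_on_iff_Ck Ck_real_comp)

lemma smooth_on_of_real:
  "open U \<Longrightarrow> smooth_on U f \<Longrightarrow> smooth_on U (\<lambda>x. complex_of_real (f x))"
  by (rule smooth_on_linear_comp[OF bounded_linear_of_real])

lemma smooth_on_cmult:
  fixes f :: "'a::real_normed_vector \<Rightarrow> 'b::real_normed_algebra"
  shows "open U \<Longrightarrow> smooth_on U f \<Longrightarrow> smooth_on U (\<lambda>x. c * f x)"
  by (rule smooth_on_mult) (auto intro: smooth_on_const)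

lemma smooth_on_uminus:
  "open U \<Longrightarrow> smooth_on U f \<Longrightarrow> smooth_on U (\<lambda>x. - f x)"
  by (rule smooth_on_linear_comp[OF bounded_linear_minus[OF bounded_linear_ident]])

lemma smooth_on_diff:
  "open U \<Longrightarrow> smooth_on U f \<Longrightarrow> smooth_on U h \<Longrightarrow> smooth_on U (\<lambda>x. f x - h x)"
  using smooth_on_add[of U f "\<lambda>x. - h x"] smooth_on_uminus[of U h] by simp

lemma smooth_on_prod:
  fixes f :: "'i \<Rightarrow> 'a::real_normed_vector \<Rightarrow> 'b::{real_normed_algebra,comm_ring_1}"
  assumes "open U" "\<And>i. i \<in> I \<Longrightarrow> smooth_on U (f i)"
  shows "smooth_on U (\<lambda>x. \<Prod>i\<in>I. f i x)"
  using assms(2)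
  by (induction I rule: infinite_finite_induct) (auto intro!: smooth_on_const smooth_on_mult assms(1))

lemma Ck_Un: "open U \<Longrightarrow> open V \<Longrightarrow> Ck n U f \<Longrightarrow> Ck n V f \<Longrightarrow> Ck n (U \<union> V) f"
  by (induction n arbitrary: f) (auto simp: differentiable_on_eq_differentiable_at open_Un)

lemma smooth_on_Un: "open U \<Longrightarrow> open V \<Longrightarrow> smooth_on U f \<Longrightarrow> smooth_on V f \<Longrightarrow> smooth_on (U \<union> V) f"
  by (simp add: smooth_on_iff_Ck Ck_Un)

lemma Ck_subset: "V \<subseteq> U \<Longrightarrow> Ck n U f \<Longrightarrow> Ck n V f"
  by (induction n arbitrary: f) (auto intro: differentiable_on_subset)

lemma smooth_on_subset: "V \<subseteq> U \<Longrightarrow> smooth_on U f \<Longrightarrow> smooth_on V f"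
  by (meson smooth_on_iff_Ck Ck_subset)

text \<open>The second-order difference quotient along \<open>u\<close> and \<open>v\<close> equals a value of either mixed
  derivative near \<open>x\<close>, by the mean value theorem applied twice.\<close>
lemma second_difference_mvt:
  fixes h :: "'a::real_normed_vector \<Rightarrow> real"
  assumes h: "smooth_on U h" "open U" and t: "0 < t"
    and U: "\<And>r s. 0 \<le> r \<Longrightarrow> r \<le> t \<Longrightarrow> 0 \<le> s \<Longrightarrow> s \<le> t \<Longrightarrow> x + r *\<^sub>R u + s *\<^sub>R v \<in> U"
  shows "\<exists>r s. 0 < r \<and> r < t \<and> 0 < s \<and> s < t \<and>
     h (x + t *\<^sub>R u + t *\<^sub>R v) - h (x + t *\<^sub>R u) - h (x + t *\<^sub>R v) + h x
     = t * t * frechet_derivative (\<lambda>y. frechet_derivative h (at y) u) (at (x + r *\<^sub>R u + s *\<^sub>R v)) v"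
proof -
  define D where "D w y = frechet_derivative h (at y) w" for w y
  have h1: "(h has_derivative (\<lambda>w. D w y)) (at y)" if "y \<in> U" for y
    using smooth_on_differentiable_at[OF h that] unfolding D_def frechet_derivative_works by simp
  have h2: "(D u has_derivative (\<lambda>w. frechet_derivative (D u) (at y) w)) (at y)" if "y \<in> U" for y
    using smooth_on_differentiable_at[OF smooth_on_frechet[OF h(1)] h(2) that, of u]
    unfolding D_def frechet_derivative_works by simp
  have lin: "k (c *\<^sub>R w) = c *\<^sub>R k w" if "(f has_derivative k) (at y)" for f :: "'a \<Rightarrow> real" and k y c w
    using has_derivative_linear[OF that] by (simp add: linear_cmul)
  have U0: "x + r *\<^sub>R u \<in> U" if "0 \<le> r" "r \<le> t" for r using U[of r 0] that t by simp
  define \<phi> where "\<phi> r = h (x + r *\<^sub>R u + t *\<^sub>R v) - h (x + r *\<^sub>R u)" for r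
  have "\<exists>r>0. r < t \<and> \<phi> t - \<phi> 0 = (t - 0) * (D u (x + r *\<^sub>R u + t *\<^sub>R v) - D u (x + r *\<^sub>R u))"
  proof (rule MVT2[OF t])
    fix r assume r: "0 \<le> r" "r \<le> t"
    have 1: "((\<lambda>r. x + r *\<^sub>R u + t *\<^sub>R v) has_derivative (\<lambda>c. c *\<^sub>R u)) (at r)"
      by (auto intro!: derivative_eq_intros)
    have 2: "((\<lambda>r. x + r *\<^sub>R u) has_derivative (\<lambda>c. c *\<^sub>R u)) (at r)"
      by (auto intro!: derivative_eq_intros)
    have a: "x + r *\<^sub>R u + t *\<^sub>R v \<in> U" using U r t by auto
    show "(\<phi> has_real_derivative D u (x + r *\<^sub>R u + t *\<^sub>R v) - D u (x + r *\<^sub>R u)) (at r)"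
      unfolding has_field_derivative_def \<phi>_def[abs_def]
      by (rule has_derivative_eq_rhs[OF has_derivative_diff[OF has_derivative_compose[OF 1 h1[OF a]]
          has_derivative_compose[OF 2 h1[OF U0[OF r]]]]])
         (simp add: fun_eq_iff lin[OF h1[OF a]] lin[OF h1[OF U0[OF r]]] right_diff_distrib mult.commute)
  qed
  then obtain r where r: "0 < r" "r < t"
    and e1: "\<phi> t - \<phi> 0 = t * (D u (x + r *\<^sub>R u + t *\<^sub>R v) - D u (x + r *\<^sub>R u))" by auto
  have "\<exists>s>0. s < t \<and> D u (x + r *\<^sub>R u + t *\<^sub>R v) - D u (x + r *\<^sub>R u + 0 *\<^sub>R v)
     = (t - 0) * frechet_derivative (D u) (at (x + r *\<^sub>R u + s *\<^sub>R v)) v"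
  proof (rule MVT2[OF t])
    fix s assume s: "0 \<le> s" "s \<le> t"
    have 1: "((\<lambda>s. x + r *\<^sub>R u + s *\<^sub>R v) has_derivative (\<lambda>c. c *\<^sub>R v)) (at s)"
      by (auto intro!: derivative_eq_intros)
    have a: "x + r *\<^sub>R u + s *\<^sub>R v \<in> U" using U r s t by auto
    show "((\<lambda>s. D u (x + r *\<^sub>R u + s *\<^sub>R v)) has_real_derivative
        frechet_derivative (D u) (at (x + r *\<^sub>R u + s *\<^sub>R v)) v) (at s)"
      unfolding has_field_derivative_def
      by (rule has_derivative_eq_rhs[OF has_derivative_compose[OF 1 h2[OF a]]])
         (simp add: fun_eq_iff lin[OF h2[OF a]])
  qed
  then obtain s where s: "0 < s" "s < t" and
    e2: "D u (x + r *\<^sub>R u + t *\<^sub>R v) - D u (x + r *\<^sub>R u) = t * frechet_derivative (D u) (at (x + r *\<^sub>R u + s *\<^sub>R v)) v"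
    by auto
  have "h (x + t *\<^sub>R u + t *\<^sub>R v) - h (x + t *\<^sub>R u) - h (x + t *\<^sub>R v) + h x = \<phi> t - \<phi> 0"
    by (simp add: \<phi>_def)
  then show ?thesis using r s e1 e2 unfolding D_def by (metis mult.assoc)
qed

text \<open>The second difference is symmetric in \<open>u\<close> and \<open>v\<close>, so it
  equals \<open>t * t\<close> times either mixed derivative at some point near \<open>x\<close>.
  Both mixed derivatives are continuous, being themselves differentiable, and a positive gap between
  them at \<open>x\<close> is contradicted for small \<open>t\<close>.\<close>

lemma frechet_derivative_commute:
  fixes h :: "'a::real_normed_vector \<Rightarrow> real"
  assumes h: "smooth_on U h" "open U" and x: "x \<in> U"
  shows "frechet_derivative (\<lambda>y. frechet_derivative h (at y) u) (at x) v
       = frechet_derivative (\<lambda>y. frechet_derivative h (at y) v) (at x) u"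
proof -
  define A where "A u v y = frechet_derivative (\<lambda>y. frechet_derivative h (at y) u) (at y) v" for u v y
  have cont: "isCont (A u v) x" for u v
    using smooth_on_differentiable_at[OF smooth_on_frechet[OF smooth_on_frechet[OF h(1)]] h(2) x]
    unfolding A_def[abs_def] by (rule differentiable_imp_continuous_within)
  have "A u v x - A v u x = 0"
  proof (rule ccontr)
    assume ne: "A u v x - A v u x \<noteq> 0"
    define e where "e = \<bar>A u v x - A v u x\<bar> / 2"
    have e: "e > 0" using ne e_def by simp
    obtain d1 where d1: "d1 > 0" "\<And>y. dist y x < d1 \<Longrightarrow> dist (A u v y) (A u v x) < e"
      using cont[of u v] e unfolding continuous_at_eps_delta by blast
    obtain d2 where d2: "d2 > 0" "\<And>y. dist y x < d2 \<Longrightarrow> dist (A v u y) (A v u x) < e"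
      using cont[of v u] e unfolding continuous_at_eps_delta by blast
    obtain d3 where d3: "d3 > 0" "ball x d3 \<subseteq> U" using h(2) x openE by blast
    define d where "d = min d1 (min d2 d3)"
    \<comment> \<open>Makes every displacement by \<open>r\<close> along one vector and
      \<open>s\<close> along the other, with \<open>r\<close> and \<open>s\<close> at most
      \<open>t\<close>, no longer than \<open>d / 2\<close>; the summand 1 keeps the denominator
      positive when both vectors vanish.\<close>
    define t where "t = d / (2 * (norm u + norm v + 1))"
    have np: "norm u + norm v + 1 > 0" by (smt (verit) norm_ge_zero)
    have t: "t > 0" unfolding t_def using d1 d2 d3 np d_def by simp
    have near: "dist (x + r *\<^sub>R a + s *\<^sub>R b) x < d"
      if "0 \<le> r" "r \<le> t" "0 \<le> s" "s \<le> t" "(a, b) = (u, v) \<or> (a, b) = (v, u)" for r s a b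
    proof -
      have "dist (x + r *\<^sub>R a + s *\<^sub>R b) x = norm (r *\<^sub>R a + s *\<^sub>R b)" by (simp add: dist_norm algebra_simps)
      also have "\<dots> \<le> r * norm a + s * norm b"
        using norm_triangle_ineq[of "r *\<^sub>R a" "s *\<^sub>R b"] that by simp
      also have "\<dots> \<le> t * norm a + t * norm b" using that by (intro add_mono mult_right_mono) auto
      also have "\<dots> \<le> t * (norm u + norm v + 1)" using that(5) t by (auto simp: algebra_simps)
      also have "\<dots> = d / 2" unfolding t_def using np by (simp add: divide_simps)
      also have "\<dots> < d" using d1(1) d2(1) d3(1) d_def by linarith
      finally show ?thesis .
    qed
    have in_U: "x + r *\<^sub>R a + s *\<^sub>R b \<in> U"
      if "0 \<le> r" "r \<le> t" "0 \<le> s" "s \<le> t" "(a, b) = (u, v) \<or> (a, b) = (v, u)" for r s a b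
      using near[OF that] d3(2) unfolding d_def by (auto simp: dist_commute)
    obtain r s where rs: "0 < r" "r < t" "0 < s" "s < t"
      and 1: "h (x + t *\<^sub>R u + t *\<^sub>R v) - h (x + t *\<^sub>R u) - h (x + t *\<^sub>R v) + h x = t * t * A u v (x + r *\<^sub>R u + s *\<^sub>R v)"
      using second_difference_mvt[OF h t, of x u v] in_U unfolding A_def by blast
    obtain r' s' where rs': "0 < r'" "r' < t" "0 < s'" "s' < t"
      and 2: "h (x + t *\<^sub>R v + t *\<^sub>R u) - h (x + t *\<^sub>R v) - h (x + t *\<^sub>R u) + h x = t * t * A v u (x + r' *\<^sub>R v + s' *\<^sub>R u)"
      using second_difference_mvt[OF h t, of x v u] in_U unfolding A_def by blast
    have "t * t * A u v (x + r *\<^sub>R u + s *\<^sub>R v) = t * t * A v u (x + r' *\<^sub>R v + s' *\<^sub>R u)"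
      using 1 2 by (simp add: algebra_simps)
    then have eq: "A u v (x + r *\<^sub>R u + s *\<^sub>R v) = A v u (x + r' *\<^sub>R v + s' *\<^sub>R u)" using t by simp
    have "dist (A u v (x + r *\<^sub>R u + s *\<^sub>R v)) (A u v x) < e"
      by (rule d1(2)) (use near[of r s u v] rs d_def in auto)
    moreover have "dist (A v u (x + r' *\<^sub>R v + s' *\<^sub>R u)) (A v u x) < e"
      by (rule d2(2)) (use near[of r' s' v u] rs' d_def in auto)
    moreover have "\<bar>y - z\<bar> \<le> \<bar>c - y\<bar> + \<bar>c - z\<bar>" for y z c :: real by linarith
    ultimately show False using eq unfolding e_def dist_real_def
      by (smt (verit, best) field_sum_of_halves)
  qed
  then show ?thesis unfolding A_def by simp
qed

subsection \<open>Cutoff and test functions\<close>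

text \<open>The polynomial factor makes the family of flat functions closed under differentiation.\<close>
definition flat :: "real poly \<Rightarrow> real \<Rightarrow> real" where
  "flat P t = (if t \<le> 0 then 0 else poly P (1 / t) * exp (- (1 / t)))"

lemma tendsto_poly_exp_at_top: "((\<lambda>s. poly P s * exp (- s)) \<longlongrightarrow> (0::real)) at_top"
proof -
  have "((\<lambda>s. \<Sum>i\<le>degree P. coeff P i * (s ^ i / exp s)) \<longlongrightarrow> (\<Sum>i\<le>degree P. coeff P i * 0)) at_top"
    by (intro tendsto_sum tendsto_mult tendsto_const tendsto_power_div_exp_0)
  then show ?thesis
    by (simp add: poly_altdef exp_minus field_simps sum_distrib_left sum_distrib_right sum_divide_distrib)
qed

text \<open>With s = 1/t one has ds/dt = - s^2, and \<open>[:0, 0, 1:]\<close> is s^2; the minus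
  sign turns P' - P into \<open>P - pderiv P\<close>. At 0 the right difference quotient is s P(s)
  exp(-s), which tends to 0 as s grows, and the left one is 0.\<close>

lemma flat_has_derivative:
  "(flat P has_real_derivative flat ((P - pderiv P) * [:0, 0, 1:]) t) (at t)"
proof -
  consider "t < 0" | "t > 0" | "t = 0" by linarith
  then show ?thesis
  proof cases
    case 1
    have "((\<lambda>_. 0) has_real_derivative 0) (at t)" by simp
    then have "(flat P has_real_derivative 0) (at t)"
      by (rule has_field_derivative_transform_within_open[where S = "{..<0}"]) (use 1 in \<open>auto simp: flat_def\<close>)
    then show ?thesis using 1 by (simp add: flat_def)
  next
    case 2
    have "((\<lambda>t. poly P (1 / t) * exp (- (1 / t))) has_real_derivative
        flat ((P - pderiv P) * [:0, 0, 1:]) t) (at t)"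
    proof -
      have "((\<lambda>t. 1 / t) has_real_derivative - (1 / t) * (1 / t)) (at t)"
        using 2 by (auto intro!: derivative_eq_intros simp: field_simps)
      then have 1: "((\<lambda>t. poly P (1 / t)) has_real_derivative poly (pderiv P) (1 / t) * (- (1 / t) * (1 / t))) (at t)"
        and 3: "((\<lambda>t. exp (- (1 / t))) has_real_derivative exp (- (1 / t)) * - (- (1 / t) * (1 / t))) (at t)"
        by (rule DERIV_chain2[OF poly_DERIV], rule DERIV_fun_exp[OF DERIV_minus])
      show ?thesis
        by (rule DERIV_cong[OF DERIV_mult[OF 1 3]]) (use 2 in \<open>simp add: flat_def algebra_simps\<close>)
    qed
    then show ?thesis
      by (rule has_field_derivative_transform_within_open[where S = "{0<..}"]) (use 2 in \<open>auto simp: flat_def\<close>)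
  next
    case 3
    have l: "((\<lambda>y. (flat P y - flat P 0) / (y - 0)) \<longlongrightarrow> 0) (at_left 0)"
      by (rule tendsto_eventually)
         (auto simp: eventually_at_left_field flat_def intro!: exI[of _ "-1::real"])
    have "((\<lambda>y. poly (P * [:0, 1:]) (inverse y) * exp (- inverse y)) \<longlongrightarrow> 0) (at_right (0::real))"
      by (rule filterlim_compose[OF tendsto_poly_exp_at_top filterlim_inverse_at_top_right])
    then have r: "((\<lambda>y. (flat P y - flat P 0) / (y - 0)) \<longlongrightarrow> 0) (at_right 0)"
      by (rule Lim_transform_eventually)
         (auto simp: eventually_at_right_field flat_def field_simps intro!: exI[of _ "1::real"])
    show ?thesis using filterlim_split_at[OF l r] 3
      by (simp add: has_field_derivative_iff flat_def)
  qed
qed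

lemma flat_smooth: "smooth_on UNIV (flat P)"
proof -
  have "Ck n UNIV (flat P)" for n
  proof (induction n arbitrary: P)
    case (Suc n)
    show ?case
      by (rule Ck_SucI[OF open_UNIV flat_has_derivative[unfolded has_field_derivative_def]])
         (intro Ck_bilinear[OF bounded_bilinear_mult] open_UNIV Suc.IH Ck_const)
  qed simp
  then show ?thesis by (simp add: smooth_on_iff_Ck)
qed

lemma flat_1_mono: "s \<le> t \<Longrightarrow> flat 1 s \<le> flat 1 t"
  by (cases "s \<le> 0") (simp_all add: flat_def frac_le)

text \<open>Nesting the flat function avoids the usual quotient: the inner difference is the constant
  \<open>flat 1 1\<close> left of \<open>\<alpha>\<close> and nonpositive right of \<open>\<beta>\<close>.\<close>
definition step :: "real \<Rightarrow> real \<Rightarrow> real \<Rightarrow> real" where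
  "step \<alpha> \<beta> t = flat 1 (flat 1 1 - flat 1 ((t - \<alpha>) / (\<beta> - \<alpha>))) / flat 1 (flat 1 1)"

lemma flat_1_pos: "t > 0 \<Longrightarrow> flat 1 t > 0"
  by (simp add: flat_def)

lemma step_eq_1: "t \<le> \<alpha> \<Longrightarrow> \<alpha> < \<beta> \<Longrightarrow> step \<alpha> \<beta> t = 1"
proof -
  assume "t \<le> \<alpha>" "\<alpha> < \<beta>"
  then have "(t - \<alpha>) / (\<beta> - \<alpha>) \<le> 0" by (simp add: divide_nonpos_pos)
  then have "flat 1 ((t - \<alpha>) / (\<beta> - \<alpha>)) = 0" by (simp add: flat_def)
  then show ?thesis using flat_1_pos[OF flat_1_pos[of 1]] by (simp add: step_def)
qed

lemma step_eq_0: "t \<ge> \<beta> \<Longrightarrow> \<alpha> < \<beta> \<Longrightarrow> step \<alpha> \<beta> t = 0"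
proof -
  assume "t \<ge> \<beta>" "\<alpha> < \<beta>"
  then have "(t - \<alpha>) / (\<beta> - \<alpha>) \<ge> 1" by simp
  then have "flat 1 1 - flat 1 ((t - \<alpha>) / (\<beta> - \<alpha>)) \<le> 0" using flat_1_mono by simp
  then have "flat 1 (flat 1 1 - flat 1 ((t - \<alpha>) / (\<beta> - \<alpha>))) = 0" by (simp only: flat_def if_True)
  then show ?thesis by (simp add: step_def)
qed

lemma step_nonneg: "0 \<le> step \<alpha> \<beta> t"
  by (simp add: step_def flat_def)

lemma step_le_1: "step \<alpha> \<beta> t \<le> 1"
proof -
  have "flat 1 (flat 1 1 - flat 1 ((t - \<alpha>) / (\<beta> - \<alpha>))) \<le> flat 1 (flat 1 1)"
    by (rule flat_1_mono) (simp add: flat_def)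
  then show ?thesis using flat_1_pos[OF flat_1_pos[of 1]] by (simp add: step_def)
qed

lemma step_smooth: "smooth_on UNIV (step \<alpha> \<beta>)"
proof -
  define a where "a = inverse (\<beta> - \<alpha>)"
  have "smooth_on UNIV (\<lambda>t::real. a * t)"
    by (rule smooth_on_bounded_linear[OF open_UNIV bounded_linear_mult_right])
  then have "smooth_on UNIV (\<lambda>t. a * t - a * \<alpha>)"
    by (rule smooth_on_diff[OF open_UNIV _ smooth_on_const])
  then have "smooth_on UNIV (\<lambda>t. flat 1 (a * t - a * \<alpha>))"
    by (rule smooth_on_real_comp[OF open_UNIV flat_smooth])
  then have "smooth_on UNIV (\<lambda>t. flat 1 1 - flat 1 (a * t - a * \<alpha>))"
    by (rule smooth_on_diff[OF open_UNIV smooth_on_const])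
  then have "smooth_on UNIV (\<lambda>t. flat 1 (flat 1 1 - flat 1 (a * t - a * \<alpha>)))"
    by (rule smooth_on_real_comp[OF open_UNIV flat_smooth])
  then have "smooth_on UNIV (\<lambda>t. inverse (flat 1 (flat 1 1)) * flat 1 (flat 1 1 - flat 1 (a * t - a * \<alpha>)))"
    by (rule smooth_on_cmult[OF open_UNIV])
  moreover have "a * t - a * \<alpha> = (t - \<alpha>) / (\<beta> - \<alpha>)" for t
    by (simp add: a_def divide_inverse algebra_simps)
  ultimately show ?thesis by (simp add: step_def[abs_def] divide_inverse mult.commute)
qed

section \<open>Compactly supported smooth functions\<close>

definition test_fun :: "'a::real_normed_vector set \<Rightarrow> ('a \<Rightarrow> complex) \<Rightarrow> bool" where
  "test_fun \<Omega> f \<longleftrightarrow> smooth_on \<Omega> f \<and> (\<exists>K. compact K \<and> K \<subseteq> \<Omega> \<and> (\<forall>x. x \<notin> K \<longrightarrow> f x = 0))"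

lemma test_funI:
  "smooth_on \<Omega> f \<Longrightarrow> compact K \<Longrightarrow> K \<subseteq> \<Omega> \<Longrightarrow> (\<And>x. x \<notin> K \<Longrightarrow> f x = 0) \<Longrightarrow> test_fun \<Omega> f"
  unfolding test_fun_def by blast

lemma test_fun_smooth: "test_fun \<Omega> f \<Longrightarrow> smooth_on \<Omega> f"
  by (simp add: test_fun_def)

text \<open>\<open>test_fun\<close> asks for vanishing outside \<open>K\<close> on the whole space,
  so \<Omega> and the complement of \<open>K\<close> form an open cover and the function is smooth
  on both members. Derivatives of test functions can then be taken at every point.\<close>

lemma test_fun_smooth_UNIV:
  assumes "test_fun \<Omega> f" "open \<Omega>"
  shows "smooth_on UNIV f"
proof -
  obtain K where K: "compact K" "K \<subseteq> \<Omega>" "\<And>x. x \<notin> K \<Longrightarrow> f x = 0" "smooth_on \<Omega> f"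
    using assms unfolding test_fun_def by blast
  have o: "open (- K)" using K compact_imp_closed by auto
  have "smooth_on (- K) f"
    by (rule smooth_on_cong[OF o smooth_on_const[of _ 0]]) (use K in auto)
  moreover have "\<Omega> \<union> - K = UNIV" using K(2) by blast
  ultimately show ?thesis using smooth_on_Un[OF assms(2) o K(4)] by simp
qed

lemma test_fun_differentiable: "test_fun \<Omega> f \<Longrightarrow> open \<Omega> \<Longrightarrow> f differentiable (at x)"
  using test_fun_smooth_UNIV smooth_on_differentiable_at by blast

lemma test_fun_zero: "test_fun \<Omega> (\<lambda>x. 0)"
  by (rule test_funI[of _ _ "{}"]) (auto intro: smooth_on_const)

lemma test_fun_add: "open \<Omega> \<Longrightarrow> test_fun \<Omega> f \<Longrightarrow> test_fun \<Omega> h \<Longrightarrow> test_fun \<Omega> (\<lambda>x. f x + h x)"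
proof -
  assume a: "open \<Omega>" "test_fun \<Omega> f" "test_fun \<Omega> h"
  then obtain K K' where "compact K" "K \<subseteq> \<Omega>" "\<And>x. x \<notin> K \<Longrightarrow> f x = 0"
    "compact K'" "K' \<subseteq> \<Omega>" "\<And>x. x \<notin> K' \<Longrightarrow> h x = 0"
    unfolding test_fun_def by blast
  then show ?thesis
    by (intro test_funI[of _ _ "K \<union> K'"] smooth_on_add a(1) test_fun_smooth[OF a(2)] test_fun_smooth[OF a(3)]) auto
qed

lemma test_fun_mult:
  assumes "open \<Omega>" "smooth_on \<Omega> h" "test_fun \<Omega> f"
  shows "test_fun \<Omega> (\<lambda>x. h x * f x)"
proof -
  obtain K where "compact K" "K \<subseteq> \<Omega>" "\<And>x. x \<notin> K \<Longrightarrow> f x = 0" "smooth_on \<Omega> f"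
    using assms unfolding test_fun_def by blast
  then show ?thesis
    by (intro test_funI[of _ _ K] smooth_on_mult assms) auto
qed

lemma test_fun_cmult: "open \<Omega> \<Longrightarrow> test_fun \<Omega> f \<Longrightarrow> test_fun \<Omega> (\<lambda>x. c * f x)"
  by (rule test_fun_mult) (auto intro: smooth_on_const)

lemma test_fun_sum:
  "open \<Omega> \<Longrightarrow> (\<And>i. i \<in> I \<Longrightarrow> test_fun \<Omega> (f i)) \<Longrightarrow> test_fun \<Omega> (\<lambda>x. \<Sum>i\<in>I. f i x)"
  by (induction I rule: infinite_finite_induct) (auto intro!: test_fun_zero test_fun_add)

lemma test_fun_frechet:
  assumes "open \<Omega>" "test_fun \<Omega> f"
  shows "test_fun \<Omega> (\<lambda>x. frechet_derivative f (at x) v)"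
proof -
  obtain K where K: "compact K" "K \<subseteq> \<Omega>" "\<And>x. x \<notin> K \<Longrightarrow> f x = 0" "smooth_on \<Omega> f"
    using assms unfolding test_fun_def by blast
  show ?thesis
  proof (rule test_funI[OF smooth_on_frechet[OF K(4)] K(1,2)])
    fix x assume x: "x \<notin> K"
    have "((\<lambda>_. 0) has_derivative (\<lambda>_. 0)) (at x)" by simp
    then have "(f has_derivative (\<lambda>_. 0)) (at x)"
      by (rule has_derivative_transform_within_open[of _ _ _ _ "- K"])
         (use x K compact_imp_closed in auto)
    then show "frechet_derivative f (at x) v = 0"
      using frechet_derivative_at by metis
  qed
qed

subsection \<open>Wirtinger derivatives\<close>

text \<open>\<open>c = - \<i>\<close> and \<open>c = \<i>\<close> give the two Wirtinger operators.\<close>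
definition wirt :: "complex \<Rightarrow> 'n::{finite,linorder} \<Rightarrow> ((complex, 'n) vec \<Rightarrow> complex) \<Rightarrow> (complex, 'n) vec \<Rightarrow> complex" where
  "wirt c k f z = (frechet_derivative f (at z) (axis k 1) + c * frechet_derivative f (at z) (axis k \<i>)) / 2"

lemma wirt_z_eq_wirt: "wirt_z = wirt (- \<i>)"
  by (auto simp: fun_eq_iff wirt_z_def wirt_def)

lemma wirt_zbar_eq_wirt: "wirt_zbar = wirt \<i>"
  by (auto simp: fun_eq_iff wirt_zbar_def wirt_def)

lemma wirt_has_derivative:
  "(f has_derivative D) (at z) \<Longrightarrow> wirt c k f z = (D (axis k 1) + c * D (axis k \<i>)) / 2"
  by (simp add: wirt_def frechet_derivative_at[symmetric])

text \<open>Functions that agree near \<open>z\<close> have the same derivatives there, and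
  \<open>frechet_derivative\<close> is a choice from that common set; hence the equality holds even
  where nothing is differentiable.\<close>

lemma wirt_cong:
  assumes "open U" "z \<in> U" "\<And>y. y \<in> U \<Longrightarrow> f y = h y"
  shows "wirt c k f z = wirt c k h z"
proof -
  have "(f has_derivative D) (at z) \<longleftrightarrow> (h has_derivative D) (at z)" for D
    using has_derivative_transform_within_open[OF _ assms(1,2), of f D UNIV h]
      has_derivative_transform_within_open[OF _ assms(1,2), of h D UNIV f] assms(3) by metis
  then show ?thesis unfolding wirt_def frechet_derivative_def by simp
qed

lemma wirt_const [simp]: "wirt c k (\<lambda>z. a) z = 0"
  by (simp add: wirt_def)

lemma wirt_add:
  "f differentiable at z \<Longrightarrow> h differentiable at z \<Longrightarrow> wirt c k (\<lambda>z. f z + h z) z = wirt c k f z + wirt c k h z"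
  unfolding frechet_derivative_works
  by (subst wirt_has_derivative[OF has_derivative_add]) (auto simp: wirt_def field_simps)

lemma wirt_mult:
  "f differentiable at z \<Longrightarrow> h differentiable at z \<Longrightarrow> wirt c k (\<lambda>z. f z * h z) z = wirt c k f z * h z + f z * wirt c k h z"
  unfolding frechet_derivative_works
  by (subst wirt_has_derivative[OF has_derivative_mult]) (auto simp: wirt_def field_simps)

lemma wirt_cmult: "f differentiable at z \<Longrightarrow> wirt c k (\<lambda>z. a * f z) z = a * wirt c k f z"
  by (subst wirt_mult) auto

lemma wirt_multc: "f differentiable at z \<Longrightarrow> wirt c k (\<lambda>z. f z * a) z = wirt c k f z * a"
  by (subst wirt_mult) auto

lemma wirt_sum:
  "(\<And>i. i \<in> I \<Longrightarrow> f i differentiable at z) \<Longrightarrow> wirt c k (\<lambda>z. \<Sum>i\<in>I. f i z) z = (\<Sum>i\<in>I. wirt c k (f i) z)"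
  by (induction I rule: infinite_finite_induct) (auto simp: wirt_add)

lemma smooth_on_wirt: "open U \<Longrightarrow> smooth_on U f \<Longrightarrow> smooth_on U (wirt c k f)"
  using smooth_on_cmult[of U _ "1/2 :: complex", OF _ smooth_on_add[OF _ smooth_on_frechet smooth_on_cmult[OF _ smooth_on_frechet]]]
  by (simp add: wirt_def[abs_def])

lemma test_fun_wirt: "open \<Omega> \<Longrightarrow> test_fun \<Omega> f \<Longrightarrow> test_fun \<Omega> (wirt c k f)"
  using test_fun_cmult[of \<Omega> _ "1/2", OF _ test_fun_add[OF _ test_fun_frechet test_fun_cmult[OF _ test_fun_frechet]]]
  by (simp add: wirt_def[abs_def])

lemma wirt_eq_0_outside:
  "open U \<Longrightarrow> z \<in> U \<Longrightarrow> (\<And>y. y \<in> U \<Longrightarrow> f y = 0) \<Longrightarrow> wirt c k f z = 0"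
  using wirt_cong[of U z f "\<lambda>_. 0" c k] by simp

definition D2 :: "('a::real_normed_vector \<Rightarrow> real) \<Rightarrow> 'a \<Rightarrow> 'a \<Rightarrow> 'a \<Rightarrow> real" where
  "D2 h z u v = frechet_derivative (\<lambda>y. frechet_derivative h (at y) u) (at z) v"

lemma wirt_of_real:
  fixes h :: "(complex, 'n::{finite,linorder}) vec \<Rightarrow> real" and c :: complex
  assumes "h differentiable at z"
  shows "wirt c k (\<lambda>z. complex_of_real (h z)) z =
    (frechet_derivative h (at z) (axis k 1) + c * frechet_derivative h (at z) (axis k \<i>)) / 2"
  using assms unfolding frechet_derivative_works
  by (subst wirt_has_derivative[OF has_derivative_of_real]) auto

lemma wirt_wirt_of_real:
  fixes h :: "(complex, 'n::{finite,linorder}) vec \<Rightarrow> real" and c d :: complex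
  assumes h: "smooth_on U h" "open U" "z \<in> U"
  shows "wirt c k (wirt d l (\<lambda>z. complex_of_real (h z))) z =
    (D2 h z (axis l 1) (axis k 1) + d * D2 h z (axis l \<i>) (axis k 1)
     + c * D2 h z (axis l 1) (axis k \<i>) + c * d * D2 h z (axis l \<i>) (axis k \<i>)) / 4"
proof -
  have df: "(\<lambda>y. frechet_derivative h (at y) u) differentiable at z" for u
    using smooth_on_differentiable_at[OF smooth_on_frechet] h by blast
  have df': "(\<lambda>y. complex_of_real (frechet_derivative h (at y) u)) differentiable at z" for u
    using df[of u] has_derivative_of_real unfolding differentiable_def by blast
  have "wirt c k (wirt d l (\<lambda>z. complex_of_real (h z))) z
     = wirt c k (\<lambda>y. (1/2) * (complex_of_real (frechet_derivative h (at y) (axis l 1))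
              + d * frechet_derivative h (at y) (axis l \<i>))) z"
    using smooth_on_differentiable_at[OF h(1,2)]
    by (intro wirt_cong[OF h(2,3)]) (simp add: wirt_of_real field_simps)
  also have "\<dots> = (1/2) * (wirt c k (\<lambda>y. complex_of_real (frechet_derivative h (at y) (axis l 1))) z
        + d * wirt c k (\<lambda>y. complex_of_real (frechet_derivative h (at y) (axis l \<i>))) z)"
    by (simp only: wirt_cmult[OF differentiable_add[OF df' differentiable_mult[OF differentiable_const df']]]
        wirt_add[OF df' differentiable_mult[OF differentiable_const df']] wirt_cmult[OF df'])
  finally show ?thesis
    unfolding wirt_of_real[OF df] D2_def by (simp add: algebra_simps add_divide_distrib)
qed

subsection \<open>Exterior algebra\<close>

text \<open>Left exterior multiplication by dz_k; the sign is the cost of sorting k into the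
  remaining indices. With this operator, its conjugate and the (1,1)-version \<open>wedge11\<close>,
  signs are handled by anticommutation relations instead of associativity of
  \<open>pf_wedge\<close>.\<close>

definition wedge_dz :: "'n::{finite,linorder} \<Rightarrow> 'n pform \<Rightarrow> 'n pform" where
  "wedge_dz k w = (\<lambda>(I,J). if k \<in> I then perm_sign {k} (I - {k}) * w (I - {k}, J) else 0)"

text \<open>Left multiplication by dzbar_l. The power of -1 arises because dzbar_l has to pass all
  the dz factors, which come first in the normal form.\<close>

definition wedge_dzbar :: "'n::{finite,linorder} \<Rightarrow> 'n pform \<Rightarrow> 'n pform" where
  "wedge_dzbar l w = (\<lambda>(I,J). if l \<in> J then (-1) ^ card I * perm_sign {l} (J - {l}) * w (I, J - {l}) else 0)"

definition ext10 :: "('n::{finite,linorder} \<Rightarrow> complex) \<Rightarrow> 'n pform \<Rightarrow> 'n pform" where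
  "ext10 c w = (\<lambda>IJ. \<Sum>k\<in>UNIV. c k * wedge_dz k w IJ)"

definition ext01 :: "('n::{finite,linorder} \<Rightarrow> complex) \<Rightarrow> 'n pform \<Rightarrow> 'n pform" where
  "ext01 c w = (\<lambda>IJ. \<Sum>l\<in>UNIV. c l * wedge_dzbar l w IJ)"

definition wedge11 :: "('n::{finite,linorder} \<Rightarrow> 'n \<Rightarrow> complex) \<Rightarrow> 'n pform \<Rightarrow> 'n pform" where
  "wedge11 M w = (\<lambda>IJ. \<Sum>k\<in>UNIV. \<Sum>l\<in>UNIV. M k l * wedge_dz k (wedge_dzbar l w) IJ)"

definition pf_basis :: "'n set \<times> 'n set \<Rightarrow> ('n::{finite,linorder}) pform" where
  "pf_basis A = (\<lambda>IJ. if IJ = A then 1 else 0)"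

definition bideg :: "nat \<Rightarrow> nat \<Rightarrow> ('n::{finite,linorder}) pform \<Rightarrow> bool" where
  "bideg p q w \<longleftrightarrow> (\<forall>I J. w (I, J) \<noteq> 0 \<longrightarrow> card I = p \<and> card J = q)"

lemma perm_sign_singleton: "perm_sign {k} A = (-1) ^ card {b \<in> A. b < k}"
proof -
  have "{(a, b). a \<in> {k} \<and> b \<in> A \<and> b < a} = Pair k ` {b \<in> A. b < k}" by auto
  then show ?thesis unfolding perm_sign_def by (simp add: card_image inj_on_def)
qed

lemma perm_sign_empty [simp]: "perm_sign {} A = 1" "perm_sign A {} = 1"
  by (auto simp: perm_sign_def)

lemma perm_sign_sq: "perm_sign A B * perm_sign A B = 1"
  by (simp add: perm_sign_def flip: power_mult_distrib)

lemma perm_sign_remove: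
  fixes k l :: "'n::{finite,linorder}"
  assumes "l \<in> A"
  shows "perm_sign {k} A = (if l < k then -1 else 1) * perm_sign {k} (A - {l})"
proof -
  have "card {b \<in> A. b < k} = (if l < k then 1 else 0) + card {b \<in> A - {l}. b < k}"
  proof (cases "l < k")
    case True
    then have "{b \<in> A. b < k} = insert l {b \<in> A - {l}. b < k}" using assms by auto
    then show ?thesis using True by simp
  next
    case False
    then have "{b \<in> A. b < k} = {b \<in> A - {l}. b < k}" by auto
    then show ?thesis using False by simp
  qed
  then show ?thesis unfolding perm_sign_singleton by (simp add: power_add)
qed

lemma minus_one_pow_remove: "k \<in> I \<Longrightarrow> finite I \<Longrightarrow> (-1::complex) ^ card I = - ((-1) ^ card (I - {k}))"
  by (metis card_Suc_Diff1 mult_minus1 power_Suc)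

text \<open>Removing the other index first changes exactly one of the two sorting signs, because
  exactly one of k < l and l < k holds.\<close>

lemma wedge_dz_wedge_dz: "wedge_dz k (wedge_dz l w) = (\<lambda>IJ. - wedge_dz l (wedge_dz k w) IJ)"
proof (cases "k = l")
  case True
  then show ?thesis by (auto simp: wedge_dz_def fun_eq_iff)
next
  case False
  show ?thesis
  proof
    fix IJ :: "'a set \<times> 'a set"
    obtain I J where IJ: "IJ = (I, J)" by (cases IJ)
    have sw: "I - {l} - {k} = I - {k} - {l}" by auto
    show "wedge_dz k (wedge_dz l w) IJ = - wedge_dz l (wedge_dz k w) IJ"
    proof (cases "k \<in> I \<and> l \<in> I")
      case True
      then have "perm_sign {k} (I - {k}) = (if l < k then -1 else 1) * perm_sign {k} (I - {k} - {l})"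
        "perm_sign {l} (I - {l}) = (if k < l then -1 else 1) * perm_sign {l} (I - {k} - {l})"
        using False perm_sign_remove[of l "I - {k}" k] perm_sign_remove[of k "I - {l}" l] sw by auto
      note * = this
      have 1: "wedge_dz k (wedge_dz l w) (I, J) = perm_sign {k} (I - {k}) * (perm_sign {l} (I - {k} - {l}) * w (I - {k} - {l}, J))"
        using True False by (simp add: wedge_dz_def)
      have 2: "wedge_dz l (wedge_dz k w) (I, J) = perm_sign {l} (I - {l}) * (perm_sign {k} (I - {k} - {l}) * w (I - {k} - {l}, J))"
        using True False by (simp add: wedge_dz_def sw)
      show ?thesis unfolding IJ 1 2 * using False by auto
    qed (auto simp: wedge_dz_def IJ)
  qed
qed

lemma wedge_dzbar_wedge_dzbar: "wedge_dzbar k (wedge_dzbar l w) = (\<lambda>IJ. - wedge_dzbar l (wedge_dzbar k w) IJ)"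
proof (cases "k = l")
  case True
  then show ?thesis by (auto simp: wedge_dzbar_def fun_eq_iff)
next
  case False
  show ?thesis
  proof
    fix IJ :: "'a set \<times> 'a set"
    obtain I J where IJ: "IJ = (J, I)" by (cases IJ)
    have sw: "I - {l} - {k} = I - {k} - {l}" by auto
    show "wedge_dzbar k (wedge_dzbar l w) IJ = - wedge_dzbar l (wedge_dzbar k w) IJ"
    proof (cases "k \<in> I \<and> l \<in> I")
      case True
      then have "perm_sign {k} (I - {k}) = (if l < k then -1 else 1) * perm_sign {k} (I - {k} - {l})"
        "perm_sign {l} (I - {l}) = (if k < l then -1 else 1) * perm_sign {l} (I - {k} - {l})"
        using False perm_sign_remove[of l "I - {k}" k] perm_sign_remove[of k "I - {l}" l] sw by auto
      note * = this
      have 1: "wedge_dzbar k (wedge_dzbar l w) (J, I) = (-1) ^ card J * perm_sign {k} (I - {k}) * ((-1) ^ card J * perm_sign {l} (I - {k} - {l}) * w (J, I - {k} - {l}))"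
        using True False by (simp add: wedge_dzbar_def)
      have 2: "wedge_dzbar l (wedge_dzbar k w) (J, I) = (-1) ^ card J * perm_sign {l} (I - {l}) * ((-1) ^ card J * perm_sign {k} (I - {k} - {l}) * w (J, I - {k} - {l}))"
        using True False by (simp add: wedge_dzbar_def sw)
      show ?thesis unfolding IJ 1 2 * using False by auto
    qed (auto simp: wedge_dzbar_def IJ)
  qed
qed

lemma wedge_dz_wedge_dzbar: "wedge_dz k (wedge_dzbar l w) = (\<lambda>IJ. - wedge_dzbar l (wedge_dz k w) IJ)"
  by (auto simp: wedge_dz_def wedge_dzbar_def fun_eq_iff minus_one_pow_remove)

lemma wedge_dz_sum: "wedge_dz k (\<lambda>IJ. \<Sum>i\<in>A. c i * w i IJ) = (\<lambda>IJ. \<Sum>i\<in>A. c i * wedge_dz k (w i) IJ)"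
  by (auto simp: wedge_dz_def fun_eq_iff sum_distrib_left algebra_simps)

lemma wedge_dzbar_sum: "wedge_dzbar k (\<lambda>IJ. \<Sum>i\<in>A. c i * w i IJ) = (\<lambda>IJ. \<Sum>i\<in>A. c i * wedge_dzbar k (w i) IJ)"
  by (auto simp: wedge_dzbar_def fun_eq_iff sum_distrib_left algebra_simps)

lemma wedge_dz_cmult: "wedge_dz k (\<lambda>IJ. c * w IJ) = (\<lambda>IJ. c * wedge_dz k w IJ)"
  by (auto simp: wedge_dz_def fun_eq_iff)

lemma wedge_dzbar_cmult: "wedge_dzbar k (\<lambda>IJ. c * w IJ) = (\<lambda>IJ. c * wedge_dzbar k w IJ)"
  by (auto simp: wedge_dzbar_def fun_eq_iff)

lemma wedge_dz_add: "wedge_dz k (\<lambda>IJ. v IJ + w IJ) = (\<lambda>IJ. wedge_dz k v IJ + wedge_dz k w IJ)"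
  by (auto simp: wedge_dz_def fun_eq_iff algebra_simps)

lemma wedge_dzbar_add: "wedge_dzbar k (\<lambda>IJ. v IJ + w IJ) = (\<lambda>IJ. wedge_dzbar k v IJ + wedge_dzbar k w IJ)"
  by (auto simp: wedge_dzbar_def fun_eq_iff algebra_simps)

lemma wedge_dz_uminus: "wedge_dz k (\<lambda>IJ. - w IJ) = (\<lambda>IJ. - wedge_dz k w IJ)"
  by (auto simp: wedge_dz_def fun_eq_iff)

lemma wedge_dz_zero: "wedge_dz k (\<lambda>IJ. 0) = (\<lambda>IJ. 0)" and wedge_dzbar_zero: "wedge_dzbar k (\<lambda>IJ. 0) = (\<lambda>IJ. 0)"
  by (auto simp: wedge_dz_def wedge_dzbar_def fun_eq_iff)

lemma wedge11_cmult: "wedge11 M (\<lambda>IJ. c * w IJ) = (\<lambda>IJ. c * wedge11 M w IJ)"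
  by (simp add: wedge11_def wedge_dz_cmult wedge_dzbar_cmult sum_distrib_left algebra_simps)

lemma wedge11_add: "wedge11 M (\<lambda>IJ. v IJ + w IJ) = (\<lambda>IJ. wedge11 M v IJ + wedge11 M w IJ)"
  by (simp add: wedge11_def wedge_dz_add wedge_dzbar_add sum.distrib algebra_simps)

lemma wedge11_zero: "wedge11 M (\<lambda>IJ. 0) = (\<lambda>IJ. 0)"
  by (simp add: wedge11_def wedge_dz_zero wedge_dzbar_zero)

lemma wedge11_add_left: "wedge11 (\<lambda>k l. M k l + N k l) w IJ = wedge11 M w IJ + wedge11 N w IJ"
  by (simp add: wedge11_def sum.distrib algebra_simps)

lemma wedge11_cmult_left: "wedge11 (\<lambda>k l. c * M k l) w IJ = c * wedge11 M w IJ"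
  by (simp add: wedge11_def sum_distrib_left algebra_simps)

lemma wedge11_rank1: "wedge11 (\<lambda>k l. c k * d l) w = ext10 c (ext01 d w)"
  by (simp add: wedge11_def ext10_def ext01_def wedge_dz_sum sum_distrib_left algebra_simps)

lemma ext10_anticomm: "ext10 c (ext10 d w) = (\<lambda>IJ. - ext10 d (ext10 c w) IJ)"
proof
  fix IJ
  have "ext10 c (ext10 d w) IJ = (\<Sum>k\<in>UNIV. \<Sum>l\<in>UNIV. c k * d l * wedge_dz k (wedge_dz l w) IJ)"
    by (simp add: ext10_def wedge_dz_sum sum_distrib_left algebra_simps)
  also have "\<dots> = (\<Sum>l\<in>UNIV. \<Sum>k\<in>UNIV. - (c k * d l * wedge_dz l (wedge_dz k w) IJ))"
    by (subst sum.swap, subst wedge_dz_wedge_dz) simp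
  also have "\<dots> = - ext10 d (ext10 c w) IJ"
    by (simp add: ext10_def wedge_dz_sum sum_distrib_left algebra_simps sum_negf)
  finally show "ext10 c (ext10 d w) IJ = - ext10 d (ext10 c w) IJ" .
qed

lemma ext01_anticomm: "ext01 c (ext01 d w) = (\<lambda>IJ. - ext01 d (ext01 c w) IJ)"
proof
  fix IJ
  have "ext01 c (ext01 d w) IJ = (\<Sum>k\<in>UNIV. \<Sum>l\<in>UNIV. c k * d l * wedge_dzbar k (wedge_dzbar l w) IJ)"
    by (simp add: ext01_def wedge_dzbar_sum sum_distrib_left algebra_simps)
  also have "\<dots> = (\<Sum>l\<in>UNIV. \<Sum>k\<in>UNIV. - (c k * d l * wedge_dzbar l (wedge_dzbar k w) IJ))"
    by (subst sum.swap, subst wedge_dzbar_wedge_dzbar) simp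
  also have "\<dots> = - ext01 d (ext01 c w) IJ"
    by (simp add: ext01_def wedge_dzbar_sum sum_distrib_left algebra_simps sum_negf)
  finally show "ext01 c (ext01 d w) IJ = - ext01 d (ext01 c w) IJ" .
qed

lemma ext10_ext01: "ext10 c (ext01 d w) = (\<lambda>IJ. - ext01 d (ext10 c w) IJ)"
proof
  fix IJ
  have "ext10 c (ext01 d w) IJ = (\<Sum>k\<in>UNIV. \<Sum>l\<in>UNIV. c k * d l * wedge_dz k (wedge_dzbar l w) IJ)"
    by (simp add: ext10_def ext01_def wedge_dz_sum sum_distrib_left algebra_simps)
  also have "\<dots> = (\<Sum>l\<in>UNIV. \<Sum>k\<in>UNIV. - (c k * d l * wedge_dzbar l (wedge_dz k w) IJ))"
    by (subst sum.swap, subst wedge_dz_wedge_dzbar) simp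
  also have "\<dots> = - ext01 d (ext10 c w) IJ"
    by (simp add: ext10_def ext01_def wedge_dzbar_sum sum_distrib_left algebra_simps sum_negf)
  finally show "ext10 c (ext01 d w) IJ = - ext01 d (ext10 c w) IJ" .
qed

lemma ext10_zero: "ext10 c (\<lambda>IJ. 0) = (\<lambda>IJ. 0)" and ext01_zero: "ext01 c (\<lambda>IJ. 0) = (\<lambda>IJ. 0)"
  by (simp_all add: ext10_def ext01_def wedge_dz_zero wedge_dzbar_zero)

lemma ext10_uminus: "ext10 c (\<lambda>IJ. - w IJ) = (\<lambda>IJ. - ext10 c w IJ)"
  by (simp add: ext10_def wedge_dz_uminus sum_negf)

text \<open>A rank-one (1,1)-form is a product of two one-forms, so a one-form passes it at the cost
  of two signs.\<close>

lemma ext10_wedge11_rank1: "ext10 a (wedge11 (\<lambda>k l. c k * d l) w) = wedge11 (\<lambda>k l. c k * d l) (ext10 a w)"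
  unfolding wedge11_rank1
  by (subst ext10_anticomm, subst ext10_ext01) (simp add: ext10_uminus)

lemma ext01_wedge11_rank1: "ext01 a (wedge11 (\<lambda>k l. c k * d l) w) = wedge11 (\<lambda>k l. c k * d l) (ext01 a w)"
proof -
  have "ext01 a (ext10 c (ext01 d w)) = (\<lambda>IJ. - ext10 c (ext01 a (ext01 d w)) IJ)"
    by (subst ext10_ext01) simp
  then show ?thesis unfolding wedge11_rank1
    by (simp only: ext01_anticomm[of a d w] ext10_uminus minus_minus)
qed

section \<open>Wedge products as iterated multiplications by one-forms\<close>

lemma pf_wedge_basis:
  "pf_wedge (pf_basis (A, B)) w (I, J) = (if A \<subseteq> I \<and> B \<subseteq> J then
     (-1) ^ (card B * card (I - A)) * perm_sign A (I - A) * perm_sign B (J - B) * w (I - A, J - B) else 0)"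
proof -
  have "pf_wedge (pf_basis (A, B)) w (I, J) = (\<Sum>I1\<in>Pow I. if I1 = A then \<Sum>J1\<in>Pow J. if J1 = B then
     (-1) ^ (card B * card (I - A)) * perm_sign A (I - A) * perm_sign B (J - B) * w (I - A, J - B) else 0 else 0)"
    unfolding pf_wedge_def pf_basis_def prod.case
  proof (rule sum.cong[OF refl])
    fix I1
    show "(\<Sum>J1\<in>Pow J. (-1) ^ (card J1 * card (I - I1)) * perm_sign I1 (I - I1) * perm_sign J1 (J - J1)
        * (if (I1, J1) = (A, B) then 1 else 0) * w (I - I1, J - J1)) =
      (if I1 = A then \<Sum>J1\<in>Pow J. if J1 = B then
     (-1) ^ (card B * card (I - A)) * perm_sign A (I - A) * perm_sign B (J - B) * w (I - A, J - B) else 0 else 0)"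
    proof (cases "I1 = A")
      case True
      show ?thesis unfolding True if_P[OF refl] by (rule sum.cong[OF refl]) simp
    qed simp
  qed
  then show ?thesis by (auto simp: sum.delta)
qed

lemma pf_wedge_sum_left: "pf_wedge (\<lambda>IJ. \<Sum>i\<in>A. c i * u i IJ) w = (\<lambda>IJ. \<Sum>i\<in>A. c i * pf_wedge (u i) w IJ)"
proof -
  have add: "pf_wedge (\<lambda>IJ. a * u IJ + v IJ) w IJ = a * pf_wedge u w IJ + pf_wedge v w IJ" for a u v IJ
    by (cases IJ) (simp add: pf_wedge_def sum.distrib sum_distrib_left algebra_simps)
  have zero: "pf_wedge (\<lambda>IJ. 0) w = (\<lambda>IJ. 0)" by (auto simp: pf_wedge_def fun_eq_iff)
  show ?thesis
    by (induction A rule: infinite_finite_induct) (auto simp: zero add fun_eq_iff)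
qed

lemma pf_wedge_basis10: "pf_wedge (pf_basis ({k}, {})) w = wedge_dz k w"
  by (auto simp: fun_eq_iff pf_wedge_basis wedge_dz_def)

lemma pf_wedge_basis11: "pf_wedge (pf_basis ({k}, {l})) w = wedge_dz k (wedge_dzbar l w)"
  by (auto simp: fun_eq_iff pf_wedge_basis wedge_dz_def wedge_dzbar_def)

lemma wedge_dzbar_one: "wedge_dzbar l pf_one = pf_basis ({}, {l})"
  by (auto simp: fun_eq_iff wedge_dzbar_def pf_one_def pf_basis_def)

lemma wedge_dz_wedge_dzbar_one: "wedge_dz k (wedge_dzbar l pf_one) = pf_basis ({k}, {l})"
  unfolding wedge_dzbar_one by (auto simp: fun_eq_iff wedge_dz_def pf_basis_def)

lemma wedge11_pairs: "wedge11 M w IJ = (\<Sum>q\<in>UNIV. M (fst q) (snd q) * wedge_dz (fst q) (wedge_dzbar (snd q) w) IJ)"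
  unfolding wedge11_def sum.cartesian_product UNIV_Times_UNIV by (simp add: case_prod_beta)

lemma pf_wedge_wedge11_one: "pf_wedge (wedge11 M pf_one) w = wedge11 M w"
  unfolding wedge11_pairs[abs_def] pf_wedge_sum_left wedge_dz_wedge_dzbar_one pf_wedge_basis11 ..

lemma pf10_sum: "pf10 a = (\<lambda>IJ. \<Sum>k\<in>UNIV. a $ k * pf_basis ({k}, {}) IJ)"
proof
  fix IJ :: "'a set \<times> 'a set"
  obtain I J where IJ: "IJ = (I, J)" by (cases IJ)
  show "pf10 a IJ = (\<Sum>k\<in>UNIV. a $ k * pf_basis ({k}, {}) IJ)"
  proof (cases "J = {} \<and> (\<exists>k. I = {k})")
    case True
    then obtain k where k: "J = {}" "I = {k}" by auto
    have "(\<Sum>i\<in>UNIV. a $ i * pf_basis ({i}, {}) IJ) = (\<Sum>i\<in>UNIV. if i = k then a $ i else 0)"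
      by (rule sum.cong) (auto simp: pf_basis_def IJ k)
    then show ?thesis by (simp add: pf10_def IJ k)
  qed (auto simp: pf10_def IJ pf_basis_def intro!: sum.neutral)
qed

lemma pf01_sum: "pf01 a = (\<lambda>IJ. \<Sum>k\<in>UNIV. cnj (a $ k) * pf_basis ({}, {k}) IJ)"
proof
  fix IJ :: "'a set \<times> 'a set"
  obtain I J where IJ: "IJ = (I, J)" by (cases IJ)
  show "pf01 a IJ = (\<Sum>k\<in>UNIV. cnj (a $ k) * pf_basis ({}, {k}) IJ)"
  proof (cases "I = {} \<and> (\<exists>k. J = {k})")
    case True
    then obtain k where k: "I = {}" "J = {k}" by auto
    have "(\<Sum>i\<in>UNIV. cnj (a $ i) * pf_basis ({}, {i}) IJ) = (\<Sum>i\<in>UNIV. if i = k then cnj (a $ i) else 0)"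
      by (rule sum.cong) (auto simp: pf_basis_def IJ k)
    then show ?thesis by (simp add: pf01_def IJ k)
  qed (auto simp: pf01_def IJ pf_basis_def intro!: sum.neutral)
qed

text \<open>The head factor is \<i> times a one-form times its conjugate, that is, a rank-one matrix
  acting through \<open>wedge11\<close>. This is the form in which elementary positive forms are
  used from here on.\<close>

lemma elem_pos_Cons:
  "elem_pos (a # as) = wedge11 (\<lambda>k l. \<i> * (a $ k * cnj (a $ l))) (elem_pos as)"
proof -
  have 1: "pf_wedge (pf10 a) (pf01 a) = wedge11 (\<lambda>k l. a $ k * cnj (a $ l)) pf_one"
    unfolding wedge11_rank1 ext10_def ext01_def wedge_dzbar_one
    by (subst pf10_sum) (simp add: pf_wedge_sum_left pf_wedge_basis10 flip: pf01_sum)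
  have 2: "(\<lambda>IJ. \<i> * wedge11 (\<lambda>k l. a $ k * cnj (a $ l)) pf_one IJ) = wedge11 (\<lambda>k l. \<i> * (a $ k * cnj (a $ l))) pf_one"
    by (simp add: fun_eq_iff wedge11_cmult_left)
  show ?thesis unfolding elem_pos_def by (simp add: 1 2 pf_wedge_wedge11_one)
qed

lemma elem_pos_Cons': "elem_pos (a # as) = (\<lambda>IJ. \<i> * wedge11 (\<lambda>k l. a $ k * cnj (a $ l)) (elem_pos as) IJ)"
  unfolding elem_pos_Cons by (simp add: fun_eq_iff wedge11_cmult_left)

text \<open>One-forms commute with the (1,1)-factors, so the multiplication can be moved to the
  factor that contains \<open>a\<close>, where the product of \<open>a\<close> with itself
  vanishes.\<close>

lemma ext10_elem_pos:
  assumes "a \<in> set as"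
  shows "ext10 (\<lambda>k. a $ k) (elem_pos as) = (\<lambda>IJ. 0)"
proof -
  have sc: "ext10 c (\<lambda>IJ. x * w IJ) = (\<lambda>IJ. x * ext10 c w IJ)" for c x w
    by (simp add: ext10_def wedge_dz_cmult sum_distrib_left algebra_simps)
  have sq: "ext10 c (ext10 c w) = (\<lambda>IJ. 0)" for c w
    using ext10_anticomm[of c c w] by (auto simp: fun_eq_iff)
  show ?thesis using assms
  proof (induction as)
    case (Cons b bs)
    show ?case
    proof (cases "a \<in> set bs")
      case True
      then show ?thesis using Cons.IH by (simp add: elem_pos_Cons' sc ext10_wedge11_rank1 wedge11_zero)
    next
      case False
      then have "a = b" using Cons.prems by simp
      then show ?thesis by (simp add: elem_pos_Cons' sc wedge11_rank1 sq)
    qed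
  qed simp
qed

lemma ext01_elem_pos:
  assumes "a \<in> set as"
  shows "ext01 (\<lambda>k. cnj (a $ k)) (elem_pos as) = (\<lambda>IJ. 0)"
proof -
  have sc: "ext01 c (\<lambda>IJ. x * w IJ) = (\<lambda>IJ. x * ext01 c w IJ)" for c x w
    by (simp add: ext01_def wedge_dzbar_cmult sum_distrib_left algebra_simps)
  have sq: "ext01 c (ext01 c w) = (\<lambda>IJ. 0)" for c w
    using ext01_anticomm[of c c w] by (auto simp: fun_eq_iff)
  show ?thesis using assms
  proof (induction as)
    case (Cons b bs)
    show ?case
    proof (cases "a \<in> set bs")
      case True
      then show ?thesis using Cons.IH by (simp add: elem_pos_Cons' sc ext01_wedge11_rank1 wedge11_zero)
    next
      case False
      then have "a = b" using Cons.prems by simp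
      then show ?thesis by (simp add: elem_pos_Cons' sc ext01_wedge11_rank1) 
         (simp add: wedge11_rank1 sq ext10_zero)
    qed
  qed simp
qed

lemma wedge11_left_elem_pos: "a \<in> set as \<Longrightarrow> wedge11 (\<lambda>k l. a $ k * d l) (elem_pos as) = (\<lambda>IJ. 0)"
  unfolding wedge11_rank1 by (subst ext10_ext01) (simp add: ext10_elem_pos ext01_zero)

lemma wedge11_right_elem_pos: "a \<in> set as \<Longrightarrow> wedge11 (\<lambda>k l. c k * cnj (a $ l)) (elem_pos as) = (\<lambda>IJ. 0)"
  unfolding wedge11_rank1 by (simp add: ext01_elem_pos ext10_zero)

lemma bideg_wedge_dz:
  assumes "bideg p q w"
  shows "bideg (Suc p) q (wedge_dz k w)"
  unfolding bideg_def
proof (intro allI impI)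
  fix I J assume "wedge_dz k w (I, J) \<noteq> 0"
  then have "k \<in> I" "w (I - {k}, J) \<noteq> 0" by (auto simp: wedge_dz_def split: if_splits)
  then show "card I = Suc p \<and> card J = q"
    using assms card_Suc_Diff1[of I k] by (auto simp: bideg_def)
qed

lemma bideg_wedge_dzbar:
  assumes "bideg p q w"
  shows "bideg p (Suc q) (wedge_dzbar k w)"
  unfolding bideg_def
proof (intro allI impI)
  fix I J assume "wedge_dzbar k w (I, J) \<noteq> 0"
  then have "k \<in> J" "w (I, J - {k}) \<noteq> 0" by (auto simp: wedge_dzbar_def split: if_splits)
  then show "card I = p \<and> card J = Suc q"
    using assms card_Suc_Diff1[of J k] by (auto simp: bideg_def)
qed

lemma bideg_sum:
  assumes "\<And>i. i \<in> A \<Longrightarrow> bideg p q (w i)"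
  shows "bideg p q (\<lambda>IJ. \<Sum>i\<in>A. c i * w i IJ)"
  unfolding bideg_def
proof (intro allI impI)
  fix I J assume "(\<Sum>i\<in>A. c i * w i (I, J)) \<noteq> 0"
  then obtain i where "i \<in> A" "c i * w i (I, J) \<noteq> 0" using sum.not_neutral_contains_not_neutral by blast
  then show "card I = p \<and> card J = q" using assms[of i] by (auto simp: bideg_def)
qed

lemma bideg_wedge11: "bideg p q w \<Longrightarrow> bideg (Suc p) (Suc q) (wedge11 M w)"
  unfolding wedge11_pairs[abs_def] by (rule bideg_sum[OF bideg_wedge_dz[OF bideg_wedge_dzbar]])

lemma bideg_elem_pos: "bideg (length as) (length as) (elem_pos as)"
proof (induction as)
  case Nil
  then show ?case by (auto simp: bideg_def elem_pos_def pf_one_def)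
next
  case (Cons a as)
  then show ?case by (simp add: elem_pos_Cons bideg_wedge11)
qed

section \<open>Elementary positive forms as generators\<close>

lemma wedge11_single: "wedge11 (\<lambda>x y. if x = k then if y = l then 1 else 0 else 0) w = wedge_dz k (wedge_dzbar l w)"
proof
  fix IJ
  have "wedge11 (\<lambda>x y. if x = k then if y = l then 1 else 0 else 0) w IJ =
    (\<Sum>x\<in>UNIV. if x = k then \<Sum>y\<in>UNIV. if y = l then wedge_dz x (wedge_dzbar y w) IJ else 0 else 0)"
    unfolding wedge11_def
  proof (rule sum.cong[OF refl])
    fix x :: 'a
    show "(\<Sum>la\<in>UNIV. (if x = k then if la = l then 1 else 0 else 0) * wedge_dz x (wedge_dzbar la w) IJ) =
      (if x = k then \<Sum>y\<in>UNIV. if y = l then wedge_dz x (wedge_dzbar y w) IJ else 0 else 0)"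
    proof (cases "x = k")
      case True
      show ?thesis unfolding if_P[OF True] by (rule sum.cong[OF refl]) simp
    qed simp
  qed
  then show "wedge11 (\<lambda>x y. if x = k then if y = l then 1 else 0 else 0) w IJ = wedge_dz k (wedge_dzbar l w) IJ"
    by simp
qed

text \<open>Polarization over the fourth roots of unity: with e_k + c e_l as covector, weighting by
  c and summing leaves only the entry (k, l), since the sums of c and of c^2 vanish while c times
  its conjugate is 1 four times. The denominator also cancels the \<i> of the positive form.\<close>

lemma wedge_dz_wedge_dzbar_polarization:
  fixes w :: "('n::{finite,linorder}) pform"
  defines "b \<equiv> \<lambda>c k l. \<chi> x::'n. (if x = k then 1 else 0) + c * (if x = l then 1 else 0)"
  shows "wedge_dz k (wedge_dzbar l w) = (\<lambda>IJ. \<Sum>c\<in>{1, \<i>, -1, -\<i>}. c / (4 * \<i>) * wedge11 (\<lambda>x y. \<i> * (b c k l $ x * cnj (b c k l $ y))) w IJ)"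
proof -
  define M where "M = (\<lambda>c x y. \<i> * (b c k l $ x * cnj (b c k l $ y)))"
  have "(if x = k then if y = l then 1 else 0 else 0) =
     1 / (4 * \<i>) * M 1 x y + (\<i> / (4 * \<i>) * M \<i> x y + (- 1 / (4 * \<i>) * M (-1) x y + - \<i> / (4 * \<i>) * M (-\<i>) x y))" for x y
    by (simp add: M_def b_def field_simps)
  then have *: "wedge_dz k (wedge_dzbar l w) = wedge11 (\<lambda>x y. 1 / (4 * \<i>) * M 1 x y + (\<i> / (4 * \<i>) * M \<i> x y
      + (- 1 / (4 * \<i>) * M (-1) x y + - \<i> / (4 * \<i>) * M (-\<i>) x y))) w"
    by (simp only: flip: wedge11_single)
  have ne: "\<i> \<noteq> 1" "\<i> \<noteq> - 1" "- \<i> \<noteq> 1" "\<i> \<noteq> - \<i>" "- 1 \<noteq> \<i>" "1 \<noteq> \<i>" "(1::complex) \<noteq> - 1" "1 \<noteq> - \<i>" "-1 \<noteq> - \<i>"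
    by (auto simp: complex_eq_iff)
  have four: "(\<Sum>c\<in>{1, \<i>, -1, -\<i>}. f c) = f 1 + (f \<i> + (f (-1) + f (-\<i>)))" for f :: "complex \<Rightarrow> complex"
    using ne by simp
  show ?thesis
    unfolding * by (simp only: four wedge11_add_left wedge11_cmult_left M_def fun_eq_iff simp_thms)
qed

lemma pf_basis_expand: "w = (\<lambda>IJ. \<Sum>A\<in>UNIV. w A * pf_basis A IJ)"
  for w :: "('n::{finite,linorder}) pform"
proof
  fix IJ
  have "(\<Sum>A\<in>UNIV. w A * pf_basis A IJ) = (\<Sum>A\<in>UNIV. if A = IJ then w A else 0)"
    by (rule sum.cong) (auto simp: pf_basis_def)
  then show "w IJ = (\<Sum>A\<in>UNIV. w A * pf_basis A IJ)" by simp
qed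

lemma wedge_dz_wedge_dzbar_pf_basis:
  assumes "k \<in> I" "l \<in> J"
  shows "pf_basis (I, J) = (\<lambda>IJ. perm_sign {k} (I - {k}) * ((-1) ^ card (I - {k}) * perm_sign {l} (J - {l}))
    * wedge_dz k (wedge_dzbar l (pf_basis (I - {k}, J - {l}))) IJ)"
proof
  fix AB :: "'a set \<times> 'a set"
  obtain A B where AB: "AB = (A, B)" by (cases AB)
  show "pf_basis (I, J) AB = perm_sign {k} (I - {k}) * ((-1) ^ card (I - {k}) * perm_sign {l} (J - {l}))
    * wedge_dz k (wedge_dzbar l (pf_basis (I - {k}, J - {l}))) AB"
  proof (cases "AB = (I, J)")
    case True
    have "perm_sign {k} (I - {k}) * ((-1) ^ card (I - {k}) * perm_sign {l} (J - {l})) *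
       (perm_sign {k} (I - {k}) * ((-1) ^ card (I - {k}) * perm_sign {l} (J - {l}))) =
       (perm_sign {k} (I - {k}) * perm_sign {k} (I - {k})) * ((-1) ^ card (I - {k}) * (-1) ^ card (I - {k}))
       * (perm_sign {l} (J - {l}) * perm_sign {l} (J - {l}))" by (simp only: ac_simps)
    also have "\<dots> = 1" by (simp only: perm_sign_sq) (simp flip: power_mult_distrib)
    finally show ?thesis using True assms by (simp add: wedge_dz_def wedge_dzbar_def pf_basis_def)
  next
    case False
    then have "\<not> (k \<in> A \<and> l \<in> B \<and> A - {k} = I - {k} \<and> B - {l} = J - {l})"
      using assms AB by auto
    then have "wedge_dz k (wedge_dzbar l (pf_basis (I - {k}, J - {l}))) AB = 0"
      unfolding wedge_dz_def wedge_dzbar_def pf_basis_def AB prod.case prod.inject by (simp only: if_False if_True mult_zero_right split: if_split) blast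
    then show ?thesis using False by (simp add: pf_basis_def)
  qed
qed

text \<open>Induction on \<open>p\<close> peels off one pair dz_k, dzbar_l, which polarization turns
  into elementary factors. \<open>P\<close> is any predicate closed under linear combinations, not
  membership in a span, so that convergence statements can be inserted directly.\<close>

lemma elem_pos_span:
  fixes w :: "('n::{finite,linorder}) pform"
  assumes zero: "P (\<lambda>_. 0)" and add: "\<And>v w. P v \<Longrightarrow> P w \<Longrightarrow> P (\<lambda>IJ. v IJ + w IJ)"
    and scale: "\<And>c w. P w \<Longrightarrow> P (\<lambda>IJ. c * w IJ)"
    and ep: "\<And>as. length as = p \<Longrightarrow> P (elem_pos as)" and bd: "bideg p p w"
  shows "P w"
proof -
  \<comment> \<open>Only terms with nonzero coefficient have to satisfy \<open>Q\<close>; at the end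
    this discards the basis forms whose bidegree is not (p,p).\<close>
  have sum: "Q (\<lambda>IJ. \<Sum>i\<in>A. c i * v i IJ)"
    if "Q (\<lambda>_. 0)" "\<And>v w. Q v \<Longrightarrow> Q w \<Longrightarrow> Q (\<lambda>IJ. v IJ + w IJ)" "\<And>c w. Q w \<Longrightarrow> Q (\<lambda>IJ. c * w IJ)"
      "\<And>i. i \<in> A \<Longrightarrow> c i \<noteq> 0 \<Longrightarrow> Q (v i)" for A :: "'i set" and c v and Q :: "'n pform \<Rightarrow> bool"
    using that(4)
  proof (induction A rule: infinite_finite_induct)
    case (insert a A)
    have "Q (\<lambda>IJ. c a * v a IJ)" by (cases "c a = 0") (use that insert in auto)
    moreover have "Q (\<lambda>IJ. \<Sum>i\<in>A. c i * v i IJ)" using insert by auto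
    ultimately show ?case using that(2) insert.hyps by simp
  qed (use that in auto)
  have basis: "P (pf_basis (I, J))" if "card I = p" "card J = p" for I J
    using that zero add scale ep
  proof (induction p arbitrary: P I J)
    case 0
    then have "pf_basis (I, J) = elem_pos []" by (auto simp: elem_pos_def pf_one_def pf_basis_def fun_eq_iff)
    then show ?case using 0 by simp
  next
    case (Suc p)
    obtain k l where kl: "k \<in> I" "l \<in> J" using Suc.prems(1,2) by (metis card_0_eq ex_in_conv finite nat.distinct(1))
    \<comment> \<open>The induction hypothesis is applied to the predicate precomposed with
      multiplication by dz_k and dzbar_l, which is again closed under linear combinations.\<close>
    have "P (wedge_dz k (wedge_dzbar l (pf_basis (I - {k}, J - {l}))))"
    proof (rule Suc.IH[of "I - {k}" "J - {l}" "\<lambda>v. P (wedge_dz k (wedge_dzbar l v))"])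
      show "card (I - {k}) = p" "card (J - {l}) = p" using Suc.prems(1,2) kl by auto
      show "P (wedge_dz k (wedge_dzbar l (\<lambda>_. 0)))" by (simp add: wedge_dz_zero wedge_dzbar_zero Suc.prems)
      fix as :: "(complex, 'n) vec list" assume as: "length as = p"
      show "P (wedge_dz k (wedge_dzbar l (elem_pos as)))"
        unfolding wedge_dz_wedge_dzbar_polarization[of k l]
        unfolding elem_pos_Cons[symmetric]
        by (rule sum) (use Suc.prems as in auto)
    qed (simp_all add: wedge_dz_add wedge_dzbar_add wedge_dz_cmult wedge_dzbar_cmult Suc.prems)
    then show ?case by (subst wedge_dz_wedge_dzbar_pf_basis[OF kl]) (rule Suc.prems)
  qed
  show ?thesis
    by (subst pf_basis_expand, rule sum[OF zero add scale]) (use basis bd in \<open>auto simp: bideg_def\<close>)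
qed

lemma tendsto_elem_pos:
  assumes "\<And>i. i \<in> set xs \<Longrightarrow> (\<lambda>n. \<Lambda>s n i) \<longlonglongrightarrow> \<Lambda> i"
  shows "(\<lambda>n. elem_pos (map (\<Lambda>s n) xs) IJ) \<longlonglongrightarrow> elem_pos (map \<Lambda> xs) IJ"
  using assms
proof (induction xs arbitrary: IJ)
  case Nil
  then show ?case by simp
next
  case (Cons x xs)
  have wedge_dz: "(\<lambda>n. wedge_dz k (wedge_dzbar l (elem_pos (map (\<Lambda>s n) xs))) IJ) \<longlonglongrightarrow> wedge_dz k (wedge_dzbar l (elem_pos (map \<Lambda> xs))) IJ" for k l IJ
    using Cons by (cases IJ) (auto simp: wedge_dz_def wedge_dzbar_def intro!: tendsto_intros)
  show ?case
    using Cons.prems by (auto simp: elem_pos_Cons wedge11_def intro!: tendsto_intros wedge_dz)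
qed

text \<open>Linear predicates on forms with finitely many coefficients cut out closed sets, and
  \<open>elem_pos\<close> depends continuously on its covectors. Hence a dense set of good covector
  tuples already makes all tuples good.\<close>

lemma elem_pos_dense_span:
  fixes w :: "('n::{finite,linorder}) pform"
  assumes zero: "P (\<lambda>_. 0)" and add: "\<And>v w. P v \<Longrightarrow> P w \<Longrightarrow> P (\<lambda>IJ. v IJ + w IJ)"
    and scale: "\<And>c w. P w \<Longrightarrow> P (\<lambda>IJ. c * w IJ)"
    and dense: "\<And>\<Lambda> e. e > 0 \<Longrightarrow> \<exists>\<Lambda>'. (\<forall>i<m. norm (\<Lambda>' i - \<Lambda> i) < e) \<and> P (elem_pos (map \<Lambda>' [0..<m]))"
    and bd: "bideg m m w"
  shows "P w"
proof (rule elem_pos_span[OF zero add scale _ bd])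
  fix as :: "(complex, 'n) vec list" assume as: "length as = m"
  have vec: "($) (vec_lambda f) = f" for f :: "'n set \<times> 'n set \<Rightarrow> complex" by (simp add: fun_eq_iff)
  \<comment> \<open>Forms are recoded as vectors indexed by pairs of index sets, in order to have a
    Euclidean space in which subspaces are closed.\<close>
  define S where "S = {v :: (complex, 'n set \<times> 'n set) vec. P (\<lambda>IJ. v $ IJ)}"
  have "($) (0 :: (complex, 'n set \<times> 'n set) vec) = (\<lambda>_. 0)"
    "($) (x + y) = (\<lambda>IJ. x $ IJ + y $ IJ)" "($) (r *\<^sub>R x) = (\<lambda>IJ. complex_of_real r * x $ IJ)"
    for x y :: "(complex, 'n set \<times> 'n set) vec" and r
    by (simp_all add: fun_eq_iff) (simp add: scaleR_conv_of_real)
  then have "subspace S"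
    unfolding S_def by (intro subspaceI) (simp_all add: zero add scale)
  then have cl: "closed S" by (rule closed_subspace)
  have "\<forall>n::nat. \<exists>\<Lambda>'. (\<forall>i<m. norm (\<Lambda>' i - as ! i) < inverse (real (Suc n))) \<and> P (elem_pos (map \<Lambda>' [0..<m]))"
    by (intro allI dense) simp
  then obtain \<Lambda>s where \<Lambda>s: "\<And>n i. i < m \<Longrightarrow> norm (\<Lambda>s n i - as ! i) < inverse (real (Suc n))"
    "\<And>n. P (elem_pos (map (\<Lambda>s n) [0..<m]))" by metis
  have lim: "(\<lambda>n. \<Lambda>s n i) \<longlonglongrightarrow> as ! i" if "i < m" for i
    unfolding LIM_zero_iff[symmetric, of "\<lambda>n. \<Lambda>s n i"]
    by (rule Lim_null_comparison[OF _ LIMSEQ_inverse_real_of_nat])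
       (intro always_eventually allI less_imp_le \<Lambda>s(1) that)
  have as': "map ((!) as) [0..<m] = as" using as by (auto intro: nth_equalityI)
  have "(\<lambda>n. \<chi> IJ. elem_pos (map (\<Lambda>s n) [0..<m]) IJ) \<longlonglongrightarrow> (\<chi> IJ. elem_pos (map ((!) as) [0..<m]) IJ)"
    by (intro vec_tendstoI, unfold vec_lambda_beta, rule tendsto_elem_pos) (simp add: lim)
  then have "(\<chi> IJ. elem_pos as IJ) \<in> S"
    unfolding as' by (rule closed_sequentially[OF cl, rotated]) (use \<Lambda>s(2) in \<open>auto simp: S_def vec\<close>)
  then show "P (elem_pos as)" by (simp add: S_def vec)
qed

lemma mult_cnj_cmod: "z * cnj z = complex_of_real ((cmod z)\<^sup>2)"
  by (rule complex_norm_square[symmetric])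

subsection \<open>Positive semidefinite Hermitian matrices\<close>

definition psd :: "('n::finite \<Rightarrow> 'n \<Rightarrow> complex) \<Rightarrow> bool" where
  "psd M \<longleftrightarrow> (\<forall>k l. M l k = cnj (M k l)) \<and> (\<forall>b. 0 \<le> Re (\<Sum>k\<in>UNIV. \<Sum>l\<in>UNIV. M k l * (b k * cnj (b l))))"

text \<open>Isolates the dependence on the coordinate \<open>x\<close> as a quadratic expression in
  \<open>s\<close>, with the column functional \<open>L\<close> as linear part and the pivot
  \<open>M x x\<close> as leading coefficient. The elimination below optimises over
  \<open>s\<close>.\<close>

lemma hermitian_form_shift:
  fixes M :: "'n::finite \<Rightarrow> 'n \<Rightarrow> complex" and x :: 'n
  assumes "\<And>k l. M l k = cnj (M k l)"
  defines "Q \<equiv> \<lambda>b. Re (\<Sum>k\<in>UNIV. \<Sum>l\<in>UNIV. M k l * (b k * cnj (b l)))"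
    and "L \<equiv> \<lambda>b. \<Sum>k\<in>UNIV. M k x * b k"
  shows "Q (\<lambda>k. b k + (if k = x then s else 0)) = Q b + 2 * Re (cnj s * L b) + (cmod s)\<^sup>2 * Re (M x x)"
proof -
  let ?d = "\<lambda>k. if k = x then s else 0"
  have 1: "(\<Sum>k\<in>UNIV. \<Sum>l\<in>UNIV. M k l * (b k * cnj (?d l))) = cnj s * L b"
  proof -
    have "(\<Sum>k\<in>UNIV. \<Sum>l\<in>UNIV. M k l * (b k * cnj (?d l))) = (\<Sum>k\<in>UNIV. \<Sum>l\<in>UNIV. if l = x then M k l * (b k * cnj s) else 0)"
      by (intro sum.cong refl) auto
    then show ?thesis by (simp add: L_def sum_distrib_left algebra_simps)
  qed
  have 2: "(\<Sum>k\<in>UNIV. \<Sum>l\<in>UNIV. M k l * (?d k * cnj (b l))) = s * cnj (L b)"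
  proof -
    have "(\<Sum>k\<in>UNIV. \<Sum>l\<in>UNIV. M k l * (?d k * cnj (b l))) = (\<Sum>k\<in>UNIV. if k = x then \<Sum>l\<in>UNIV. M k l * (s * cnj (b l)) else 0)"
      by (intro sum.cong refl) auto
    also have "\<dots> = (\<Sum>l\<in>UNIV. cnj (M l x) * (s * cnj (b l)))"
      using assms(1)[of x] by (simp add: assms(1)[of _ x, symmetric])
    finally show ?thesis by (simp add: L_def sum_distrib_left algebra_simps)
  qed
  have 3: "(\<Sum>k\<in>UNIV. \<Sum>l\<in>UNIV. M k l * (?d k * cnj (?d l))) = M x x * (s * cnj s)"
  proof -
    have "(\<Sum>k\<in>UNIV. \<Sum>l\<in>UNIV. M k l * (?d k * cnj (?d l))) = (\<Sum>k\<in>UNIV. if k = x then \<Sum>l\<in>UNIV. if l = x then M k l * (s * cnj s) else 0 else 0)"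
    proof (rule sum.cong[OF refl])
      fix k
      show "(\<Sum>l\<in>UNIV. M k l * (?d k * cnj (?d l))) = (if k = x then \<Sum>l\<in>UNIV. if l = x then M k l * (s * cnj s) else 0 else 0)"
      proof (cases "k = x")
        case True
        show ?thesis unfolding if_P[OF True] by (rule sum.cong[OF refl]) simp
      qed simp
    qed
    then show ?thesis by simp
  qed
  have "(\<Sum>k\<in>UNIV. \<Sum>l\<in>UNIV. M k l * ((b k + ?d k) * cnj (b l + ?d l))) =
     (\<Sum>k\<in>UNIV. \<Sum>l\<in>UNIV. M k l * (b k * cnj (b l))) + (\<Sum>k\<in>UNIV. \<Sum>l\<in>UNIV. M k l * (b k * cnj (?d l)))
     + (\<Sum>k\<in>UNIV. \<Sum>l\<in>UNIV. M k l * (?d k * cnj (b l))) + (\<Sum>k\<in>UNIV. \<Sum>l\<in>UNIV. M k l * (?d k * cnj (?d l)))"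
    unfolding sum.distrib[symmetric] by (intro sum.cong refl) (simp only: complex_cnj_add algebra_simps)
  then show ?thesis unfolding 1 2 3 Q_def
    by (simp add: mult_cnj_cmod algebra_simps flip: of_real_power)
qed

text \<open>Cholesky elimination: \<open>N\<close> bounds the rows and columns that may be nonzero.
  Each round removes the index \<open>x\<close>, either because its row and column already vanish or
  by subtracting one rank-one matrix.\<close>

lemma psd_rank1_decomposition:
  fixes M :: "'n::finite \<Rightarrow> 'n \<Rightarrow> complex"
  assumes "finite N" "psd M" "\<And>k l. k \<notin> N \<or> l \<notin> N \<Longrightarrow> M k l = 0"
  shows "\<exists>as :: (complex, 'n) vec list. \<forall>k l. M k l = (\<Sum>a\<leftarrow>as. a $ k * cnj (a $ l))"
  using assms
proof (induction N arbitrary: M rule: finite_induct)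
  case empty
  then show ?case by (intro exI[of _ "[]"]) auto
next
  case (insert x N)
  define Q where "Q M b = Re (\<Sum>k\<in>UNIV. \<Sum>l\<in>UNIV. M k l * (b k * cnj (b l)))" for M and b :: "'n \<Rightarrow> complex"
  define L where "L b = (\<Sum>k\<in>UNIV. M k x * b k)" for b
  have herm: "M l k = cnj (M k l)" and pos: "0 \<le> Q M b" for k l b
    using insert.prems(1) unfolding psd_def Q_def by blast+
  have shift: "Q M (\<lambda>k. b k + (if k = x then s else 0)) = Q M b + 2 * Re (cnj s * L b) + (cmod s)\<^sup>2 * Re (M x x)" for b s
    unfolding Q_def L_def by (rule hermitian_form_shift) (rule herm)
  have "Q M (\<lambda>k. 0 + (if k = x then 1 else 0)) = Re (M x x)"
    unfolding shift by (simp add: Q_def L_def)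
  then have d0: "Re (M x x) \<ge> 0" using pos by metis
  have real: "M x x = of_real (Re (M x x))" using herm[of x x] by (simp add: complex_eq_iff)
  show ?case
  proof (cases "Re (M x x) = 0")
    case True
    have "M y x = 0" for y
    proof (rule ccontr)
      assume ne: "M y x \<noteq> 0"
      define b :: "'n \<Rightarrow> complex" where "b k = (if k = y then 1 else 0)" for k
      have L: "L b = M y x"
      proof -
        have "L b = (\<Sum>k\<in>UNIV. if k = y then M k x else 0)" unfolding L_def b_def by (intro sum.cong) auto
        then show ?thesis by simp
      qed
      \<comment> \<open>With a zero pivot the form is affine in the size of the shift, so it can be
        driven below zero; this \<open>r\<close> makes the value exactly -1.\<close>
      define r where "r = (Q M b + 1) / (2 * (cmod (M y x))\<^sup>2)"
      have "0 \<le> Q M b + 2 * Re (cnj (- (of_real r * M y x)) * M y x)"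
        using pos[of "\<lambda>k. b k + (if k = x then - (of_real r * M y x) else 0)"] unfolding shift L True by simp
      also have "Re (cnj (- (of_real r * M y x)) * M y x) = - (r * (cmod (M y x))\<^sup>2)"
      proof -
        have "cnj (- (of_real r * M y x)) * M y x = - (of_real r * (M y x * cnj (M y x)))" by simp
        then show ?thesis unfolding mult_cnj_cmod by (simp flip: of_real_power of_real_mult)
      qed
      also have "Q M b + 2 * - (r * (cmod (M y x))\<^sup>2) = - 1" proof -
        have "r * (cmod (M y x))\<^sup>2 = (Q M b + 1) / 2" using ne by (simp add: r_def)
        then show ?thesis by simp
      qed
      finally show False by simp
    qed
    moreover from this have "M x y = 0" for y using herm[of x y] by simp
    ultimately have "M k l = 0" if "k \<notin> N \<or> l \<notin> N" for k l
      using insert.prems(2)[of k l] that by (metis insert_iff)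
    then show ?thesis using insert.IH[OF insert.prems(1)] by blast
  next
    case False
    define d where "d = Re (M x x)"
    have d: "d > 0" "M x x = of_real d" using False d0 real d_def by auto
    \<comment> \<open>Column \<open>x\<close> divided by the square root of the pivot:
      \<open>M'\<close> below is then the Schur complement, whose row and column \<open>x\<close>
      vanish.\<close>
    define a :: "(complex, 'n) vec" where "a = (\<chi> k. M k x / of_real (sqrt d))"
    have sq: "complex_of_real (sqrt d) * of_real (sqrt d) = of_real d" using d by (simp flip: of_real_mult)
    have aa: "a $ k * cnj (a $ l) = M k x * M x l / of_real d" for k l
      using sq herm[of x l] by (simp add: a_def)
    define M' where "M' k l = M k l - a $ k * cnj (a $ l)" for k l
    have "Q M' b \<ge> 0" for b
    proof -
      have S: "(\<Sum>k\<in>UNIV. a $ k * b k) = L b / of_real (sqrt d)"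
        by (simp add: a_def L_def sum_divide_distrib)
      have "(\<Sum>k\<in>UNIV. \<Sum>l\<in>UNIV. M' k l * (b k * cnj (b l))) = (\<Sum>k\<in>UNIV. \<Sum>l\<in>UNIV. M k l * (b k * cnj (b l)))
         - (\<Sum>k\<in>UNIV. a $ k * b k) * cnj (\<Sum>l\<in>UNIV. a $ l * b l)"
        by (simp add: M'_def sum_subtractf right_diff_distrib sum_product ac_simps)
      then have "Q M' b = Q M b - Re ((L b / of_real (sqrt d)) * cnj (L b / of_real (sqrt d)))"
        unfolding Q_def S by simp
      also have "(L b / of_real (sqrt d)) * cnj (L b / of_real (sqrt d)) = of_real ((cmod (L b))\<^sup>2 / d)"
        using sq by (simp add: mult_cnj_cmod)
      finally have 1: "Q M' b = Q M b - (cmod (L b))\<^sup>2 / d" by simp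
      \<comment> \<open>This shift minimises the form over the coordinate \<open>x\<close>, and the
        minimum is exactly \<open>Q M' b\<close>.\<close>
      have "0 \<le> Q M (\<lambda>k. b k + (if k = x then - (L b / of_real d) else 0))" by (rule pos)
      also have "\<dots> = Q M b + 2 * Re (cnj (- (L b / of_real d)) * L b) + (cmod (L b / of_real d))\<^sup>2 * d"
        unfolding shift d_def by simp
      also have "cnj (- (L b / of_real d)) * L b = of_real (- ((cmod (L b))\<^sup>2 / d))"
        by (simp add: mult_cnj_cmod mult.commute[of "cnj _"])
      also have "(cmod (L b / of_real d))\<^sup>2 * d = (cmod (L b))\<^sup>2 / d"
        using d by (simp add: norm_divide power_divide power2_eq_square)
      finally show ?thesis unfolding 1 by simp
    qed
    moreover have "M' l k = cnj (M' k l)" for k l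
      using herm[of l k] by (simp add: M'_def mult.commute)
    ultimately have "psd M'" unfolding psd_def Q_def by blast
    moreover have "M' k l = 0" if kl: "k \<notin> N \<or> l \<notin> N" for k l
    proof (cases "k = x \<or> l = x")
      case True
      then show ?thesis using d by (auto simp: M'_def aa)
    next
      case False
      then have "k \<notin> insert x N \<or> l \<notin> insert x N" using kl by auto
      then have "M k l = 0" "M k x = 0 \<or> M x l = 0" using insert.prems(2) by blast+
      then show ?thesis by (auto simp: M'_def aa)
    qed
    ultimately obtain as :: "(complex, 'n) vec list" where "\<forall>k l. M' k l = (\<Sum>a\<leftarrow>as. a $ k * cnj (a $ l))"
      using insert.IH by blast
    then have "\<forall>k l. M k l = (\<Sum>a\<leftarrow>a # as. a $ k * cnj (a $ l))"
      by (simp add: M'_def algebra_simps)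
    then show ?thesis by blast
  qed
qed

section \<open>The cone of strongly positive forms\<close>

lemma strongly_pos_zero: "strongly_pos q (\<lambda>IJ. 0)"
  unfolding strongly_pos_def by (intro exI[of _ "[]"]) auto

lemma strongly_pos_add:
  assumes "strongly_pos q v" "strongly_pos q w"
  shows "strongly_pos q (\<lambda>IJ. v IJ + w IJ)"
proof -
  obtain F F' where "\<forall>(c, as)\<in>set F. c \<ge> 0 \<and> length as = q" "\<forall>(c, as)\<in>set F'. c \<ge> 0 \<and> length as = q"
    "v = (\<lambda>IJ. \<Sum>(c, as)\<leftarrow>F. complex_of_real c * elem_pos as IJ)"
    "w = (\<lambda>IJ. \<Sum>(c, as)\<leftarrow>F'. complex_of_real c * elem_pos as IJ)"
    using assms unfolding strongly_pos_def by blast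
  then show ?thesis unfolding strongly_pos_def by (intro exI[of _ "F @ F'"]) auto
qed

lemma strongly_pos_elem:
  "c \<ge> 0 \<Longrightarrow> length as = q \<Longrightarrow> strongly_pos q (\<lambda>IJ. complex_of_real c * elem_pos as IJ)"
  unfolding strongly_pos_def by (intro exI[of _ "[(c, as)]"]) auto

lemma strongly_pos_induct [consumes 1, case_names zero add]:
  assumes "strongly_pos q w" "P (\<lambda>IJ. 0)"
    and "\<And>c as w. c \<ge> 0 \<Longrightarrow> length as = q \<Longrightarrow> P w \<Longrightarrow> P (\<lambda>IJ. complex_of_real c * elem_pos as IJ + w IJ)"
  shows "P w"
proof -
  obtain F where F: "\<forall>(c, as)\<in>set F. c \<ge> 0 \<and> length as = q"
    "w = (\<lambda>IJ. \<Sum>(c, as)\<leftarrow>F. complex_of_real c * elem_pos as IJ)"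
    using assms(1) unfolding strongly_pos_def by blast
  from F(1) have "P (\<lambda>IJ. \<Sum>(c, as)\<leftarrow>F. complex_of_real c * elem_pos as IJ)"
    by (induction F) (auto simp: assms(2) intro!: assms(3))
  then show ?thesis using F by simp
qed

lemma strongly_pos_scale:
  assumes "r \<ge> 0" "strongly_pos q w"
  shows "strongly_pos q (\<lambda>IJ. complex_of_real r * w IJ)"
  using assms(2)
proof (induction rule: strongly_pos_induct)
  case zero
  then show ?case by (simp add: strongly_pos_zero)
next
  case (add c as w)
  have "strongly_pos q (\<lambda>IJ. complex_of_real (r * c) * elem_pos as IJ)"
    by (rule strongly_pos_elem) (use add assms in auto)
  from strongly_pos_add[OF this add.IH] show ?case by (simp add: algebra_simps)
qed

lemma strongly_pos_wedge11_rank1: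
  assumes "strongly_pos q w"
  shows "strongly_pos (Suc q) (wedge11 (\<lambda>k l. \<i> * (a $ k * cnj (a $ l))) w)"
  using assms
proof (induction rule: strongly_pos_induct)
  case zero
  then show ?case by (simp add: wedge11_zero strongly_pos_zero)
next
  case (add c as w)
  show ?case unfolding wedge11_add wedge11_cmult elem_pos_Cons[symmetric]
    by (rule strongly_pos_add[OF strongly_pos_elem add.IH]) (use add in auto)
qed

text \<open>The rank-one decomposition reduces \<open>M\<close> to summands that merely prepend one
  covector to each list in the definition of strong positivity.\<close>

lemma strongly_pos_wedge11:
  fixes M :: "'n::{finite,linorder} \<Rightarrow> 'n \<Rightarrow> complex"
  assumes "psd M" "strongly_pos q w"
  shows "strongly_pos (Suc q) (wedge11 (\<lambda>k l. \<i> * M k l) w)"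
proof -
  obtain as :: "(complex, 'n) vec list" where as: "\<And>k l. M k l = (\<Sum>a\<leftarrow>as. a $ k * cnj (a $ l))"
    using psd_rank1_decomposition[OF _ assms(1), of UNIV] by auto
  have "strongly_pos (Suc q) (wedge11 (\<lambda>k l. \<i> * (\<Sum>a\<leftarrow>as. a $ k * cnj (a $ l))) w)"
  proof (induction as)
    case Nil
    then show ?case by (simp add: wedge11_def strongly_pos_zero)
  next
    case (Cons a as)
    show ?case using strongly_pos_add[OF strongly_pos_wedge11_rank1[OF assms(2)] Cons.IH, of a]
      by (simp add: distrib_left flip: wedge11_add_left)
  qed
  then show ?thesis by (simp add: as)
qed

definition scaled_form :: "((complex, 'n::{finite,linorder}) vec \<Rightarrow> complex) \<Rightarrow> 'n pform \<Rightarrow> 'n form" where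
  "scaled_form F w = (\<lambda>z IJ. F z * w IJ)"

subsection \<open>The Levi form\<close>

text \<open>Twice the complex Hessian; taking both orders of differentiation makes it Hermitian for real
  functions without appealing to the symmetry of second derivatives.\<close>
definition levi :: "((complex, 'n::{finite,linorder}) vec \<Rightarrow> complex) \<Rightarrow> (complex, 'n) vec \<Rightarrow> 'n \<Rightarrow> 'n \<Rightarrow> complex" where
  "levi F z k l = wirt_z k (wirt_zbar l F) z + wirt_zbar l (wirt_z k F) z"

lemma ext10_apply: "ext10 c w (I, J) = (\<Sum>k\<in>I. c k * (perm_sign {k} (I - {k}) * w (I - {k}, J)))"
  unfolding ext10_def wedge_dz_def prod.case by (rule sum.mono_neutral_cong_right) auto

lemma ext01_apply: "ext01 c w (I, J) = (\<Sum>l\<in>J. c l * ((-1) ^ card I * perm_sign {l} (J - {l}) * w (I, J - {l})))"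
  unfolding ext01_def wedge_dzbar_def prod.case by (rule sum.mono_neutral_cong_right) auto

lemma del_sum_scaled_form:
  assumes "\<And>i. i \<in> A \<Longrightarrow> F i differentiable at z"
  shows "del (\<lambda>z IJ. \<Sum>i\<in>A. F i z * W i IJ) z IJ = (\<Sum>i\<in>A. ext10 (\<lambda>k. wirt_z k (F i) z) (W i) IJ)"
proof -
  obtain I J where IJ: "IJ = (I, J)" by (cases IJ)
  have "wirt_z k (\<lambda>w. \<Sum>i\<in>A. F i w * W i X) z = (\<Sum>i\<in>A. wirt_z k (F i) z * W i X)" for k X
    unfolding wirt_z_eq_wirt
    by (subst wirt_sum) (auto intro!: sum.cong wirt_multc differentiable_mult assms)
  then show ?thesis
    unfolding del_def IJ prod.case ext10_apply
    by (subst sum.swap) (simp add: sum_distrib_left ac_simps)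
qed

lemma delbar_sum_scaled_form:
  assumes "\<And>i. i \<in> A \<Longrightarrow> F i differentiable at z"
  shows "delbar (\<lambda>z IJ. \<Sum>i\<in>A. F i z * W i IJ) z IJ = (\<Sum>i\<in>A. ext01 (\<lambda>k. wirt_zbar k (F i) z) (W i) IJ)"
proof -
  obtain I J where IJ: "IJ = (I, J)" by (cases IJ)
  have "wirt_zbar k (\<lambda>w. \<Sum>i\<in>A. F i w * W i X) z = (\<Sum>i\<in>A. wirt_zbar k (F i) z * W i X)" for k X
    unfolding wirt_zbar_eq_wirt
    by (subst wirt_sum) (auto intro!: sum.cong wirt_multc differentiable_mult assms)
  then show ?thesis
    unfolding delbar_def IJ prod.case ext01_apply
    by (subst sum.swap) (simp add: sum_distrib_left ac_simps)
qed

lemma del_cong: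
  assumes "open U" "z \<in> U" "\<And>y. y \<in> U \<Longrightarrow> u y = v y"
  shows "del u z = del v z"
proof -
  have "wirt_z k (\<lambda>w. u w X) z = wirt_z k (\<lambda>w. v w X) z" for k X
    unfolding wirt_z_eq_wirt by (rule wirt_cong[OF assms(1,2)]) (simp add: assms(3))
  then show ?thesis unfolding del_def by simp
qed

lemma delbar_cong:
  assumes "open U" "z \<in> U" "\<And>y. y \<in> U \<Longrightarrow> u y = v y"
  shows "delbar u z = delbar v z"
proof -
  have "wirt_zbar k (\<lambda>w. u w X) z = wirt_zbar k (\<lambda>w. v w X) z" for k X
    unfolding wirt_zbar_eq_wirt by (rule wirt_cong[OF assms(1,2)]) (simp add: assms(3))
  then show ?thesis unfolding delbar_def by simp
qed

lemma del_scaled_form: "F differentiable at z \<Longrightarrow> del (scaled_form F w) z = ext10 (\<lambda>k. wirt_z k F z) w"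
  using del_sum_scaled_form[of "{()}" "\<lambda>_. F" z "\<lambda>_. w"] by (auto simp: scaled_form_def fun_eq_iff)

lemma delbar_scaled_form: "F differentiable at z \<Longrightarrow> delbar (scaled_form F w) z = ext01 (\<lambda>k. wirt_zbar k F z) w"
  using delbar_sum_scaled_form[of "{()}" "\<lambda>_. F" z "\<lambda>_. w"] by (auto simp: scaled_form_def fun_eq_iff)

text \<open>Symmetry of second derivatives is at hand for real functions, so \<open>F\<close> is
  split into real and imaginary part; the same \<open>c\<close> in both operators makes the four
  second derivatives match up.\<close>

lemma wirt_commute:
  assumes F: "smooth_on U F" "open U" "z \<in> U"
  shows "wirt c k (wirt c l F) z = wirt c l (wirt c k F) z"
proof -
  define R where "R z = complex_of_real (Re (F z))" for z
  define S where "S z = complex_of_real (Im (F z))" for z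
  have re: "smooth_on U (\<lambda>z. Re (F z))" and im: "smooth_on U (\<lambda>z. Im (F z))"
    by (rule smooth_on_linear_comp[OF _ F(2,1)], rule bounded_linear_Re bounded_linear_Im)+
  have RS: "smooth_on U R" "smooth_on U S"
    unfolding R_def[abs_def] S_def[abs_def] by (intro smooth_on_of_real F re im)+
  note dR = smooth_on_differentiable_at[OF RS(1) F(2)] and dS = smooth_on_differentiable_at[OF RS(2) F(2)]
  have *: "wirt c k (wirt c l F) z = wirt c k (wirt c l R) z + \<i> * wirt c k (wirt c l S) z" for k l
  proof -
    have FR: "F y = R y + \<i> * S y" for y by (simp add: R_def S_def complex_eq_iff)
    have "wirt c l F y = wirt c l R y + \<i> * wirt c l S y" if "y \<in> U" for y
      unfolding FR[abs_def] using dR[OF that] dS[OF that]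
      by (simp add: wirt_add wirt_cmult)
    then have "wirt c k (wirt c l F) z = wirt c k (\<lambda>y. wirt c l R y + \<i> * wirt c l S y) z"
      by (rule wirt_cong[OF F(2,3)])
    moreover have "wirt c l R differentiable at z" "wirt c l S differentiable at z"
      by (rule smooth_on_differentiable_at[OF smooth_on_wirt[OF F(2)] F(2,3)], rule RS)+
    ultimately show ?thesis by (simp add: wirt_add wirt_cmult)
  qed
  have "wirt c k (wirt c l R) z = wirt c l (wirt c k R) z" "wirt c k (wirt c l S) z = wirt c l (wirt c k S) z"
    unfolding R_def[abs_def] S_def[abs_def] wirt_wirt_of_real[OF re F(2,3)] wirt_wirt_of_real[OF im F(2,3)]
    using frechet_derivative_commute[OF re F(2,3)] frechet_derivative_commute[OF im F(2,3)]
    unfolding D2_def by (simp_all add: algebra_simps)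
  then show ?thesis unfolding * by simp
qed

lemma sum_UNIV_sum: "(\<Sum>q\<in>(UNIV :: ('n::finite + 'n) set). g q) = (\<Sum>k\<in>UNIV. g (Inl k)) + (\<Sum>k\<in>UNIV. g (Inr k))"
  using sum.Plus[of UNIV UNIV g] by (simp add: UNIV_Plus_UNIV)

lemma sum_sym_antisym:
  fixes A B :: "'n::finite \<Rightarrow> 'n \<Rightarrow> complex"
  assumes "\<And>k l. A k l = A l k" "\<And>k l. B k l = - B l k"
  shows "(\<Sum>k\<in>UNIV. \<Sum>l\<in>UNIV. A k l * B k l) = 0"
proof -
  have "(\<Sum>k\<in>UNIV. \<Sum>l\<in>UNIV. A k l * B k l) = (\<Sum>l\<in>UNIV. \<Sum>k\<in>UNIV. - (A l k * B l k))"
    by (subst sum.swap, intro sum.cong refl) (metis assms mult_minus_right)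
  also have "\<dots> = - (\<Sum>k\<in>UNIV. \<Sum>l\<in>UNIV. A k l * B k l)" by (simp add: sum_negf)
  finally show ?thesis by simp
qed

text \<open>Applying d to \<open>dcform\<close> gives four blocks. The two pure ones pair a
  symmetric array of derivatives with anticommuting multiplications and vanish. In the two mixed
  ones the swap of dz and dzbar makes the signs agree, and their sum is \<open>levi\<close>.\<close>

lemma ddcform_scaled_form:
  assumes F: "smooth_on U F" "open U" "z \<in> U"
  shows "ddcform (scaled_form F w) z = wedge11 (\<lambda>k l. \<i> * levi F z k l) w"
proof
  fix IJ
  \<comment> \<open>The sum type indexes the one-form terms of \<open>dcform\<close>:
    \<open>Inl\<close> for the dzbar terms, \<open>Inr\<close> for the dz terms.\<close>
  define C :: "'a + 'a \<Rightarrow> (complex, 'a) vec \<Rightarrow> complex" where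
    "C = (\<lambda>q. case q of Inl l \<Rightarrow> (\<lambda>y. \<i> * wirt_zbar l F y) | Inr k \<Rightarrow> (\<lambda>y. - \<i> * wirt_z k F y))"
  define W where "W = (\<lambda>q. case q of Inl l \<Rightarrow> wedge_dzbar l w | Inr k \<Rightarrow> wedge_dz k w)"
  define u where "u = (\<lambda>y IJ. \<Sum>q\<in>UNIV. C q y * W q IJ)"
  have dF: "wirt c l F differentiable at y" if "y \<in> U" for y l c
    by (rule smooth_on_differentiable_at[OF smooth_on_wirt[OF F(2,1)] F(2) that])
  have "dcform (scaled_form F w) y = u y" if "y \<in> U" for y
  proof
    fix X
    show "dcform (scaled_form F w) y X = u y X"
      using smooth_on_differentiable_at[OF F(1,2) that]
      by (simp add: dcform_def del_scaled_form delbar_scaled_form u_def C_def W_def sum_UNIV_sum ext10_def ext01_def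
          sum_distrib_left sum_negf algebra_simps)
  qed
  then have "ddcform (scaled_form F w) z IJ = dform u z IJ"
    unfolding ddcform_def dform_def
    using del_cong[OF F(2,3), of "dcform (scaled_form F w)" u] delbar_cong[OF F(2,3), of "dcform (scaled_form F w)" u] by simp
  also have "\<dots> = (\<Sum>q\<in>UNIV. ext10 (\<lambda>k. wirt_z k (C q) z) (W q) IJ) + (\<Sum>q\<in>UNIV. ext01 (\<lambda>k. wirt_zbar k (C q) z) (W q) IJ)"
  proof -
    have "C q differentiable at z" for q
      unfolding C_def wirt_z_eq_wirt wirt_zbar_eq_wirt
      by (cases q) (auto intro!: differentiable_mult differentiable_minus dF F(3))
    then show ?thesis unfolding dform_def u_def by (simp add: del_sum_scaled_form delbar_sum_scaled_form)
  qed
  also have "\<dots> = (\<Sum>l\<in>UNIV. \<Sum>k\<in>UNIV. \<i> * wirt_z k (wirt_zbar l F) z * wedge_dz k (wedge_dzbar l w) IJ)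
      - \<i> * (\<Sum>k\<in>UNIV. \<Sum>m\<in>UNIV. wirt_z m (wirt_z k F) z * wedge_dz m (wedge_dz k w) IJ)
      + \<i> * (\<Sum>l\<in>UNIV. \<Sum>m\<in>UNIV. wirt_zbar m (wirt_zbar l F) z * wedge_dzbar m (wedge_dzbar l w) IJ)
      - (\<Sum>k\<in>UNIV. \<Sum>l\<in>UNIV. \<i> * wirt_zbar l (wirt_z k F) z * wedge_dzbar l (wedge_dz k w) IJ)"
  proof -
    have c: "wirt c k (\<lambda>y. \<i> * wirt d l F y) z = \<i> * wirt c k (wirt d l F) z"
      "wirt c k (\<lambda>y. - (\<i> * wirt d l F y)) z = - (\<i> * wirt c k (wirt d l F) z)" for c k d l
      using wirt_cmult[OF dF[OF F(3)], of c k \<i> d l] wirt_cmult[OF dF[OF F(3)], of c k "- \<i>" d l] by simp_all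
    show ?thesis
      unfolding sum_UNIV_sum C_def W_def ext10_def ext01_def wirt_z_eq_wirt wirt_zbar_eq_wirt
      by (simp add: c sum_distrib_left sum_negf algebra_simps)
  qed
  also have "(\<Sum>k\<in>UNIV. \<Sum>m\<in>UNIV. wirt_z m (wirt_z k F) z * wedge_dz m (wedge_dz k w) IJ) = 0"
    by (rule sum_sym_antisym) (auto simp: wirt_z_eq_wirt intro!: wirt_commute[OF F] fun_cong[OF wedge_dz_wedge_dz])
  also have "(\<Sum>k\<in>UNIV. \<Sum>m\<in>UNIV. wirt_zbar m (wirt_zbar k F) z * wedge_dzbar m (wedge_dzbar k w) IJ) = 0"
    by (rule sum_sym_antisym) (auto simp: wirt_zbar_eq_wirt intro!: wirt_commute[OF F] fun_cong[OF wedge_dzbar_wedge_dzbar])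
  also have "(\<Sum>k\<in>UNIV. \<Sum>l\<in>UNIV. \<i> * wirt_zbar l (wirt_z k F) z * wedge_dzbar l (wedge_dz k w) IJ)
      = - (\<Sum>k\<in>UNIV. \<Sum>l\<in>UNIV. \<i> * wirt_zbar l (wirt_z k F) z * wedge_dz k (wedge_dzbar l w) IJ)"
    by (simp add: wedge_dz_wedge_dzbar sum_negf)
  also have "(\<Sum>l\<in>UNIV. \<Sum>k\<in>UNIV. \<i> * wirt_z k (wirt_zbar l F) z * wedge_dz k (wedge_dzbar l w) IJ)
     = (\<Sum>k\<in>UNIV. \<Sum>l\<in>UNIV. \<i> * wirt_z k (wirt_zbar l F) z * wedge_dz k (wedge_dzbar l w) IJ)"
    by (rule sum.swap)
  finally show "ddcform (scaled_form F w) z IJ = wedge11 (\<lambda>k l. \<i> * levi F z k l) w IJ"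
    by (simp add: wedge11_def levi_def sum.distrib algebra_simps)
qed

lemma levi_mult:
  assumes h: "smooth_on U h" and f: "smooth_on U f" and U: "open U" "z \<in> U"
  shows "levi (\<lambda>y. h y * f y) z k l = h z * levi f z k l + f z * levi h z k l
     + 2 * (wirt_z k h z * wirt_zbar l f z + wirt_zbar l h z * wirt_z k f z)"
proof -
  have d: "h differentiable at y" "f differentiable at y" if "y \<in> U" for y
    using smooth_on_differentiable_at that U(1) h f by blast+
  have d': "wirt c l h differentiable at z" "wirt c l f differentiable at z" for c l
    using smooth_on_differentiable_at[OF smooth_on_wirt[OF U(1)] U] h f by blast+
  have "wirt c k (wirt d l (\<lambda>y. h y * f y)) z = wirt c k (\<lambda>y. wirt d l h y * f y + h y * wirt d l f y) z" for c k d l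
    by (rule wirt_cong[OF U]) (simp add: wirt_mult d)
  also have "\<dots> c k d l = wirt c k (wirt d l h) z * f z + wirt d l h z * wirt c k f z
      + (wirt c k h z * wirt d l f z + h z * wirt c k (wirt d l f) z)" for c k d l
    by (simp add: wirt_add wirt_mult d' d[OF U(2)])
  finally show ?thesis
    unfolding levi_def wirt_z_eq_wirt wirt_zbar_eq_wirt by (simp add: algebra_simps)
qed

lemma levi_cong:
  assumes "open U" "z \<in> U" "\<And>y. y \<in> U \<Longrightarrow> f y = h y"
  shows "levi f z k l = levi h z k l"
proof -
  have "wirt c k (wirt d l f) z = wirt c k (wirt d l h) z" for c d k l
    by (rule wirt_cong[OF assms(1,2)]) (rule wirt_cong[OF assms(1) _ assms(3)])
  then show ?thesis unfolding levi_def wirt_z_eq_wirt wirt_zbar_eq_wirt by simp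
qed

lemma levi_eq_0_outside:
  assumes "open U" "z \<in> U" "\<And>y. y \<in> U \<Longrightarrow> f y = 0"
  shows "levi f z k l = 0"
proof -
  have "levi f z k l = levi (\<lambda>_. 0) z k l" by (rule levi_cong[OF assms])
  moreover have "wirt c k (\<lambda>_. 0) = (\<lambda>_. 0)" for c and k :: 'a by (simp add: fun_eq_iff)
  ultimately show ?thesis by (simp add: levi_def wirt_z_eq_wirt wirt_zbar_eq_wirt)
qed

text \<open>A function of a single linear form \<open>a\<close> does not contribute to the Levi form modulo
  \<open>a\<close> and its conjugate, both of which annihilate \<open>elem_pos as\<close>.\<close>
lemma wedge11_levi_mult_kill:
  assumes \<phi>: "smooth_on U \<phi>" and \<psi>: "smooth_on U \<psi>" and U: "open U" "z \<in> U"
    and c: "smooth_on U c" "\<And>y k. y \<in> U \<Longrightarrow> wirt_z k \<phi> y = c y * a $ k"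
    and d: "smooth_on U d" "\<And>y k. y \<in> U \<Longrightarrow> wirt_zbar k \<phi> y = d y * cnj (a $ k)"
    and a: "a \<in> set as"
  shows "wedge11 (levi (\<lambda>y. \<phi> y * \<psi> y) z) (elem_pos as) = (\<lambda>IJ. \<phi> z * wedge11 (levi \<psi> z) (elem_pos as) IJ)"
proof -
  have dc: "c differentiable at z" and dd: "d differentiable at z"
    using smooth_on_differentiable_at U c(1) d(1) by blast+
  have 1: "wirt_z k (wirt_zbar l \<phi>) z = wirt_z k d z * cnj (a $ l)" for k l
  proof -
    have "wirt_z k (wirt_zbar l \<phi>) z = wirt_z k (\<lambda>y. d y * cnj (a $ l)) z"
      unfolding wirt_z_eq_wirt by (rule wirt_cong[OF U]) (rule d(2))
    then show ?thesis unfolding wirt_z_eq_wirt by (simp add: wirt_multc[OF dd])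
  qed
  have 2: "wirt_zbar l (wirt_z k \<phi>) z = wirt_zbar l c z * a $ k" for k l
  proof -
    have "wirt_zbar l (wirt_z k \<phi>) z = wirt_zbar l (\<lambda>y. c y * a $ k) z"
      unfolding wirt_zbar_eq_wirt by (rule wirt_cong[OF U]) (rule c(2))
    then show ?thesis unfolding wirt_zbar_eq_wirt by (simp add: wirt_multc[OF dc])
  qed
  have "levi (\<lambda>y. \<phi> y * \<psi> y) z k l = \<phi> z * levi \<psi> z k l
     + (a $ k * (\<psi> z * wirt_zbar l c z + 2 * c z * wirt_zbar l \<psi> z)
     + (\<psi> z * wirt_z k d z + 2 * d z * wirt_z k \<psi> z) * cnj (a $ l))" for k l
    unfolding levi_mult[OF \<phi> \<psi> U] unfolding levi_def[of \<phi>] 1 2 c(2)[OF U(2)] d(2)[OF U(2)]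
    by (simp add: algebra_simps)
  then have "wedge11 (levi (\<lambda>y. \<phi> y * \<psi> y) z) (elem_pos as) IJ = wedge11 (\<lambda>k l. \<phi> z * levi \<psi> z k l
     + (a $ k * (\<psi> z * wirt_zbar l c z + 2 * c z * wirt_zbar l \<psi> z)
     + (\<psi> z * wirt_z k d z + 2 * d z * wirt_z k \<psi> z) * cnj (a $ l))) (elem_pos as) IJ" for IJ
    unfolding wedge11_def by simp
  then show ?thesis
    by (simp add: wedge11_add_left wedge11_cmult_left wedge11_left_elem_pos[OF a] wedge11_right_elem_pos[OF a] fun_eq_iff)
qed

text \<open>Bilinear, without conjugation: \<open>pair a\<close> is holomorphic with differential
  the covector \<open>a\<close>, the same one that \<open>pf10 a\<close> encodes.\<close>

definition pair :: "(complex, 'n::finite) vec \<Rightarrow> (complex, 'n) vec \<Rightarrow> complex" where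
  "pair a z = (\<Sum>k\<in>UNIV. a $ k * z $ k)"

lemma bounded_linear_pair: "bounded_linear (pair a)"
  unfolding pair_def[abs_def]
  by (intro bounded_linear_sum bounded_linear_const_mult bounded_linear_vec_nth)

lemma pair_axis: "pair a (axis k c) = a $ k * c"
proof -
  have "pair a (axis k c) = (\<Sum>i\<in>UNIV. if i = k then a $ k * c else 0)"
    unfolding pair_def by (rule sum.cong) (auto simp: axis_def)
  then show ?thesis by simp
qed

lemma pair_has_derivative: "((\<lambda>z. pair a (z - x)) has_derivative pair a) (at z)"
proof -
  have "((\<lambda>z. z - x) has_derivative (\<lambda>h. h)) (at z)" by (auto intro!: derivative_eq_intros)
  from bounded_linear.has_derivative[OF bounded_linear_pair this] show ?thesis .
qed

lemma wirt_pair: "wirt c k (\<lambda>z. pair a (z - x)) z = (1 + c * \<i>) / 2 * a $ k"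
  by (subst wirt_has_derivative[OF pair_has_derivative]) (simp add: pair_axis field_simps)

lemma wirt_cnj_pair: "wirt c k (\<lambda>z. cnj (pair a (z - x))) z = (1 - c * \<i>) / 2 * cnj (a $ k)"
  by (subst wirt_has_derivative[OF has_derivative_cnj[OF pair_has_derivative]]) (simp add: pair_axis field_simps)

lemma smooth_on_pair: "open U \<Longrightarrow> smooth_on U (\<lambda>z. pair a (z - x))"
  using smooth_on_linear_comp[OF bounded_linear_pair _ smooth_on_diff[OF _ smooth_on_bounded_linear[OF _ bounded_linear_ident] smooth_on_const]]
  by auto

lemma smooth_on_cnj: "open U \<Longrightarrow> smooth_on U f \<Longrightarrow> smooth_on U (\<lambda>z. cnj (f z))"
  by (rule smooth_on_linear_comp[OF bounded_linear_cnj])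

lemma smooth_on_cmod_pair_sq: "open U \<Longrightarrow> smooth_on U (\<lambda>z. (cmod (pair a (z - x)))\<^sup>2)"
proof -
  assume U: "open U"
  have "smooth_on U (\<lambda>z. Re (pair a (z - x)) * Re (pair a (z - x)) + Im (pair a (z - x)) * Im (pair a (z - x)))"
    by (intro smooth_on_add smooth_on_mult smooth_on_linear_comp[OF bounded_linear_Re]
        smooth_on_linear_comp[OF bounded_linear_Im] smooth_on_pair U)
  then show ?thesis by (simp only: cmod_power2 power2_eq_square[of "Re _"] power2_eq_square[of "Im _"])
qed

lemma of_real_cmod_pair_sq: "complex_of_real ((cmod (pair a (z - x)))\<^sup>2) = pair a (z - x) * cnj (pair a (z - x))"
  by (rule complex_norm_square)

lemma wirt_cmod_pair_sq:
  "wirt_z k (\<lambda>z. complex_of_real ((cmod (pair a (z - x)))\<^sup>2)) z = cnj (pair a (z - x)) * a $ k"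
  "wirt_zbar k (\<lambda>z. complex_of_real ((cmod (pair a (z - x)))\<^sup>2)) z = pair a (z - x) * cnj (a $ k)"
proof -
  have d: "(\<lambda>z. pair a (z - x)) differentiable at z" "(\<lambda>z. cnj (pair a (z - x))) differentiable at z"
    using pair_has_derivative has_derivative_cnj[OF pair_has_derivative] unfolding differentiable_def by blast+
  show "wirt_z k (\<lambda>z. complex_of_real ((cmod (pair a (z - x)))\<^sup>2)) z = cnj (pair a (z - x)) * a $ k"
    "wirt_zbar k (\<lambda>z. complex_of_real ((cmod (pair a (z - x)))\<^sup>2)) z = pair a (z - x) * cnj (a $ k)"
    unfolding of_real_cmod_pair_sq wirt_z_eq_wirt wirt_zbar_eq_wirt wirt_mult[OF d] wirt_pair wirt_cnj_pair
    by simp_all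
qed

text \<open>The factor 2 comes from the two orders of differentiation in \<open>levi\<close>. The
  value does not depend on \<open>z\<close>, which later allows the Levi matrix to be treated as a
  fixed matrix.\<close>

lemma levi_cmod_pair_sq:
  "levi (\<lambda>z. complex_of_real ((cmod (pair a (z - x)))\<^sup>2)) z k l = 2 * (a $ k * cnj (a $ l))"
proof -
  have d: "(\<lambda>z. pair a (z - x)) differentiable at z" "(\<lambda>z. cnj (pair a (z - x))) differentiable at z"
    using pair_has_derivative has_derivative_cnj[OF pair_has_derivative] unfolding differentiable_def by blast+
  show ?thesis
    unfolding levi_def wirt_cmod_pair_sq[abs_def]
    unfolding wirt_z_eq_wirt wirt_zbar_eq_wirt wirt_multc[OF d(1)] wirt_multc[OF d(2)] wirt_pair wirt_cnj_pair
    by simp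
qed

lemma wirt_real_comp:
  fixes s :: "real \<Rightarrow> real" and \<theta> :: "(complex, 'n::{finite,linorder}) vec \<Rightarrow> real"
  assumes s: "smooth_on UNIV s" and \<theta>: "\<theta> differentiable at z"
  shows "wirt c k (\<lambda>z. complex_of_real (s (\<theta> z))) z
    = complex_of_real (frechet_derivative s (at (\<theta> z)) 1) * wirt c k (\<lambda>z. complex_of_real (\<theta> z)) z"
proof -
  have ds: "(s has_derivative frechet_derivative s (at t)) (at t)" for t
    using smooth_on_differentiable_at[OF s open_UNIV] frechet_derivative_works by blast
  have lin: "frechet_derivative s (at t) r = frechet_derivative s (at t) 1 * r" for t r
    using linear_cmul[OF has_derivative_linear[OF ds[of t]], of r 1] by simp
  have d\<theta>: "(\<theta> has_derivative frechet_derivative \<theta> (at z)) (at z)"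
    using \<theta> frechet_derivative_works by blast
  from has_derivative_compose[OF this ds]
  have d: "((\<lambda>z. s (\<theta> z)) has_derivative (\<lambda>v. frechet_derivative s (at (\<theta> z)) 1 * frechet_derivative \<theta> (at z) v)) (at z)"
    by (subst (asm) lin) simp
  show ?thesis
    unfolding wirt_has_derivative[OF has_derivative_of_real[OF d]] wirt_has_derivative[OF has_derivative_of_real[OF d\<theta>]]
    by (simp add: field_simps)
qed

subsection \<open>Smooth plurisubharmonic functions\<close>

lemma smooth_on_has_derivative:
  "smooth_on U h \<Longrightarrow> open U \<Longrightarrow> y \<in> U \<Longrightarrow> (h has_derivative frechet_derivative h (at y)) (at y)"
  using smooth_on_differentiable_at frechet_derivative_works by blast

lemma D2_linear:
  assumes h: "smooth_on U h" "open U" "z \<in> U"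
  shows "linear (D2 h z u)" "linear (\<lambda>u. D2 h z u v)"
proof -
  show 1: "linear (D2 h z u)" for u
    unfolding D2_def[abs_def]
    by (rule has_derivative_linear[OF smooth_on_has_derivative[OF smooth_on_frechet[OF h(1)] h(2,3)]])
  have "(\<lambda>u. D2 h z u v) = D2 h z v"
    unfolding D2_def using frechet_derivative_commute[OF h] by auto
  then show "linear (\<lambda>u. D2 h z u v)" using 1 by simp
qed

lemma D2_sym:
  "smooth_on U h \<Longrightarrow> open U \<Longrightarrow> z \<in> U \<Longrightarrow> D2 h z u v = D2 h z v u"
  unfolding D2_def by (rule frechet_derivative_commute)

lemma D2_continuous:
  "smooth_on U h \<Longrightarrow> open U \<Longrightarrow> z \<in> U \<Longrightarrow> isCont (\<lambda>y. D2 h y u v) z"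
  unfolding D2_def
  by (rule differentiable_imp_continuous_within)
     (rule smooth_on_differentiable_at[OF smooth_on_frechet[OF smooth_on_frechet]])

lemma frechet_line_derivatives:
  fixes h :: "'a::real_normed_vector \<Rightarrow> real"
  assumes h: "smooth_on U h" "open U" and s: "z + s *\<^sub>R v \<in> U"
  shows "((\<lambda>s. h (z + s *\<^sub>R v)) has_real_derivative frechet_derivative h (at (z + s *\<^sub>R v)) v) (at s)"
    and "((\<lambda>s. frechet_derivative h (at (z + s *\<^sub>R v)) v) has_real_derivative D2 h (z + s *\<^sub>R v) v v) (at s)"
proof -
  have line: "((\<lambda>s. z + s *\<^sub>R v) has_derivative (\<lambda>r. r *\<^sub>R v)) (at s)"
    by (auto intro!: derivative_eq_intros)
  have gen: "((\<lambda>s. f (z + s *\<^sub>R v)) has_real_derivative frechet_derivative f (at (z + s *\<^sub>R v)) v) (at s)"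
    if "smooth_on U f" for f :: "'a \<Rightarrow> real"
  proof -
    note d = smooth_on_has_derivative[OF that h(2) s]
    show ?thesis unfolding has_field_derivative_def
      by (rule has_derivative_eq_rhs[OF has_derivative_compose[OF line d]])
         (simp add: fun_eq_iff linear_cmul[OF has_derivative_linear[OF d]])
  qed
  show "((\<lambda>s. h (z + s *\<^sub>R v)) has_real_derivative frechet_derivative h (at (z + s *\<^sub>R v)) v) (at s)"
    by (rule gen[OF h(1)])
  show "((\<lambda>s. frechet_derivative h (at (z + s *\<^sub>R v)) v) has_real_derivative D2 h (z + s *\<^sub>R v) v v) (at s)"
    unfolding D2_def by (rule gen[OF smooth_on_frechet[OF h(1)]])
qed

lemma taylor2_upper:
  fixes h :: "'a::real_normed_vector \<Rightarrow> real"
  assumes h: "smooth_on U h" "open U" and t: "t > 0"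
    and U: "\<And>s. 0 \<le> s \<Longrightarrow> s \<le> t \<Longrightarrow> z + s *\<^sub>R v \<in> U"
    and B: "\<And>s. 0 \<le> s \<Longrightarrow> s \<le> t \<Longrightarrow> D2 h (z + s *\<^sub>R v) v v \<le> B"
  shows "h (z + t *\<^sub>R v) \<le> h z + t * frechet_derivative h (at z) v + t\<^sup>2 / 2 * B"
proof -
  define D where "D n = (if n = 0 then (\<lambda>s. h (z + s *\<^sub>R v)) else if n = 1 then
      (\<lambda>s. frechet_derivative h (at (z + s *\<^sub>R v)) v) else (\<lambda>s. D2 h (z + s *\<^sub>R v) v v))" for n :: nat
  have "\<exists>s>0. s < t \<and> h (z + t *\<^sub>R v) = (\<Sum>m<2. D m 0 / fact m * t ^ m) + D 2 s / fact 2 * t ^ 2"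
  proof (rule Maclaurin[OF t])
    show "D 0 = (\<lambda>s. h (z + s *\<^sub>R v))" by (simp add: D_def)
    show "\<forall>m s. m < 2 \<and> 0 \<le> s \<and> s \<le> t \<longrightarrow> DERIV (D m) s :> D (Suc m) s"
    proof (intro allI impI)
      fix m :: nat and s assume m: "m < 2 \<and> 0 \<le> s \<and> s \<le> t"
      then have "m = 0 \<or> m = 1" by auto
      then show "DERIV (D m) s :> D (Suc m) s"
        using frechet_line_derivatives[OF h U, of s] m by (auto simp: D_def)
    qed
  qed simp
  then obtain s where s: "0 < s" "s < t" and e: "h (z + t *\<^sub>R v) = (\<Sum>m<2. D m 0 / fact m * t ^ m) + D 2 s / fact 2 * t ^ 2"
    by auto
  have "h (z + t *\<^sub>R v) = h z + t * frechet_derivative h (at z) v + D2 h (z + s *\<^sub>R v) v v / 2 * t\<^sup>2"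
    using e by (simp add: D_def numeral_2_eq_2 mult.commute)
  moreover have "D2 h (z + s *\<^sub>R v) v v * t\<^sup>2 \<le> B * t\<^sup>2"
    using B[of s] s by (intro mult_right_mono) auto
  ultimately show ?thesis by (simp add: mult.commute)
qed

text \<open>The second-order Taylor bound is averaged over a small circle in the complex line of
  \<open>b\<close>: first-order terms integrate to zero and the squares of cosine and sine average
  to 1/2. The sub-mean-value property then bounds the sum below by minus the continuity
  error.\<close>

lemma psh_D2_nonneg:
  fixes h :: "(complex, 'n::{finite,linorder}) vec \<Rightarrow> real"
  assumes h: "smooth_on U h" "open U" and psh: "psh_real U h" and z: "z \<in> U"
  shows "0 \<le> D2 h z b b + D2 h z (\<i> *s b) (\<i> *s b)"
proof (rule field_le_epsilon)
  fix e :: real assume e: "e > 0"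
  define c where "c = \<i> *s b"
  \<comment> \<open>This is \<open>b\<close> rotated by the angle \<theta> in its complex line,
    written in the real directions \<open>b\<close> and \<open>\<i> *s b\<close>.\<close>
  define v where "v \<theta> = cos \<theta> *\<^sub>R b + sin \<theta> *\<^sub>R c" for \<theta>
  have expand: "D2 h y (v \<theta>) (v \<theta>) = (cos \<theta>)\<^sup>2 * D2 h y b b + 2 * (cos \<theta> * sin \<theta>) * D2 h y b c + (sin \<theta>)\<^sup>2 * D2 h y c c"
    if "y \<in> U" for y \<theta>
  proof -
    note l = D2_linear[OF h that]
    show ?thesis
      unfolding v_def linear_add[OF l(1)] linear_cmul[OF l(1)] linear_add[OF l(2)] linear_cmul[OF l(2)]
      using D2_sym[OF h that, of c b] by (simp add: power2_eq_square algebra_simps)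
  qed
  \<comment> \<open>The three second derivatives enter with weights at most 1, 2 and 1, so an error
    below \<open>e / 8\<close> in each costs at most \<open>e / 2\<close> in total.\<close>
  have cont: "\<exists>d>0. \<forall>y. dist y z < d \<longrightarrow> \<bar>D2 h y u w - D2 h z u w\<bar> < e / 8" for u w
    using D2_continuous[OF h z, of u w] e unfolding continuous_at_eps_delta dist_real_def
    by (metis zero_less_divide_iff zero_less_numeral)
  obtain d1 where d1: "d1 > 0" "\<And>y. dist y z < d1 \<Longrightarrow> \<bar>D2 h y b b - D2 h z b b\<bar> < e / 8" using cont by metis
  obtain d2 where d2: "d2 > 0" "\<And>y. dist y z < d2 \<Longrightarrow> \<bar>D2 h y b c - D2 h z b c\<bar> < e / 8" using cont by metis
  obtain d3 where d3: "d3 > 0" "\<And>y. dist y z < d3 \<Longrightarrow> \<bar>D2 h y c c - D2 h z c c\<bar> < e / 8" using cont by metis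
  obtain d4 where d4: "d4 > 0" "ball z d4 \<subseteq> U" using h(2) z openE by blast
  define d where "d = min (min d1 d2) (min d3 d4)"
  have d: "d > 0" using d1 d2 d3 d4 by (simp add: d_def)
  have nc: "norm c = norm b"
    unfolding c_def norm_vec_def L2_set_def by (simp add: norm_mult)
  define t where "t = d / (2 * (norm b + 1))"
  have t: "t > 0" using d by (simp add: t_def add_nonneg_pos)
  have tb: "t * norm b < d / 2 + d / 2"
  proof -
    have "t * norm b < t * (norm b + 1)" using t by simp
    also have "\<dots> = d / 2" unfolding t_def by (simp add: divide_simps) (smt (verit) norm_ge_zero)
    finally show ?thesis using d by linarith
  qed
  have pt: "z + \<zeta> *s (complex_of_real t *s b) \<in> ball z d" if "cmod \<zeta> \<le> 1" for \<zeta>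
  proof -
    have "norm (\<zeta> *s (complex_of_real t *s b)) = cmod \<zeta> * (t * norm b)"
      using t unfolding norm_vec_def L2_set_def by (simp add: norm_mult power_mult_distrib real_sqrt_mult flip: sum_distrib_left)
    also have "\<dots> \<le> 1 * (t * norm b)" using that t by (intro mult_right_mono) auto
    finally show ?thesis using tb by (simp add: dist_norm)
  qed
  have circ: "circle_pt z (complex_of_real t *s b) \<theta> = z + t *\<^sub>R v \<theta>" for \<theta>
    unfolding circle_pt_def v_def c_def
    by (simp add: vec_eq_iff exp_Euler cos_of_real sin_of_real) (simp add: scaleR_conv_of_real algebra_simps)
  have v_in: "z + s *\<^sub>R v \<theta> \<in> ball z d" if "0 \<le> s" "s \<le> t" for s \<theta>
  proof -
    have "z + complex_of_real (s / t) * exp (\<i> * complex_of_real \<theta>) *s (complex_of_real t *s b) \<in> ball z d"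
      using that t by (intro pt) (simp add: norm_mult norm_divide)
    also have "z + complex_of_real (s / t) * exp (\<i> * complex_of_real \<theta>) *s (complex_of_real t *s b) = z + s *\<^sub>R v \<theta>"
      using t unfolding v_def c_def
      by (simp add: vec_eq_iff exp_Euler cos_of_real sin_of_real) (simp add: scaleR_conv_of_real algebra_simps)
    finally show ?thesis .
  qed
  have subU: "ball z d \<subseteq> U" using d4 by (auto simp: d_def)
  define R where "R \<theta> = h z + t * (cos \<theta> * frechet_derivative h (at z) b + sin \<theta> * frechet_derivative h (at z) c)
     + t\<^sup>2 / 2 * ((cos \<theta>)\<^sup>2 * D2 h z b b + 2 * (cos \<theta> * sin \<theta>) * D2 h z b c + (sin \<theta>)\<^sup>2 * D2 h z c c + e / 2)" for \<theta>
  have up: "h (circle_pt z (complex_of_real t *s b) \<theta>) \<le> R \<theta>" for \<theta>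
  proof -
    have lin: "frechet_derivative h (at z) (v \<theta>) = cos \<theta> * frechet_derivative h (at z) b + sin \<theta> * frechet_derivative h (at z) c"
    proof -
      note l = has_derivative_linear[OF smooth_on_has_derivative[OF h z]]
      show ?thesis unfolding v_def linear_add[OF l] linear_cmul[OF l] by simp
    qed
    have "h (z + t *\<^sub>R v \<theta>) \<le> h z + t * frechet_derivative h (at z) (v \<theta>)
      + t\<^sup>2 / 2 * ((cos \<theta>)\<^sup>2 * D2 h z b b + 2 * (cos \<theta> * sin \<theta>) * D2 h z b c + (sin \<theta>)\<^sup>2 * D2 h z c c + e / 2)"
    proof (rule taylor2_upper[OF h t])
      fix s assume s: "0 \<le> s" "s \<le> t"
      define y where "y = z + s *\<^sub>R v \<theta>"
      have y: "y \<in> ball z d" using v_in[OF s] y_def by simp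
      then have yU: "y \<in> U" and yd: "dist y z < d" using subU by (auto simp: dist_commute)
      show "z + s *\<^sub>R v \<theta> \<in> U" using yU y_def by simp
      have a1: "\<bar>D2 h y b b - D2 h z b b\<bar> < e / 8" "\<bar>D2 h y b c - D2 h z b c\<bar> < e / 8" "\<bar>D2 h y c c - D2 h z c c\<bar> < e / 8"
        using d1(2)[of y] d2(2)[of y] d3(2)[of y] yd by (auto simp: d_def)
      have b: "\<bar>r * x\<bar> \<le> e / 8" if "\<bar>r\<bar> \<le> 1" "\<bar>x\<bar> < e / 8" for r x :: real
        unfolding abs_mult using mult_mono[OF that(1) less_imp_le[OF that(2)]] by simp
      have c1: "\<bar>(cos \<theta>)\<^sup>2\<bar> \<le> 1" "\<bar>(sin \<theta>)\<^sup>2\<bar> \<le> 1" "\<bar>cos \<theta> * sin \<theta>\<bar> \<le> 1"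
        by (auto simp: abs_mult abs_square_le_1 intro: mult_le_one)
      have "D2 h y (v \<theta>) (v \<theta>) - ((cos \<theta>)\<^sup>2 * D2 h z b b + 2 * (cos \<theta> * sin \<theta>) * D2 h z b c + (sin \<theta>)\<^sup>2 * D2 h z c c)
         = (cos \<theta>)\<^sup>2 * (D2 h y b b - D2 h z b b) + 2 * ((cos \<theta> * sin \<theta>) * (D2 h y b c - D2 h z b c)) + (sin \<theta>)\<^sup>2 * (D2 h y c c - D2 h z c c)"
        unfolding expand[OF yU] by (simp add: algebra_simps)
      also have "\<dots> \<le> e / 8 + 2 * (e / 8) + e / 8"
        using b[OF c1(1) a1(1)] b[OF c1(3) a1(2)] b[OF c1(2) a1(3)] by linarith
      finally show "D2 h (z + s *\<^sub>R v \<theta>) (v \<theta>) (v \<theta>) \<le> (cos \<theta>)\<^sup>2 * D2 h z b b + 2 * (cos \<theta> * sin \<theta>) * D2 h z b c + (sin \<theta>)\<^sup>2 * D2 h z c c + e / 2"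
        unfolding y_def by simp
    qed
    then show ?thesis unfolding circ R_def lin .
  qed
  \<comment> \<open>An antiderivative of \<open>R\<close>. Over a full period only the summands
    linear in \<theta> survive, so the first derivatives and the mixed second derivative drop
    out.\<close>
  define G where "G \<theta> = \<theta> * h z + t * (sin \<theta> * frechet_derivative h (at z) b - cos \<theta> * frechet_derivative h (at z) c)
     + t\<^sup>2 / 2 * ((\<theta> + sin \<theta> * cos \<theta>) / 2 * D2 h z b b + (sin \<theta>)\<^sup>2 * D2 h z b c + (\<theta> - sin \<theta> * cos \<theta>) / 2 * D2 h z c c + e / 2 * \<theta>)" for \<theta>
  have Gd: "(G has_real_derivative R \<theta>) (at \<theta> within S)" for \<theta> S
  proof -
    have s: "(sin \<theta>)\<^sup>2 = 1 - (cos \<theta>)\<^sup>2" by (simp add: sin_squared_eq)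
    show ?thesis
      unfolding G_def R_def
      by (rule derivative_eq_intros refl | simp)+ (simp add: s power2_eq_square[of "cos \<theta>", symmetric] power2_eq_square[of "sin \<theta>", symmetric] field_simps)
  qed
  have "(R has_integral (G (2 * pi) - G 0)) {0..2 * pi}"
    by (rule fundamental_theorem_of_calculus) (use Gd in \<open>auto simp: has_real_derivative_iff_has_vector_derivative[symmetric]\<close>)
  then have R: "R integrable_on {0..2 * pi}" "integral {0..2 * pi} R = G (2 * pi) - G 0"
    by (auto simp: has_integral_iff)
  have hc: "continuous_on U h"
    by (rule differentiable_imp_continuous_on[OF smooth_on_differentiable[OF h(1)]])
  have "(\<lambda>\<theta>. h (circle_pt z (complex_of_real t *s b) \<theta>)) integrable_on {0..2 * pi}"
    unfolding circ
  proof (rule integrable_continuous_real, rule continuous_on_compose2[OF hc])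
    show "continuous_on {0..2 * pi} (\<lambda>\<theta>. z + t *\<^sub>R v \<theta>)" unfolding v_def by (intro continuous_intros)
    show "(\<lambda>\<theta>. z + t *\<^sub>R v \<theta>) ` {0..2 * pi} \<subseteq> U" using v_in[of t] t subU by auto
  qed
  then have "integral {0..2 * pi} (\<lambda>\<theta>. h (circle_pt z (complex_of_real t *s b) \<theta>)) \<le> G (2 * pi) - G 0"
    unfolding R(2)[symmetric] by (rule integral_le[OF _ R(1)]) (rule up)
  moreover have "disc_in U z (complex_of_real t *s b)"
    unfolding disc_in_def using pt subU by blast
  then have "h z \<le> 1 / (2 * pi) * integral {0..2 * pi} (\<lambda>\<theta>. h (circle_pt z (complex_of_real t *s b) \<theta>))"
    using psh unfolding psh_real_def by blast
  ultimately have "h z \<le> 1 / (2 * pi) * (G (2 * pi) - G 0)"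
    by (smt (verit) mult_left_mono pi_gt_zero divide_nonneg_nonneg)
  also have "G (2 * pi) - G 0 = 2 * pi * (h z + t\<^sup>2 / 4 * (D2 h z b b + D2 h z c c + e))"
    by (simp add: G_def field_simps)
  also have "1 / (2 * pi) * (2 * pi * (h z + t\<^sup>2 / 4 * (D2 h z b b + D2 h z c c + e))) = h z + t\<^sup>2 / 4 * (D2 h z b b + D2 h z c c + e)"
    by simp
  finally have "0 \<le> t\<^sup>2 / 4 * (D2 h z b b + D2 h z c c + e)" by simp
  then have "0 \<le> D2 h z b b + D2 h z c c + e" using t by (simp add: zero_le_mult_iff)
  then show "0 \<le> D2 h z b b + D2 h z (\<i> *s b) (\<i> *s b) + e" by (simp add: c_def)
qed

lemma levi_of_real:
  fixes h :: "(complex, 'n::{finite,linorder}) vec \<Rightarrow> real"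
  assumes h: "smooth_on U h" "open U" "z \<in> U"
  shows "levi (\<lambda>z. complex_of_real (h z)) z k l =
    (D2 h z (axis k 1) (axis l 1) + D2 h z (axis k \<i>) (axis l \<i>)
     + \<i> * (D2 h z (axis k 1) (axis l \<i>) - D2 h z (axis k \<i>) (axis l 1))) / 2"
  unfolding levi_def wirt_z_eq_wirt wirt_zbar_eq_wirt wirt_wirt_of_real[OF h]
  using D2_sym[OF h, of "axis l 1" "axis k 1"] D2_sym[OF h, of "axis l \<i>" "axis k \<i>"]
    D2_sym[OF h, of "axis l \<i>" "axis k 1"] D2_sym[OF h, of "axis l 1" "axis k \<i>"]
  by (simp add: field_simps)

text \<open>Twice the real part of the Hermitian form at \<open>b\<close> is the second derivative
  along the corresponding vector plus the one along its rotation by \<i>, which is nonnegative by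
  \<open>psh_D2_nonneg\<close>. Hermitian symmetry is symmetry of \<open>D2\<close>.\<close>

lemma psh_levi_psd:
  fixes h :: "(complex, 'n::{finite,linorder}) vec \<Rightarrow> real"
  assumes h: "smooth_on U h" "open U" and psh: "psh_real U h" and z: "z \<in> U"
  shows "psd (levi (\<lambda>z. complex_of_real (h z)) z)"
proof -
  define A where "A = D2 h z"
  note lv = levi_of_real[OF h z, folded A_def]
  have sym: "A u v = A v u" for u v using D2_sym[OF h z] A_def by blast
  have lin: "linear (A u)" "linear (\<lambda>u. A u v)" for u v
    using D2_linear[OF h z] unfolding A_def by blast+
  have exp: "A (\<Sum>k\<in>UNIV. x k *\<^sub>R axis k 1 + y k *\<^sub>R axis k \<i>) (\<Sum>k\<in>UNIV. x k *\<^sub>R axis k 1 + y k *\<^sub>R axis k \<i>) =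
     (\<Sum>k\<in>UNIV. \<Sum>l\<in>UNIV. x k * x l * A (axis k 1) (axis l 1) + x k * y l * A (axis k 1) (axis l \<i>)
       + y k * x l * A (axis k \<i>) (axis l 1) + y k * y l * A (axis k \<i>) (axis l \<i>))" for x y :: "'n \<Rightarrow> real"
  proof -
    define u where "u k = x k *\<^sub>R axis k (1::complex) + y k *\<^sub>R axis k \<i>" for k :: 'n
    have "A (\<Sum>k\<in>UNIV. u k) (\<Sum>l\<in>UNIV. u l) = (\<Sum>l\<in>UNIV. \<Sum>k\<in>UNIV. A (u k) (u l))"
      unfolding linear_sum[OF lin(1)] linear_sum[OF lin(2)] ..
    also have "\<dots> = (\<Sum>k\<in>UNIV. \<Sum>l\<in>UNIV. A (u k) (u l))" by (rule sum.swap)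
    also have "\<dots> = (\<Sum>k\<in>UNIV. \<Sum>l\<in>UNIV. x k * x l * A (axis k 1) (axis l 1) + x k * y l * A (axis k 1) (axis l \<i>)
       + y k * x l * A (axis k \<i>) (axis l 1) + y k * y l * A (axis k \<i>) (axis l \<i>))"
      unfolding u_def linear_add[OF lin(1)] linear_add[OF lin(2)] linear_cmul[OF lin(1)] linear_cmul[OF lin(2)]
      by (intro sum.cong refl) (simp add: algebra_simps)
    finally show ?thesis unfolding u_def .
  qed
  have herm: "levi (\<lambda>z. complex_of_real (h z)) z l k = cnj (levi (\<lambda>z. complex_of_real (h z)) z k l)" for k l
    unfolding lv sym[of "axis l 1" "axis k 1"] sym[of "axis l \<i>" "axis k \<i>"]
      sym[of "axis l 1" "axis k \<i>"] sym[of "axis l \<i>" "axis k 1"]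
    by (simp add: complex_eq_iff)
  have "0 \<le> Re (\<Sum>k\<in>UNIV. \<Sum>l\<in>UNIV. levi (\<lambda>z. complex_of_real (h z)) z k l * (b k * cnj (b l)))" for b
  proof -
    define x where "x k = Re (b k)" for k
    define y where "y k = Im (b k)" for k
    define B :: "(complex, 'n) vec" where "B = (\<chi> k. b k)"
    have ax: "(\<Sum>k\<in>UNIV. axis k (c k)) = (\<chi> k. c k)" for c :: "'n \<Rightarrow> complex"
      by (simp add: vec_eq_iff axis_def)
    have sa: "r *\<^sub>R axis k c = axis k (complex_of_real r * c)" for r and k :: 'n and c
      by (simp add: vec_eq_iff axis_def) (simp add: scaleR_conv_of_real)
    have sb: "axis k c + axis k d = axis k (c + d)" for k :: 'n and c d :: complex
      by (simp add: vec_eq_iff axis_def)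
    have B1: "B = (\<Sum>k\<in>UNIV. x k *\<^sub>R axis k 1 + y k *\<^sub>R axis k \<i>)"
      unfolding sa sb ax by (simp add: B_def vec_eq_iff x_def y_def complex_eq_iff)
    have B2: "\<i> *s B = (\<Sum>k\<in>UNIV. (- y k) *\<^sub>R axis k 1 + x k *\<^sub>R axis k \<i>)"
      unfolding sa sb ax by (simp add: B_def vec_eq_iff x_def y_def complex_eq_iff)
    have "0 \<le> A B B + A (\<i> *s B) (\<i> *s B)" using psh_D2_nonneg[OF h psh z] A_def by simp
    also have "\<dots> = (\<Sum>k\<in>UNIV. \<Sum>l\<in>UNIV. (x k * x l + y k * y l) * (A (axis k 1) (axis l 1) + A (axis k \<i>) (axis l \<i>))
       + (x k * y l - y k * x l) * (A (axis k 1) (axis l \<i>) - A (axis k \<i>) (axis l 1)))"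
      unfolding arg_cong2[OF B2 B2, of A] arg_cong2[OF B1 B1, of A] exp unfolding sum.distrib[symmetric]
      by (intro sum.cong refl) (simp add: algebra_simps)
    also have "\<dots> = (\<Sum>k\<in>UNIV. \<Sum>l\<in>UNIV. 2 * Re (levi (\<lambda>z. complex_of_real (h z)) z k l * (b k * cnj (b l))))"
      unfolding lv x_def y_def by (intro sum.cong refl) (simp add: algebra_simps)
    finally have "0 \<le> 2 * (\<Sum>k\<in>UNIV. \<Sum>l\<in>UNIV. Re (levi (\<lambda>z. complex_of_real (h z)) z k l * (b k * cnj (b l))))"
      by (simp only: sum_distrib_left)
    then show ?thesis by (simp only: Re_sum)
  qed
  then show ?thesis unfolding psd_def using herm by blast
qed

subsection \<open>Positive functionals and decreasing sequences\<close>

lemma test_fun_bounded: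
  assumes "test_fun \<Omega> f" "open \<Omega>"
  shows "\<exists>M\<ge>0. \<forall>z. cmod (f z) \<le> M"
proof -
  obtain K where K: "compact K" "\<And>x. x \<notin> K \<Longrightarrow> f x = 0" using assms unfolding test_fun_def by blast
  have "continuous_on K f"
    by (rule continuous_on_subset[OF differentiable_imp_continuous_on[OF
          smooth_on_differentiable[OF test_fun_smooth_UNIV[OF assms]]]]) auto
  then have "bounded (f ` K)" using K(1) compact_continuous_image compact_imp_bounded by blast
  then obtain M where "\<And>z. z \<in> K \<Longrightarrow> cmod (f z) \<le> M" "M > 0" unfolding bounded_pos by auto
  then have "M \<ge> 0 \<and> (\<forall>z. cmod (f z) \<le> M)" using K(2) by (metis less_imp_le norm_zero)
  then show ?thesis by blast
qed

lemma test_fun_minus: "open \<Omega> \<Longrightarrow> test_fun \<Omega> f \<Longrightarrow> test_fun \<Omega> g \<Longrightarrow> test_fun \<Omega> (\<lambda>x. f x - g x)"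
  using test_fun_add[of \<Omega> f "\<lambda>x. (-1) * g x"] test_fun_cmult[of \<Omega> g "-1"] by simp

lemma test_fun_outside: "test_fun \<Omega> f \<Longrightarrow> z \<notin> \<Omega> \<Longrightarrow> f z = 0"
  unfolding test_fun_def by blast

lemma test_fun_Re_Im:
  assumes "open \<Omega>" "test_fun \<Omega> f"
  shows "test_fun \<Omega> (\<lambda>z. complex_of_real (Re (f z)))" "test_fun \<Omega> (\<lambda>z. complex_of_real (Im (f z)))"
proof -
  obtain K where K: "compact K" "K \<subseteq> \<Omega>" "\<And>x. x \<notin> K \<Longrightarrow> f x = 0" "smooth_on \<Omega> f"
    using assms unfolding test_fun_def by blast
  have L: "bounded_linear (\<lambda>c. complex_of_real (Re c))" "bounded_linear (\<lambda>c. complex_of_real (Im c))"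
    using bounded_linear_compose[OF bounded_linear_of_real bounded_linear_Re]
      bounded_linear_compose[OF bounded_linear_of_real bounded_linear_Im] by auto
  show "test_fun \<Omega> (\<lambda>z. complex_of_real (Re (f z)))" "test_fun \<Omega> (\<lambda>z. complex_of_real (Im (f z)))"
    by (rule test_funI[OF smooth_on_linear_comp[OF L(1) assms(1) K(4)] K(1,2)], simp add: K(3))
       (rule test_funI[OF smooth_on_linear_comp[OF L(2) assms(1) K(4)] K(1,2)], simp add: K(3))
qed

text \<open>A function of the squared distance, hence smooth at the centre as well; it interpolates
  from 1 within radius \<open>r\<close> to 0 beyond radius \<open>s\<close>.\<close>

definition bump :: "'a::real_inner \<Rightarrow> real \<Rightarrow> real \<Rightarrow> 'a \<Rightarrow> real" where
  "bump x r s z = step (r\<^sup>2) (s\<^sup>2) ((norm (z - x))\<^sup>2)"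

lemma smooth_on_norm_sq: "open U \<Longrightarrow> smooth_on U (\<lambda>z::'a::real_inner. (norm (z - x))\<^sup>2)"
proof -
  assume U: "open U"
  have "smooth_on U (\<lambda>z. z - x)"
    using smooth_on_diff[OF U smooth_on_bounded_linear[OF U bounded_linear_ident] smooth_on_const] .
  then have "smooth_on U (\<lambda>z. (z - x) \<bullet> (z - x))"
    unfolding smooth_on_iff_Ck by (intro allI Ck_bilinear[OF bounded_bilinear_inner U]) auto
  then show ?thesis by (simp add: power2_norm_eq_inner)
qed

lemma bump_smooth: "open U \<Longrightarrow> smooth_on U (bump x r s)"
  unfolding bump_def[abs_def] by (rule smooth_on_real_comp[OF _ step_smooth smooth_on_norm_sq])

lemma bump_bounds: "0 \<le> bump x r s z" "bump x r s z \<le> 1"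
  by (simp_all add: bump_def step_nonneg step_le_1)

lemma bump_eq_1: "0 \<le> r \<Longrightarrow> r < s \<Longrightarrow> dist x z \<le> r \<Longrightarrow> bump x r s z = 1"
  unfolding bump_def by (rule step_eq_1) (auto simp: dist_norm norm_minus_commute intro!: power_mono power_strict_mono)

lemma bump_eq_0: "0 \<le> r \<Longrightarrow> r < s \<Longrightarrow> dist x z \<ge> s \<Longrightarrow> bump x r s z = 0"
  unfolding bump_def by (rule step_eq_0) (auto simp: dist_norm norm_minus_commute intro!: power_mono power_strict_mono)

text \<open>In place of a partition of unity, \<open>f\<close> is peeled as \<eta> f + (1 - \<eta>)
  f with \<eta> a bump at one centre of a finite subcover. The first part lives in one good ball;
  the second vanishes on the half-sized ball and has one ball fewer to cover.\<close>

lemma test_fun_localize: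
  fixes \<Omega> :: "'a::real_inner set"
  assumes \<Omega>: "open \<Omega>"
    and zero: "Q (\<lambda>z. 0)" and add: "\<And>f g. test_fun \<Omega> f \<Longrightarrow> test_fun \<Omega> g \<Longrightarrow> Q f \<Longrightarrow> Q g \<Longrightarrow> Q (\<lambda>z. f z + g z)"
    and K: "compact K" and f: "test_fun \<Omega> f" "\<And>z. z \<notin> K \<Longrightarrow> f z = 0"
    and loc: "\<And>x. x \<in> K \<Longrightarrow> \<exists>r>0. \<forall>f. test_fun \<Omega> f \<and> (\<forall>z. z \<notin> ball x r \<longrightarrow> f z = 0) \<longrightarrow> Q f"
  shows "Q f"
proof -
  obtain r where r: "\<And>x. x \<in> K \<Longrightarrow> r x > (0::real)"
    "\<And>x f. x \<in> K \<Longrightarrow> test_fun \<Omega> f \<Longrightarrow> (\<And>z. z \<notin> ball x (r x) \<Longrightarrow> f z = 0) \<Longrightarrow> Q f"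
    using loc by metis
  have "K \<subseteq> (\<Union>x\<in>K. ball x (r x / 2))" using r(1) by force
  then obtain X where X: "X \<subseteq> K" "finite X" "K \<subseteq> (\<Union>x\<in>X. ball x (r x / 2))"
    using compactE_image[OF K, of K "\<lambda>x. ball x (r x / 2)"] by (metis open_ball)
  have *: "Q f" if "finite X" "X \<subseteq> K" "test_fun \<Omega> f" "\<And>z. f z \<noteq> 0 \<Longrightarrow> z \<in> (\<Union>x\<in>X. ball x (r x / 2))" for X f
    using that
  proof (induction X arbitrary: f rule: finite_induct)
    case empty
    then have "f = (\<lambda>z. 0)" by (auto simp: fun_eq_iff)
    then show ?case using zero by simp
  next
      case (insert x X)
    define \<eta> where "\<eta> z = complex_of_real (bump x (r x / 2) (r x) z)" for z
    have rx: "r x > 0" "x \<in> K" using insert.prems r(1) by auto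
    have sm: "smooth_on \<Omega> \<eta>" unfolding \<eta>_def[abs_def] by (intro smooth_on_of_real bump_smooth \<Omega>)
    have 1: "test_fun \<Omega> (\<lambda>z. \<eta> z * f z)" by (rule test_fun_mult[OF \<Omega> sm insert.prems(2)])
    have 2: "test_fun \<Omega> (\<lambda>z. (1 - \<eta> z) * f z)"
      by (rule test_fun_mult[OF \<Omega> smooth_on_diff[OF \<Omega> smooth_on_const sm] insert.prems(2)])
    have "Q (\<lambda>z. \<eta> z * f z)"
    proof (rule r(2)[OF rx(2) 1])
      fix z assume "z \<notin> ball x (r x)"
      then have "bump x (r x / 2) (r x) z = 0" using rx(1) by (intro bump_eq_0) auto
      then show "\<eta> z * f z = 0" by (simp add: \<eta>_def)
    qed
    moreover have "Q (\<lambda>z. (1 - \<eta> z) * f z)"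
    proof (rule insert.IH[OF _ 2])
      fix z assume z: "(1 - \<eta> z) * f z \<noteq> 0"
      have "z \<notin> ball x (r x / 2)"
      proof
        assume "z \<in> ball x (r x / 2)"
        then have "bump x (r x / 2) (r x) z = 1" using rx(1) by (intro bump_eq_1) auto
        then show False using z by (simp add: \<eta>_def)
      qed
      then show "z \<in> (\<Union>x\<in>X. ball x (r x / 2))" using insert.prems(3)[of z] z by auto
    qed (use insert.prems in auto)
    ultimately have "Q (\<lambda>z. \<eta> z * f z + (1 - \<eta> z) * f z)" by (rule add[OF 1 2])
    then show ?case by (simp add: algebra_simps)
  qed
  show ?thesis by (rule *[OF X(2,1) f(1)]) (use f(2) X(3) in blast)
qed

text \<open>Functionals on scalar test functions arise by freezing a constant form \<open>w\<close>:
  \<open>f \<mapsto> T (f w)\<close> and \<open>f \<mapsto> T (dd\<^sup>c (f w))\<close>.\<close>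
definition lin_functional :: "'a::real_normed_vector set \<Rightarrow> (('a \<Rightarrow> complex) \<Rightarrow> complex) \<Rightarrow> bool" where
  "lin_functional \<Omega> N \<longleftrightarrow>
     (\<forall>f g. test_fun \<Omega> f \<longrightarrow> test_fun \<Omega> g \<longrightarrow> N (\<lambda>z. f z + g z) = N f + N g)
   \<and> (\<forall>c f. test_fun \<Omega> f \<longrightarrow> N (\<lambda>z. c * f z) = c * N f)"

lemma lin_functionalD:
  assumes "lin_functional \<Omega> N"
  shows "test_fun \<Omega> f \<Longrightarrow> test_fun \<Omega> g \<Longrightarrow> N (\<lambda>z. f z + g z) = N f + N g"
    "test_fun \<Omega> f \<Longrightarrow> N (\<lambda>z. c * f z) = c * N f"
  using assms unfolding lin_functional_def by blast+

definition pos_functional :: "'a::real_normed_vector set \<Rightarrow> (('a \<Rightarrow> complex) \<Rightarrow> complex) \<Rightarrow> bool" where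
  "pos_functional \<Omega> N \<longleftrightarrow> lin_functional \<Omega> N
   \<and> (\<forall>h. test_fun \<Omega> (\<lambda>z. complex_of_real (h z)) \<longrightarrow> (\<forall>z. 0 \<le> h z) \<longrightarrow> nonneg_real (N (\<lambda>z. complex_of_real (h z))))"

lemma pos_functionalD:
  assumes "pos_functional \<Omega> N"
  shows "test_fun \<Omega> f \<Longrightarrow> test_fun \<Omega> g \<Longrightarrow> N (\<lambda>z. f z + g z) = N f + N g"
    "test_fun \<Omega> f \<Longrightarrow> N (\<lambda>z. c * f z) = c * N f"
    "test_fun \<Omega> (\<lambda>z. complex_of_real (h z)) \<Longrightarrow> (\<And>z. 0 \<le> h z) \<Longrightarrow> 0 \<le> Re (N (\<lambda>z. complex_of_real (h z)))"
    "test_fun \<Omega> (\<lambda>z. complex_of_real (h z)) \<Longrightarrow> (\<And>z. 0 \<le> h z) \<Longrightarrow> Im (N (\<lambda>z. complex_of_real (h z))) = 0"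
  using assms unfolding pos_functional_def lin_functional_def nonneg_real_def by (auto simp: complex_is_Real_iff)

section \<open>Convergence of positive functionals along the sequence\<close>

locale decreasing_smooth =
  fixes \<Omega> :: "'a::euclidean_space set" and G :: "nat \<Rightarrow> 'a \<Rightarrow> real"
  assumes \<Omega>: "open \<Omega>"
    and G_smooth: "\<And>j. smooth_on \<Omega> (G j)"
    and G_dec: "\<And>j z. z \<in> \<Omega> \<Longrightarrow> G (Suc j) z \<le> G j z"
begin

definition conv :: "(('a \<Rightarrow> complex) \<Rightarrow> complex) \<Rightarrow> ('a \<Rightarrow> complex) \<Rightarrow> bool" where
  "conv N f \<longleftrightarrow> convergent (\<lambda>j. N (\<lambda>z. complex_of_real (G j z) * f z))"

lemma test_fun_G: "test_fun \<Omega> f \<Longrightarrow> test_fun \<Omega> (\<lambda>z. complex_of_real (G j z) * f z)"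
  by (rule test_fun_mult[OF \<Omega> smooth_on_of_real[OF \<Omega> G_smooth]])

lemma conv_add:
  assumes "lin_functional \<Omega> N" "test_fun \<Omega> f" "test_fun \<Omega> g" "conv N f" "conv N g"
  shows "conv N (\<lambda>z. f z + g z)"
proof -
  have "N (\<lambda>z. complex_of_real (G j z) * (f z + g z)) =
      N (\<lambda>z. complex_of_real (G j z) * f z) + N (\<lambda>z. complex_of_real (G j z) * g z)" for j
    using lin_functionalD(1)[OF assms(1) test_fun_G[OF assms(2)] test_fun_G[OF assms(3)]]
    by (simp add: distrib_left)
  then show ?thesis using convergent_add assms(4,5) unfolding conv_def by simp
qed

lemma conv_cmult:
  assumes "lin_functional \<Omega> N" "test_fun \<Omega> f" "conv N f"
  shows "conv N (\<lambda>z. c * f z)"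
proof -
  have "N (\<lambda>z. complex_of_real (G j z) * (c * f z)) = c * N (\<lambda>z. complex_of_real (G j z) * f z)" for j
    using lin_functionalD(2)[OF assms(1) test_fun_G[OF assms(2)], of c] by (simp add: mult.left_commute)
  then show ?thesis using assms(3) convergent_mult[OF convergent_const] unfolding conv_def by auto
qed

lemma conv_zero: "lin_functional \<Omega> N \<Longrightarrow> conv N (\<lambda>z. 0)"
  using lin_functionalD(2)[of \<Omega> N "\<lambda>z. 0" 0] test_fun_zero[of \<Omega>] by (simp add: conv_def convergent_const)

lemma G_le_0: "z \<in> \<Omega> \<Longrightarrow> G j z \<le> G 0 z"
  by (induction j) (auto intro: order_trans[OF G_dec])

lemma Re_pos_mono:
  assumes N: "pos_functional \<Omega> N"
    and h: "test_fun \<Omega> (\<lambda>z. complex_of_real (h z))" and k: "test_fun \<Omega> (\<lambda>z. complex_of_real (k z))"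
    and le: "\<And>z. h z \<le> k z"
  shows "Re (N (\<lambda>z. complex_of_real (h z))) \<le> Re (N (\<lambda>z. complex_of_real (k z)))"
proof -
  have d: "test_fun \<Omega> (\<lambda>z. complex_of_real (k z - h z))"
    using test_fun_minus[OF \<Omega> k h] by simp
  have "N (\<lambda>z. complex_of_real (k z)) = N (\<lambda>z. complex_of_real (h z)) + N (\<lambda>z. complex_of_real (k z - h z))"
    using pos_functionalD(1)[OF N h d] by simp
  moreover have "0 \<le> Re (N (\<lambda>z. complex_of_real (k z - h z)))"
    by (rule pos_functionalD(3)[OF N d]) (simp add: le)
  ultimately show ?thesis by simp
qed

lemma test_fun_G_real:
  "test_fun \<Omega> (\<lambda>z. complex_of_real (s z)) \<Longrightarrow> test_fun \<Omega> (\<lambda>z. complex_of_real (G j z * s z))"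
  using test_fun_G[of "\<lambda>z. complex_of_real (s z)" j] by simp

text \<open>The values on \<open>G\<^sub>j s\<close> decrease, so a lower bound is all that convergence needs.\<close>
lemma conv_nonneg_dominated:
  assumes N: "pos_functional \<Omega> N"
    and F: "test_fun \<Omega> (\<lambda>z. complex_of_real (F z))"
    and B: "\<And>j. - B \<le> Re (N (\<lambda>z. complex_of_real (G j z * F z)))"
    and s: "test_fun \<Omega> (\<lambda>z. complex_of_real (s z))" "\<And>z. 0 \<le> s z" "\<And>z. s z \<le> c * F z"
    and c: "0 \<le> c"
  shows "conv N (\<lambda>z. complex_of_real (s z))"
proof -
  define a where "a j = N (\<lambda>z. complex_of_real (G j z * s z))" for j
  obtain K where K: "compact K" "K \<subseteq> \<Omega>" "\<And>x. x \<notin> K \<Longrightarrow> F x = 0"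
    using F unfolding test_fun_def by auto
  have "continuous_on K (G 0)"
    using differentiable_imp_continuous_on[OF smooth_on_differentiable[OF G_smooth]] K(2) continuous_on_subset by blast
  then have "bounded (G 0 ` K)" using K(1) compact_continuous_image compact_imp_bounded by blast
  \<comment> \<open>A bound for \<open>G 0\<close> on the support of \<open>F\<close> bounds every
    \<open>G j\<close> from above there, since the sequence decreases.\<close>
  then obtain M where M: "\<And>z. z \<in> K \<Longrightarrow> \<bar>G 0 z\<bar> \<le> M" unfolding bounded_iff by auto
  have GM: "G j z \<le> M" if "z \<in> K" for j z
    using G_le_0[of z j] M[OF that] K(2) that by fastforce
  have s0: "s z = 0" if "z \<notin> K" for z using s(2,3)[of z] K(3)[OF that] by simp
  note tGs = test_fun_G_real[OF s(1)] and tGF = test_fun_G_real[OF F]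
  have cm: "test_fun \<Omega> (\<lambda>z. complex_of_real (r * h z))" "N (\<lambda>z. complex_of_real (r * h z)) = of_real r * N (\<lambda>z. complex_of_real (h z))"
    if "test_fun \<Omega> (\<lambda>z. complex_of_real (h z))" for r h
    using test_fun_cmult[OF \<Omega> that, of "of_real r"] pos_functionalD(2)[OF N that, of "of_real r"] by simp_all
  have ad: "test_fun \<Omega> (\<lambda>z. complex_of_real (h z + k z))"
    "N (\<lambda>z. complex_of_real (h z + k z)) = N (\<lambda>z. complex_of_real (h z)) + N (\<lambda>z. complex_of_real (k z))"
    if "test_fun \<Omega> (\<lambda>z. complex_of_real (h z))" "test_fun \<Omega> (\<lambda>z. complex_of_real (k z))" for h k
    using test_fun_add[OF \<Omega> that] pos_functionalD(1)[OF N that] by simp_all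
  \<comment> \<open>\<open>G j\<close> may change sign, but both \<open>s\<close> and (M - G j) s
    are nonnegative test functions, so the functional is real on both and hence on their
    combination.\<close>
  have im: "Im (a j) = 0" for j
  proof -
    have pos: "test_fun \<Omega> (\<lambda>z. complex_of_real (M * s z + (-1) * (G j z * s z)))"
      by (intro ad(1) cm(1) tGs s(1))
    have "Im (N (\<lambda>z. complex_of_real (M * s z + (-1) * (G j z * s z)))) = 0"
    proof (rule pos_functionalD(4)[OF N pos])
      fix z
      show "0 \<le> M * s z + - 1 * (G j z * s z)"
        using GM[of z j] s(2)[of z] s0[of z] mult_right_mono[of "G j z" M "s z"] by (cases "z \<in> K") auto
    qed
    moreover have "Im (N (\<lambda>z. complex_of_real (s z))) = 0" by (rule pos_functionalD(4)[OF N s(1,2)])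
    ultimately show ?thesis
      by (simp only: ad(2)[OF cm(1)[OF s(1)] cm(1)[OF tGs]] cm(2)[OF s(1)] cm(2)[OF tGs] a_def) simp
  qed
  have dec: "Re (a (Suc j)) \<le> Re (a j)" for j
    unfolding a_def
  proof (rule Re_pos_mono[OF N tGs tGs])
    fix z show "G (Suc j) z * s z \<le> G j z * s z"
      using G_dec[of z j] s(2)[of z] s0[of z] K(2) by (cases "z \<in> K") (auto intro!: mult_right_mono)
  qed
  define m where "m = M * c * Re (N (\<lambda>z. complex_of_real (F z))) - M * Re (N (\<lambda>z. complex_of_real (s z)))"
  \<comment> \<open>Expanding (M - G j)(c F - s) >= 0 compares \<open>G j\<close> times
    \<open>s\<close> from below with \<open>G j\<close> times \<open>c F\<close>; the terms without
    \<open>G j\<close> are collected in \<open>m\<close>.\<close>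
  have low: "- c * B - m \<le> Re (a j)" for j
  proof -
    have "Re (N (\<lambda>z. complex_of_real (M * s z + c * (G j z * F z)))) \<le> Re (N (\<lambda>z. complex_of_real (M * c * F z + G j z * s z)))"
    proof (rule Re_pos_mono[OF N])
      show "test_fun \<Omega> (\<lambda>z. complex_of_real (M * s z + c * (G j z * F z)))"
        "test_fun \<Omega> (\<lambda>z. complex_of_real (M * c * F z + G j z * s z))"
        by (intro ad(1) cm(1) tGs tGF s(1) F)+
      fix z
      show "M * s z + c * (G j z * F z) \<le> M * c * F z + G j z * s z"
      proof (cases "z \<in> K")
        case True
        have "0 \<le> (M - G j z) * (c * F z - s z)"
          using GM[OF True, of j] s(3)[of z] by simp
        then show ?thesis by (simp add: algebra_simps)
      qed (simp add: s0 K(3))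
    qed
    then have "M * Re (N (\<lambda>z. complex_of_real (s z))) + c * Re (N (\<lambda>z. complex_of_real (G j z * F z)))
       \<le> M * c * Re (N (\<lambda>z. complex_of_real (F z))) + Re (a j)"
      by (simp only: ad(2)[OF cm(1)[OF s(1)] cm(1)[OF tGF]] ad(2)[OF cm(1)[OF F] tGs] cm(2)[OF s(1)] cm(2)[OF tGF] cm(2)[OF F] a_def)
         (simp flip: of_real_mult)
    moreover have "c * - B \<le> c * Re (N (\<lambda>z. complex_of_real (G j z * F z)))"
      by (rule mult_left_mono[OF B c])
    ultimately show ?thesis unfolding m_def by simp
  qed
  have "convergent (\<lambda>j. Re (a j))"
  proof (rule Bseq_monoseq_convergent)
    show "monoseq (\<lambda>j. Re (a j))" by (rule decseq_imp_monoseq[OF decseq_SucI[of "\<lambda>j. Re (a j)"]]) (rule dec)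
    show "Bseq (\<lambda>j. Re (a j))"
      by (rule decseq_bounded[OF decseq_SucI[of "\<lambda>j. Re (a j)"]]) (rule dec, rule allI, rule low)
  qed
  then have "convergent (\<lambda>j. complex_of_real (Re (a j)))"
    using tendsto_of_real unfolding convergent_def by blast
  moreover have "complex_of_real (Re (a j)) = a j" for j using im[of j] by (simp add: complex_eq_iff)
  ultimately show ?thesis unfolding conv_def a_def by simp
qed

text \<open>Real and imaginary part are treated separately. Each such \<open>r\<close> is the
  difference of M F and M F - r, both lying between 0 and 2 M F, so the nonnegative case applies
  twice.\<close>

lemma conv_dominated:
  assumes N: "pos_functional \<Omega> N"
    and F: "test_fun \<Omega> (\<lambda>z. complex_of_real (F z))" "\<And>z. 0 \<le> F z"
    and B: "\<And>j. - B \<le> Re (N (\<lambda>z. complex_of_real (G j z * F z)))"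
    and f: "test_fun \<Omega> f" "\<And>z. f z \<noteq> 0 \<Longrightarrow> 1 \<le> F z"
  shows "conv N f"
proof -
  have lin: "lin_functional \<Omega> N" using N by (simp add: pos_functional_def)
  obtain M where M: "M \<ge> 0" "\<And>z. cmod (f z) \<le> M" using test_fun_bounded[OF f(1) \<Omega>] by blast
  have cF: "test_fun \<Omega> (\<lambda>z. complex_of_real (M * F z))" using test_fun_cmult[OF \<Omega> F(1), of "of_real M"] by simp
  have real: "conv N (\<lambda>z. complex_of_real (r z))" and treal: "test_fun \<Omega> (\<lambda>z. complex_of_real (r z))"
    if r: "test_fun \<Omega> (\<lambda>z. complex_of_real (r z))" "\<And>z. \<bar>r z\<bar> \<le> cmod (f z)" for r
  proof -
    show "test_fun \<Omega> (\<lambda>z. complex_of_real (r z))" by (rule r)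
    have rM: "\<bar>r z\<bar> \<le> M * F z" for z
    proof (cases "f z = 0")
      case True
      then show ?thesis using r(2)[of z] M(1) F(2)[of z] by simp
    next
      case False
      have "\<bar>r z\<bar> \<le> M * 1" using r(2)[of z] M(2)[of z] by simp
      also have "\<dots> \<le> M * F z" by (rule mult_left_mono[OF f(2)[OF False] M(1)])
      finally show ?thesis .
    qed
    have t: "test_fun \<Omega> (\<lambda>z. complex_of_real (M * F z - r z))" using test_fun_minus[OF \<Omega> cF r(1)] by simp
    have 1: "conv N (\<lambda>z. complex_of_real (M * F z - r z))"
    proof (rule conv_nonneg_dominated[OF N F(1) B t])
      fix z show "0 \<le> M * F z - r z" "M * F z - r z \<le> (2 * M) * F z" using rM[of z] by auto
    qed (use M in auto)
    have 2: "conv N (\<lambda>z. complex_of_real (M * F z))"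
      by (rule conv_nonneg_dominated[OF N F(1) B cF _ _ M(1)]) (use M(1) F(2) in auto)
    have "conv N (\<lambda>z. complex_of_real (M * F z) + (-1) * complex_of_real (M * F z - r z))"
      by (rule conv_add[OF lin cF test_fun_cmult[OF \<Omega> t] 2 conv_cmult[OF lin t 1]])
    then show "conv N (\<lambda>z. complex_of_real (r z))" by simp
  qed
  note re = test_fun_Re_Im[OF \<Omega> f(1)]
  have "conv N (\<lambda>z. complex_of_real (Re (f z)) + \<i> * complex_of_real (Im (f z)))"
    by (intro conv_add[OF lin] conv_cmult[OF lin] test_fun_cmult[OF \<Omega>] re real abs_Re_le_cmod abs_Im_le_cmod)
  then show ?thesis by (simp flip: complex_eq)
qed

text \<open>For a bump \<open>F\<close> positivity turns the pointwise bound by \<open>- B\<close>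
  into a bound on the values at \<open>G j\<close> times \<open>F\<close>, and \<open>F\<close> is 1
  on the smaller ball, where it dominates the test functions in question.\<close>

lemma conv_local_bounded_below:
  assumes N: "pos_functional \<Omega> N" and x: "x \<in> \<Omega>"
    and e: "e > 0" "\<And>j y. y \<in> ball x e \<inter> \<Omega> \<Longrightarrow> - B \<le> G j y"
  shows "\<exists>r>0. \<forall>f. test_fun \<Omega> f \<and> (\<forall>z. z \<notin> ball x r \<longrightarrow> f z = 0) \<longrightarrow> conv N f"
proof -
  obtain d where d: "d > 0" "cball x d \<subseteq> \<Omega>" using open_contains_cball \<Omega> x by blast
  define r where "r = min d e / 2"
  have r: "0 < r" "r < 2 * r" "2 * r \<le> d" "2 * r \<le> e" using d e by (auto simp: r_def)
  define F where "F = bump x r (2 * r)"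
  have out: "F z = 0" if "z \<notin> ball x (2 * r)" for z using that r by (auto simp: F_def bump_eq_0)
  have "test_fun \<Omega> (\<lambda>z. complex_of_real (F z))"
  proof (rule test_funI)
    show "smooth_on \<Omega> (\<lambda>z. complex_of_real (F z))"
      unfolding F_def by (intro smooth_on_of_real bump_smooth \<Omega>)
    show "compact (cball x (2 * r))" "cball x (2 * r) \<subseteq> \<Omega>" using d r by auto
    show "complex_of_real (F z) = 0" if "z \<notin> cball x (2 * r)" for z using out[of z] that by auto
  qed
  note F = this
  have BF: "test_fun \<Omega> (\<lambda>z. complex_of_real (- B * F z))"
    "N (\<lambda>z. complex_of_real (- B * F z)) = of_real (- B) * N (\<lambda>z. complex_of_real (F z))"
    using test_fun_cmult[OF \<Omega> F, of "of_real (- B)"] pos_functionalD(2)[OF N F, of "of_real (- B)"] by simp_all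
  have low: "- (B * Re (N (\<lambda>z. complex_of_real (F z)))) \<le> Re (N (\<lambda>z. complex_of_real (G j z * F z)))" for j
  proof -
    have "Re (N (\<lambda>z. complex_of_real (- B * F z))) \<le> Re (N (\<lambda>z. complex_of_real (G j z * F z)))"
    proof (rule Re_pos_mono[OF N BF(1) test_fun_G_real[OF F]])
      fix z
      show "- B * F z \<le> G j z * F z"
      proof (cases "z \<in> ball x (2 * r)")
        case True
        then have "z \<in> ball x e \<inter> \<Omega>" using r d by auto
        from e(2)[OF this] show ?thesis
          by (rule mult_right_mono) (simp add: F_def bump_bounds)
      qed (simp add: out)
    qed
    then show ?thesis unfolding BF(2) by simp
  qed
  have "conv N f" if f: "test_fun \<Omega> f" "\<forall>z. z \<notin> ball x r \<longrightarrow> f z = 0" for f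
  proof (rule conv_dominated[OF N F _ low f(1)])
    show "0 \<le> F z" for z by (simp add: F_def bump_bounds)
    show "1 \<le> F z" if "f z \<noteq> 0" for z
      using f(2) that r unfolding F_def by (subst bump_eq_1) (auto intro: less_imp_le)
  qed
  then show ?thesis using r(1) by blast
qed

end

subsection \<open>Currents\<close>

text \<open>There are only finitely many coefficients, so the union of their supports is compact;
  questions about test forms become questions about scalar test functions.\<close>

lemma test_form_iff:
  assumes \<Omega>: "open \<Omega>"
  shows "test_form \<Omega> u \<longleftrightarrow> (\<forall>IJ. test_fun \<Omega> (\<lambda>z. u z IJ))"
proof
  assume u: "test_form \<Omega> u"
  show "\<forall>IJ. test_fun \<Omega> (\<lambda>z. u z IJ)"
  proof
    fix IJ
    have "u z IJ = 0" if "z \<notin> form_supp u" for z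
    proof (rule ccontr)
      assume "u z IJ \<noteq> 0"
      then have "z \<in> {z. u z \<noteq> (\<lambda>_. 0)}" by auto
      then have "z \<in> form_supp u" unfolding form_supp_def by (rule subsetD[OF closure_subset])
      with that show False by (rule notE)
    qed
    then show "test_fun \<Omega> (\<lambda>z. u z IJ)"
      using u unfolding test_form_def by (intro test_funI[of _ _ "form_supp u"]) (cases IJ, auto)
  qed
next
  assume u: "\<forall>IJ. test_fun \<Omega> (\<lambda>z. u z IJ)"
  then obtain K where K: "\<And>IJ. compact (K IJ)" "\<And>IJ. K IJ \<subseteq> \<Omega>" "\<And>IJ z. z \<notin> K IJ \<Longrightarrow> u z IJ = 0"
    unfolding test_fun_def by metis
  define L where "L = (\<Union>IJ\<in>UNIV. K IJ)"
  have L: "compact L" unfolding L_def by (intro compact_UN finite K(1))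
  have L': "L \<subseteq> \<Omega>" unfolding L_def by (intro UN_least K(2))
  have "{z. u z \<noteq> (\<lambda>_. 0)} \<subseteq> L" unfolding L_def using K(3) by auto
  then have sub: "form_supp u \<subseteq> L" unfolding form_supp_def by (rule closure_minimal) (use L compact_imp_closed in auto)
  moreover have "form_supp u = L \<inter> form_supp u" using sub by auto
  then have "compact (form_supp u)"
    using compact_Int_closed[OF L, of "form_supp u"] unfolding form_supp_def by auto
  ultimately show "test_form \<Omega> u"
    unfolding test_form_def using L' u test_fun_smooth by blast
qed

lemma test_fun_multc: "open \<Omega> \<Longrightarrow> test_fun \<Omega> f \<Longrightarrow> test_fun \<Omega> (\<lambda>x. f x * c)"
  using test_fun_cmult[of \<Omega> f c] by (simp add: mult.commute)

lemma test_form_scaled_form: "open \<Omega> \<Longrightarrow> test_fun \<Omega> f \<Longrightarrow> test_form \<Omega> (scaled_form f w)"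
  unfolding test_form_iff scaled_form_def by (simp add: test_fun_multc)

lemma test_form_sum:
  "open \<Omega> \<Longrightarrow> (\<And>i. i \<in> A \<Longrightarrow> test_form \<Omega> (u i)) \<Longrightarrow> test_form \<Omega> (\<lambda>z IJ. \<Sum>i\<in>A. u i z IJ)"
  unfolding test_form_iff by (auto intro: test_fun_sum)

lemma test_form_add: "open \<Omega> \<Longrightarrow> test_form \<Omega> u \<Longrightarrow> test_form \<Omega> v \<Longrightarrow> test_form \<Omega> (\<lambda>z IJ. u z IJ + v z IJ)"
  unfolding test_form_iff by (auto intro: test_fun_add)

lemma test_form_cmult: "open \<Omega> \<Longrightarrow> test_form \<Omega> u \<Longrightarrow> test_form \<Omega> (\<lambda>z IJ. c * u z IJ)"
  unfolding test_form_iff by (auto intro: test_fun_cmult)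

lemma test_form_mult:
  "open \<Omega> \<Longrightarrow> smooth_on \<Omega> h \<Longrightarrow> test_form \<Omega> u \<Longrightarrow> test_form \<Omega> (\<lambda>z IJ. h z * u z IJ)"
  unfolding test_form_iff by (auto intro: test_fun_mult)

lemma test_form_wedge11:
  assumes \<Omega>: "open \<Omega>" and M: "\<And>k l. test_fun \<Omega> (\<lambda>z. M z k l)"
  shows "test_form \<Omega> (\<lambda>z. wedge11 (M z) w)"
  unfolding test_form_iff[OF \<Omega>] wedge11_def
  by (intro allI test_fun_sum[OF \<Omega>] test_fun_multc[OF \<Omega> M])

lemma test_fun_wirt_z: "open \<Omega> \<Longrightarrow> test_fun \<Omega> f \<Longrightarrow> test_fun \<Omega> (wirt_z k f)"
  and test_fun_wirt_zbar: "open \<Omega> \<Longrightarrow> test_fun \<Omega> f \<Longrightarrow> test_fun \<Omega> (wirt_zbar k f)"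
  unfolding wirt_z_eq_wirt wirt_zbar_eq_wirt by (rule test_fun_wirt; assumption)+

lemma test_fun_levi: "open \<Omega> \<Longrightarrow> test_fun \<Omega> f \<Longrightarrow> test_fun \<Omega> (\<lambda>z. levi f z k l)"
  unfolding levi_def by (rule test_fun_add) (simp_all add: test_fun_wirt_z test_fun_wirt_zbar)

lemma ddcform_scaled_form_test: "open \<Omega> \<Longrightarrow> test_fun \<Omega> f \<Longrightarrow> ddcform (scaled_form f w) = (\<lambda>z. wedge11 (\<lambda>k l. \<i> * levi f z k l) w)"
  by (rule ext) (rule ddcform_scaled_form[OF test_fun_smooth_UNIV open_UNIV UNIV_I])

lemma test_form_ddcform_scaled_form: "open \<Omega> \<Longrightarrow> test_fun \<Omega> f \<Longrightarrow> test_form \<Omega> (ddcform (scaled_form f w))"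
  by (subst ddcform_scaled_form_test, assumption+) (intro test_form_wedge11 test_fun_cmult test_fun_levi)

lemma levi_add:
  assumes "smooth_on UNIV f" "smooth_on UNIV g"
  shows "levi (\<lambda>z. f z + g z) z k l = levi f z k l + levi g z k l"
proof -
  note d = smooth_on_differentiable_at[OF assms(1) open_UNIV UNIV_I] smooth_on_differentiable_at[OF assms(2) open_UNIV UNIV_I]
    smooth_on_differentiable_at[OF smooth_on_wirt[OF open_UNIV assms(1)] open_UNIV UNIV_I]
    smooth_on_differentiable_at[OF smooth_on_wirt[OF open_UNIV assms(2)] open_UNIV UNIV_I]
  have "wirt c k (\<lambda>z. f z + g z) = (\<lambda>z. wirt c k f z + wirt c k g z)" for c k
    by (rule ext) (simp add: wirt_add d)
  then show ?thesis unfolding levi_def wirt_z_eq_wirt wirt_zbar_eq_wirt by (simp add: wirt_add d)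
qed

lemma levi_cmult:
  assumes "smooth_on UNIV f"
  shows "levi (\<lambda>z. a * f z) z k l = a * levi f z k l"
proof -
  note d = smooth_on_differentiable_at[OF assms(1) open_UNIV UNIV_I]
    smooth_on_differentiable_at[OF smooth_on_wirt[OF open_UNIV assms(1)] open_UNIV UNIV_I]
  have "wirt c k (\<lambda>z. a * f z) = (\<lambda>z. a * wirt c k f z)" for c k
    by (rule ext) (simp add: wirt_cmult d)
  then show ?thesis unfolding levi_def wirt_z_eq_wirt wirt_zbar_eq_wirt by (simp add: wirt_cmult d distrib_left)
qed

lemma pf_wedge_cmult_right: "pf_wedge u (\<lambda>IJ. c * w IJ) = (\<lambda>IJ. c * pf_wedge u w IJ)"
  by (auto simp: fun_eq_iff pf_wedge_def sum_distrib_left ac_simps)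

text \<open>Outside \<Omega> nothing is known about the derivatives of \<open>h\<close>, but there
  the factor \<open>f\<close> vanishes, so the pointwise formula holds on the whole space.\<close>

lemma wedge_ddcform_fun:
  assumes \<Omega>: "open \<Omega>" and h: "smooth_on \<Omega> h" and f: "test_fun \<Omega> f"
  shows "wedge (ddcform (fun_form h)) (scaled_form f w) = (\<lambda>z IJ. f z * wedge11 (\<lambda>k l. \<i> * levi h z k l) w IJ)"
proof
  fix z
  have ff: "fun_form h = scaled_form h pf_one" by (auto simp: fun_form_def scaled_form_def pf_one_def fun_eq_iff)
  show "wedge (ddcform (fun_form h)) (scaled_form f w) z = (\<lambda>IJ. f z * wedge11 (\<lambda>k l. \<i> * levi h z k l) w IJ)"
  proof (cases "z \<in> \<Omega>")
    case True
    show ?thesis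
      unfolding wedge_def ff ddcform_scaled_form[OF h \<Omega> True] unfolding scaled_form_def pf_wedge_cmult_right pf_wedge_wedge11_one ..
  next
    case False
    then show ?thesis using test_fun_outside[OF f False] by (auto simp: wedge_def scaled_form_def pf_wedge_cmult_right fun_eq_iff)
  qed
qed

lemma pp_part_other: "(\<And>z. bideg a b (u z)) \<Longrightarrow> (a, b) \<noteq> (p, p) \<Longrightarrow> pp_part p u = (\<lambda>z IJ. 0)"
  by (auto simp: pp_part_def bideg_def fun_eq_iff)

lemma bideg_cmult: "bideg a b w \<Longrightarrow> bideg a b (\<lambda>IJ. c * w IJ)"
  by (auto simp: bideg_def)

lemma bideg_ext10: "bideg a b w \<Longrightarrow> bideg (Suc a) b (ext10 c w)"
  unfolding ext10_def by (rule bideg_sum[OF bideg_wedge_dz])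

lemma bideg_ext01: "bideg a b w \<Longrightarrow> bideg a (Suc b) (ext01 c w)"
  unfolding ext01_def by (rule bideg_sum[OF bideg_wedge_dzbar])

lemma bideg_pf_basis: "bideg (card I) (card J) (pf_basis (I, J))"
  by (auto simp: bideg_def pf_basis_def)

lemma pf_wedge_sum_right: "pf_wedge u (\<lambda>IJ. \<Sum>i\<in>A. w i IJ) = (\<lambda>IJ. \<Sum>i\<in>A. pf_wedge u (w i) IJ)"
proof -
  have add: "pf_wedge u (\<lambda>IJ. v IJ + w IJ) IJ = pf_wedge u v IJ + pf_wedge u w IJ" for v w IJ
    by (cases IJ) (simp add: pf_wedge_def sum.distrib distrib_left)
  have zero: "pf_wedge u (\<lambda>IJ. 0) = (\<lambda>IJ. 0)" by (auto simp: pf_wedge_def fun_eq_iff)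
  show ?thesis
    by (induction A rule: infinite_finite_induct) (auto simp: zero add fun_eq_iff)
qed

locale current_on =
  fixes \<Omega> :: "(complex, 'n::{finite,linorder}) vec set" and p :: nat and T :: "'n current"
  assumes \<Omega>: "open \<Omega>" and T: "is_current \<Omega> p T" and p: "1 \<le> p"
begin

lemma T_add: "test_form \<Omega> u \<Longrightarrow> test_form \<Omega> v \<Longrightarrow> T (\<lambda>z IJ. u z IJ + v z IJ) = T u + T v"
  and T_cmult: "test_form \<Omega> u \<Longrightarrow> T (\<lambda>z IJ. c * u z IJ) = c * T u"
  and T_pp_part: "test_form \<Omega> u \<Longrightarrow> T u = T (pp_part p u)"
  using T unfolding is_current_def by blast+

lemma test_form_zero: "test_form \<Omega> (\<lambda>z IJ. 0)"
  unfolding test_form_iff[OF \<Omega>] by (simp add: test_fun_zero)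

lemma T_zero: "T (\<lambda>z IJ. 0) = 0"
  using T_cmult[OF test_form_zero, of 0] by simp

lemma T_sum: "(\<And>i. i \<in> A \<Longrightarrow> test_form \<Omega> (u i)) \<Longrightarrow> T (\<lambda>z IJ. \<Sum>i\<in>A. u i z IJ) = (\<Sum>i\<in>A. T (u i))"
  by (induction A rule: infinite_finite_induct) (auto simp: T_zero T_add test_form_sum[OF \<Omega>])

lemma form_basis_expand: "u = (\<lambda>z IJ. \<Sum>A\<in>UNIV. scaled_form (\<lambda>z. u z A) (pf_basis A) z IJ)"
  unfolding scaled_form_def using pf_basis_expand[of "u z" for z] by (auto simp: fun_eq_iff)

lemma T_basis_expand:
  assumes u: "test_form \<Omega> u"
  shows "T u = (\<Sum>A\<in>UNIV. T (scaled_form (\<lambda>z. u z A) (pf_basis A)))"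
proof -
  have "T u = T (\<lambda>z IJ. \<Sum>A\<in>UNIV. scaled_form (\<lambda>z. u z A) (pf_basis A) z IJ)"
    by (rule arg_cong[where f = T, OF form_basis_expand])
  also have "\<dots> = (\<Sum>A\<in>UNIV. T (scaled_form (\<lambda>z. u z A) (pf_basis A)))"
    by (rule T_sum) (use u in \<open>auto simp: test_form_iff[OF \<Omega>] intro!: test_form_scaled_form[OF \<Omega>, unfolded test_form_iff[OF \<Omega>], rule_format]\<close>)
  finally show ?thesis .
qed

lemma T_other_bideg: "test_form \<Omega> u \<Longrightarrow> (\<And>z. bideg a b (u z)) \<Longrightarrow> (a, b) \<noteq> (p, p) \<Longrightarrow> T u = 0"
  using T_pp_part[of u] pp_part_other[of a b u p] T_zero by simp

lemma T_eqI: "test_form \<Omega> u \<Longrightarrow> test_form \<Omega> v \<Longrightarrow> pp_part p u = pp_part p v \<Longrightarrow> T u = T v"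
  using T_pp_part by metis

lemma dform_scaled_form_test:
  assumes f: "test_fun \<Omega> f"
  shows "dform (scaled_form f w) = (\<lambda>z IJ. ext10 (\<lambda>k. wirt_z k f z) w IJ + ext01 (\<lambda>k. wirt_zbar k f z) w IJ)"
  using test_fun_differentiable[OF f \<Omega>] by (auto simp: dform_def del_scaled_form delbar_scaled_form fun_eq_iff)

lemma test_form_ext10: "(\<And>k. test_fun \<Omega> (\<lambda>z. c k z)) \<Longrightarrow> test_form \<Omega> (\<lambda>z. ext10 (\<lambda>k. c k z) w)"
  and test_form_ext01: "(\<And>k. test_fun \<Omega> (\<lambda>z. c k z)) \<Longrightarrow> test_form \<Omega> (\<lambda>z. ext01 (\<lambda>k. c k z) w)"
  unfolding test_form_iff[OF \<Omega>] ext10_def ext01_def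
  by (intro allI test_fun_sum test_fun_multc \<Omega>; simp)+

lemma test_form_dform_scaled_form: "test_fun \<Omega> f \<Longrightarrow> test_form \<Omega> (dform (scaled_form f w))"
  unfolding dform_scaled_form_test
  by (intro test_form_add \<Omega> test_form_ext10 test_form_ext01 test_fun_wirt_z test_fun_wirt_zbar)

text \<open>Only the two mixed terms of \<open>d\<^sup>c (h d(f w))\<close> are of bidegree \<open>(p,p)\<close>.\<close>
lemma T_dcform_mult_dform:
  assumes h: "smooth_on \<Omega> h" and f: "test_fun \<Omega> f" and w: "bideg (p - 1) (p - 1) w"
  shows "T (dcform (mult_form h (dform (scaled_form f w)))) =
    T (\<lambda>z. wedge11 (\<lambda>k l. - \<i> * (wirt_zbar l (\<lambda>y. h y * wirt_z k f y) z + wirt_z k (\<lambda>y. h y * wirt_zbar l f y) z)) w)"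
proof -
  define C :: "'n + 'n \<Rightarrow> (complex, 'n) vec \<Rightarrow> complex" where
    "C = (\<lambda>q. case q of Inl l \<Rightarrow> (\<lambda>y. h y * wirt_zbar l f y) | Inr k \<Rightarrow> (\<lambda>y. h y * wirt_z k f y))"
  define W where "W = (\<lambda>q. case q of Inl l \<Rightarrow> wedge_dzbar l w | Inr k \<Rightarrow> wedge_dz k w)"
  have tz: "test_fun \<Omega> (\<lambda>y. h y * wirt_z k f y)" and tzb: "test_fun \<Omega> (\<lambda>y. h y * wirt_zbar k f y)" for k
    by (intro test_fun_mult \<Omega> h test_fun_wirt_z test_fun_wirt_zbar f)+
  have tC: "test_fun \<Omega> (C q)" for q
    unfolding C_def using tz tzb by (cases q) simp_all
  have e: "mult_form h (dform (scaled_form f w)) = (\<lambda>y IJ. \<Sum>q\<in>UNIV. C q y * W q IJ)"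
    unfolding dform_scaled_form_test[OF f]
    by (simp add: mult_form_def fun_eq_iff C_def W_def sum_UNIV_sum ext10_def ext01_def sum_distrib_left algebra_simps)
  have dc: "dcform (mult_form h (dform (scaled_form f w))) = (\<lambda>z IJ. \<i> * ((\<Sum>q\<in>UNIV. ext01 (\<lambda>k. wirt_zbar k (C q) z) (W q) IJ)
      - (\<Sum>q\<in>UNIV. ext10 (\<lambda>k. wirt_z k (C q) z) (W q) IJ)))"
    unfolding dcform_def e using test_fun_differentiable[OF tC \<Omega>]
    by (simp add: del_sum_scaled_form delbar_sum_scaled_form fun_eq_iff)
  have t1: "test_form \<Omega> (\<lambda>z IJ. ext01 (\<lambda>k. wirt_zbar k (C q) z) (W q) IJ)"
    and t2: "test_form \<Omega> (\<lambda>z IJ. ext10 (\<lambda>k. wirt_z k (C q) z) (W q) IJ)" for q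
    by (intro test_form_ext10 test_form_ext01 test_fun_wirt_z test_fun_wirt_zbar \<Omega> tC)+
  have "test_form \<Omega> (\<lambda>z IJ. \<i> * ((\<Sum>q\<in>UNIV. ext01 (\<lambda>k. wirt_zbar k (C q) z) (W q) IJ)
      + (-1) * (\<Sum>q\<in>UNIV. ext10 (\<lambda>k. wirt_z k (C q) z) (W q) IJ)))"
    by (intro test_form_cmult test_form_add test_form_sum \<Omega> t1 t2)
  then have test1: "test_form \<Omega> (dcform (mult_form h (dform (scaled_form f w))))" unfolding dc by simp
  have test2: "test_form \<Omega> (\<lambda>z. wedge11 (\<lambda>k l. - \<i> * (wirt_zbar l (\<lambda>y. h y * wirt_z k f y) z + wirt_z k (\<lambda>y. h y * wirt_zbar l f y) z)) w)"
    by (intro test_form_wedge11 test_fun_cmult test_fun_add test_fun_wirt_z test_fun_wirt_zbar tz tzb \<Omega>)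
  show ?thesis
  proof (rule T_eqI[OF test1 test2])
    have b: "bideg (p - 1) p (wedge_dzbar l w)" "bideg p (p - 1) (wedge_dz l w)" for l
      using bideg_wedge_dzbar[OF w, of l] bideg_wedge_dz[OF w, of l] p by simp_all
    have z1: "ext01 c (wedge_dzbar l w) (I, J) = 0" if "card I = p" "card J = p" for c l I J
      using bideg_ext01[OF b(1), of c l] that unfolding bideg_def by (metis n_not_Suc_n)
    have z2: "ext10 c (wedge_dz l w) (I, J) = 0" if "card I = p" "card J = p" for c l I J
      using bideg_ext10[OF b(2), of c l] that unfolding bideg_def by (metis n_not_Suc_n)
    have eq: "dcform (mult_form h (dform (scaled_form f w))) z (I, J) =
      wedge11 (\<lambda>k l. - \<i> * (wirt_zbar l (\<lambda>y. h y * wirt_z k f y) z + wirt_z k (\<lambda>y. h y * wirt_zbar l f y) z)) w (I, J)"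
      if IJ: "card I = p" "card J = p" for z I J
    proof -
      have "dcform (mult_form h (dform (scaled_form f w))) z (I, J) =
         \<i> * ((\<Sum>k\<in>UNIV. \<Sum>l\<in>UNIV. wirt_zbar l (\<lambda>y. h y * wirt_z k f y) z * wedge_dzbar l (wedge_dz k w) (I, J))
           - (\<Sum>l\<in>UNIV. \<Sum>k\<in>UNIV. wirt_z k (\<lambda>y. h y * wirt_zbar l f y) z * wedge_dz k (wedge_dzbar l w) (I, J)))"
        unfolding dc sum_UNIV_sum C_def W_def sum.case z1[OF IJ] z2[OF IJ] by (simp add: ext10_def ext01_def)
      also have "(\<Sum>l\<in>UNIV. \<Sum>k\<in>UNIV. wirt_z k (\<lambda>y. h y * wirt_zbar l f y) z * wedge_dz k (wedge_dzbar l w) (I, J))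
        = (\<Sum>k\<in>UNIV. \<Sum>l\<in>UNIV. wirt_z k (\<lambda>y. h y * wirt_zbar l f y) z * wedge_dz k (wedge_dzbar l w) (I, J))"
        by (rule sum.swap)
      also have "(\<Sum>k\<in>UNIV. \<Sum>l\<in>UNIV. wirt_zbar l (\<lambda>y. h y * wirt_z k f y) z * wedge_dzbar l (wedge_dz k w) (I, J))
        = - (\<Sum>k\<in>UNIV. \<Sum>l\<in>UNIV. wirt_zbar l (\<lambda>y. h y * wirt_z k f y) z * wedge_dz k (wedge_dzbar l w) (I, J))"
        by (simp add: wedge_dz_wedge_dzbar sum_negf)
      also have "\<i> * (- (\<Sum>k\<in>UNIV. \<Sum>l\<in>UNIV. wirt_zbar l (\<lambda>y. h y * wirt_z k f y) z * wedge_dz k (wedge_dzbar l w) (I, J)) - (\<Sum>k\<in>UNIV. \<Sum>l\<in>UNIV. wirt_z k (\<lambda>y. h y * wirt_zbar l f y) z * wedge_dz k (wedge_dzbar l w) (I, J))) = - \<i> * ((\<Sum>k\<in>UNIV. \<Sum>l\<in>UNIV. wirt_zbar l (\<lambda>y. h y * wirt_z k f y) z * wedge_dz k (wedge_dzbar l w) (I, J)) + (\<Sum>k\<in>UNIV. \<Sum>l\<in>UNIV. wirt_z k (\<lambda>y. h y * wirt_zbar l f y) z * wedge_dz k (wedge_dzbar l w) (I, J)))"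
        by (simp add: right_diff_distrib distrib_left)
      also have "(\<Sum>k\<in>UNIV. \<Sum>l\<in>UNIV. wirt_zbar l (\<lambda>y. h y * wirt_z k f y) z * wedge_dz k (wedge_dzbar l w) (I, J)) + (\<Sum>k\<in>UNIV. \<Sum>l\<in>UNIV. wirt_z k (\<lambda>y. h y * wirt_zbar l f y) z * wedge_dz k (wedge_dzbar l w) (I, J)) = (\<Sum>k\<in>UNIV. \<Sum>l\<in>UNIV.
          (wirt_zbar l (\<lambda>y. h y * wirt_z k f y) z + wirt_z k (\<lambda>y. h y * wirt_zbar l f y) z) * wedge_dz k (wedge_dzbar l w) (I, J))"
        by (simp only: sum.distrib distrib_right)
      finally show ?thesis by (simp only: wedge11_def sum_distrib_left mult.assoc)
    qed
    show "pp_part p (dcform (mult_form h (dform (scaled_form f w)))) = pp_part p (\<lambda>z. wedge11 (\<lambda>k l. - \<i> * (wirt_zbar l (\<lambda>y. h y * wirt_z k f y) z + wirt_z k (\<lambda>y. h y * wirt_zbar l f y) z)) w)"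
      by (auto simp: pp_part_def fun_eq_iff eq)
  qed
qed

text \<open>This is \<open>dd\<^sup>c h \<and> T = dd\<^sup>c(h T) - 2 d(h d\<^sup>c T) + h dd\<^sup>c T\<close>, tested against \<open>f w\<close>.\<close>
lemma ddc_fun_wedge_identity:
  fixes h :: "(complex, 'n) vec \<Rightarrow> real"
  assumes h: "smooth_on \<Omega> h" and f: "test_fun \<Omega> f" and w: "bideg (p - 1) (p - 1) w"
  shows "ddc_fun_wedge h T (scaled_form f w) =
    T (ddcform (scaled_form (\<lambda>z. complex_of_real (h z) * f z) w)) - 2 * fun_dc_current h T (dform (scaled_form f w))
    + T (\<lambda>z IJ. complex_of_real (h z) * ddcform (scaled_form f w) z IJ)"
proof -
  define H where "H z = complex_of_real (h z)" for z
  have H: "smooth_on \<Omega> H" unfolding H_def[abs_def] by (rule smooth_on_of_real[OF \<Omega> h])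
  define N where "N z k l = - \<i> * (wirt_zbar l (\<lambda>y. H y * wirt_z k f y) z + wirt_z k (\<lambda>y. H y * wirt_zbar l f y) z)" for z k l
  have Hf: "test_fun \<Omega> (\<lambda>z. H z * f z)" by (rule test_fun_mult[OF \<Omega> H f])
  \<comment> \<open>Leibniz rule: the first-order cross terms of the Levi matrix of
    \<open>H f\<close> cancel those of twice \<open>N\<close>, and the multiples of \<open>H\<close>
    times the Levi matrix of \<open>f\<close> add up to 1 - 2 + 1 = 0.\<close>
  have mat: "f z * (\<i> * levi H z k l) = \<i> * levi (\<lambda>z. H z * f z) z k l + 2 * N z k l + H z * (\<i> * levi f z k l)" for z k l
  proof (cases "z \<in> \<Omega>")
    case True
    have dw: "wirt c k f differentiable at z" for c k
      by (rule test_fun_differentiable[OF test_fun_wirt[OF \<Omega> f] \<Omega>])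
    have dH: "H differentiable at z" by (rule smooth_on_differentiable_at[OF H \<Omega> True])
    show ?thesis
      unfolding levi_mult[OF H test_fun_smooth[OF f] \<Omega> True] N_def
      unfolding levi_def wirt_z_eq_wirt wirt_zbar_eq_wirt wirt_mult[OF dH dw]
      by (simp add: algebra_simps)
  next
    case False
    obtain K where K: "compact K" "K \<subseteq> \<Omega>" "\<And>x. x \<notin> K \<Longrightarrow> f x = 0" using f unfolding test_fun_def by blast
    have o: "open (- K)" "z \<in> - K" using K False compact_imp_closed by auto
    have w0: "wirt c k f y = 0" if "y \<in> - K" for c k y
      by (rule wirt_eq_0_outside[OF o(1) that]) (use K in auto)
    have "levi (\<lambda>z. H z * f z) z k l = 0" "levi f z k l = 0" "f z = 0"
      using K o by (auto intro!: levi_eq_0_outside[OF o])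
    moreover have "N z k l = 0"
      unfolding N_def wirt_z_eq_wirt wirt_zbar_eq_wirt
      using wirt_eq_0_outside[OF o, of "\<lambda>y. H y * wirt _ _ f y"] w0 by simp
    ultimately show ?thesis by simp
  qed
  have tN: "test_form \<Omega> (\<lambda>z. wedge11 (N z) w)"
    unfolding N_def by (intro test_form_wedge11 test_fun_cmult test_fun_add test_fun_wirt_z test_fun_wirt_zbar test_fun_mult \<Omega> H f)
  have t3: "test_form \<Omega> (\<lambda>z IJ. H z * ddcform (scaled_form f w) z IJ)"
    by (rule test_form_mult[OF \<Omega> H test_form_ddcform_scaled_form[OF \<Omega> f]])
  have "wedge (ddcform (fun_form H)) (scaled_form f w) = (\<lambda>z IJ. (ddcform (scaled_form (\<lambda>z. H z * f z) w) z IJ + 2 * wedge11 (N z) w IJ)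
      + H z * ddcform (scaled_form f w) z IJ)"
  proof (intro ext)
    fix z IJ
    have "wedge (ddcform (fun_form H)) (scaled_form f w) z IJ = wedge11 (\<lambda>k l. f z * (\<i> * levi H z k l)) w IJ"
      unfolding wedge_ddcform_fun[OF \<Omega> H f] wedge11_cmult_left ..
    also have "\<dots> = wedge11 (\<lambda>k l. \<i> * levi (\<lambda>z. H z * f z) z k l + 2 * N z k l + H z * (\<i> * levi f z k l)) w IJ"
      unfolding mat ..
    finally show "wedge (ddcform (fun_form H)) (scaled_form f w) z IJ = (ddcform (scaled_form (\<lambda>z. H z * f z) w) z IJ + 2 * wedge11 (N z) w IJ)
      + H z * ddcform (scaled_form f w) z IJ"
      unfolding ddcform_scaled_form_test[OF \<Omega> Hf] ddcform_scaled_form_test[OF \<Omega> f] by (simp only: wedge11_add_left wedge11_cmult_left)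
  qed
  then have "T (wedge (ddcform (fun_form H)) (scaled_form f w)) = T (ddcform (scaled_form (\<lambda>z. H z * f z) w)) + 2 * T (\<lambda>z. wedge11 (N z) w)
     + T (\<lambda>z IJ. H z * ddcform (scaled_form f w) z IJ)"
    by (simp only: T_add[OF test_form_add[OF \<Omega> test_form_ddcform_scaled_form[OF \<Omega> Hf] test_form_cmult[OF \<Omega> tN]] t3]
        T_add[OF test_form_ddcform_scaled_form[OF \<Omega> Hf] test_form_cmult[OF \<Omega> tN]] T_cmult[OF tN])
  moreover have "T (\<lambda>z. wedge11 (N z) w) = - fun_dc_current h T (dform (scaled_form f w))"
    unfolding fun_dc_current_def N_def H_def[symmetric, abs_def] T_dcform_mult_dform[OF H f w] by simp
  ultimately show ?thesis unfolding ddc_fun_wedge_def H_def by simp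
qed

section \<open>Scalar functionals obtained from T and its dd^c\<close>

lemma lin_functional_T: "lin_functional \<Omega> (\<lambda>f. T (scaled_form f w))"
  unfolding lin_functional_def
proof (intro conjI allI impI)
  fix f g :: "(complex, 'n) vec \<Rightarrow> complex" and c
  assume f: "test_fun \<Omega> f"
  show "T (scaled_form (\<lambda>z. c * f z) w) = c * T (scaled_form f w)"
    using T_cmult[OF test_form_scaled_form[OF \<Omega> f], of c w] by (simp add: scaled_form_def mult.assoc)
  assume g: "test_fun \<Omega> g"
  show "T (scaled_form (\<lambda>z. f z + g z) w) = T (scaled_form f w) + T (scaled_form g w)"
    using T_add[OF test_form_scaled_form[OF \<Omega> f] test_form_scaled_form[OF \<Omega> g], of w w]
    by (simp add: scaled_form_def distrib_right)
qed

lemma pos_functional_T: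
  assumes "positive_current \<Omega> p T" "length as = p"
  shows "pos_functional \<Omega> (\<lambda>f. T (scaled_form f (elem_pos as)))"
  unfolding pos_functional_def
proof (intro conjI allI impI lin_functional_T)
  fix h :: "(complex, 'n) vec \<Rightarrow> real"
  assume h: "test_fun \<Omega> (\<lambda>z. complex_of_real (h z))" "\<forall>z. 0 \<le> h z"
  have "strongly_pos p (scaled_form (\<lambda>z. complex_of_real (h z)) (elem_pos as) z)" for z
    unfolding scaled_form_def by (rule strongly_pos_elem) (use h(2) assms(2) in auto)
  then show "nonneg_real (T (scaled_form (\<lambda>z. complex_of_real (h z)) (elem_pos as)))"
    using assms(1) test_form_scaled_form[OF \<Omega> h(1)] unfolding positive_current_def by blast
qed

lemma lin_functional_ddcT: "lin_functional \<Omega> (\<lambda>f. T (ddcform (scaled_form f w)))"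
  unfolding lin_functional_def
proof (intro conjI allI impI)
  fix f g :: "(complex, 'n) vec \<Rightarrow> complex" and c
  assume f: "test_fun \<Omega> f"
  note sf = test_fun_smooth_UNIV[OF f \<Omega>] and tf = test_form_ddcform_scaled_form[OF \<Omega> f, of w]
  have "ddcform (scaled_form (\<lambda>z. c * f z) w) = (\<lambda>z IJ. c * ddcform (scaled_form f w) z IJ)"
    unfolding ddcform_scaled_form_test[OF \<Omega> test_fun_cmult[OF \<Omega> f]] ddcform_scaled_form_test[OF \<Omega> f] levi_cmult[OF sf] wedge11_cmult_left[symmetric]
    by (simp add: mult.left_commute)
  then show "T (ddcform (scaled_form (\<lambda>z. c * f z) w)) = c * T (ddcform (scaled_form f w))"
    using T_cmult[OF tf] by simp
  assume g: "test_fun \<Omega> g"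
  note sg = test_fun_smooth_UNIV[OF g \<Omega>] and tg = test_form_ddcform_scaled_form[OF \<Omega> g, of w]
  have "ddcform (scaled_form (\<lambda>z. f z + g z) w) = (\<lambda>z IJ. ddcform (scaled_form f w) z IJ + ddcform (scaled_form g w) z IJ)"
    unfolding ddcform_scaled_form_test[OF \<Omega> test_fun_add[OF \<Omega> f g]] ddcform_scaled_form_test[OF \<Omega> f] ddcform_scaled_form_test[OF \<Omega> g]
      levi_add[OF sf sg] wedge11_add_left[symmetric]
    by (simp add: distrib_left)
  then show "T (ddcform (scaled_form (\<lambda>z. f z + g z) w)) = T (ddcform (scaled_form f w)) + T (ddcform (scaled_form g w))"
    using T_add[OF tf tg] by simp
qed

lemma pos_functional_ddcT:
  assumes "psh_current \<Omega> p T" "length as = p - 1"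
  shows "pos_functional \<Omega> (\<lambda>f. T (ddcform (scaled_form f (elem_pos as))))"
  unfolding pos_functional_def
proof (intro conjI allI impI lin_functional_ddcT)
  fix h :: "(complex, 'n) vec \<Rightarrow> real"
  assume h: "test_fun \<Omega> (\<lambda>z. complex_of_real (h z))" "\<forall>z. 0 \<le> h z"
  have "strongly_pos (p - 1) (scaled_form (\<lambda>z. complex_of_real (h z)) (elem_pos as) z)" for z
    unfolding scaled_form_def by (rule strongly_pos_elem) (use h(2) assms(2) in auto)
  then show "nonneg_real (T (ddcform (scaled_form (\<lambda>z. complex_of_real (h z)) (elem_pos as))))"
    using assms(1) test_form_scaled_form[OF \<Omega> h(1)] unfolding psh_current_def positive_current_def ddc_current_def by blast
qed

lemma test_form_wedge_ddcform:
  "smooth_on \<Omega> h \<Longrightarrow> test_fun \<Omega> f \<Longrightarrow> test_form \<Omega> (wedge (ddcform (fun_form h)) (scaled_form f w))"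
proof -
  assume h: "smooth_on \<Omega> h" and f: "test_fun \<Omega> f"
  have "test_form \<Omega> (\<lambda>z. wedge11 (\<lambda>k l. \<i> * levi h z k l * f z) w)"
    unfolding levi_def wirt_z_eq_wirt wirt_zbar_eq_wirt
    by (intro test_form_wedge11 \<Omega> test_fun_mult smooth_on_cmult smooth_on_add smooth_on_wirt h f)
  moreover have "wedge11 (\<lambda>k l. \<i> * levi h z k l * f z) w = (\<lambda>IJ. f z * wedge11 (\<lambda>k l. \<i> * levi h z k l) w IJ)" for z
    by (simp add: mult.commute[of _ "f z"] wedge11_cmult_left fun_eq_iff)
  ultimately show ?thesis unfolding wedge_ddcform_fun[OF \<Omega> h f] by simp
qed

text \<open>The Levi matrix of a plurisubharmonic function is positive semidefinite, so wedging it
  to a product of p - 1 elementary factors gives a strongly positive form of degree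
  \<open>p\<close>, to which positivity of \<open>T\<close> applies.\<close>

lemma ddc_fun_wedge_nonneg:
  fixes h F :: "(complex, 'n) vec \<Rightarrow> real"
  assumes pos: "positive_current \<Omega> p T" and h: "smooth_on \<Omega> h" "psh_real \<Omega> h"
    and F: "test_fun \<Omega> (\<lambda>z. complex_of_real (F z))" "\<And>z. 0 \<le> F z" and as: "length as = p - 1"
  shows "0 \<le> Re (ddc_fun_wedge h T (scaled_form (\<lambda>z. complex_of_real (F z)) (elem_pos as)))"
proof -
  define H where "H z = complex_of_real (h z)" for z
  have H: "smooth_on \<Omega> H" unfolding H_def[abs_def] by (rule smooth_on_of_real[OF \<Omega> h(1)])
  have "strongly_pos p (wedge (ddcform (fun_form H)) (scaled_form (\<lambda>z. complex_of_real (F z)) (elem_pos as)) z)" for z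
  proof (cases "z \<in> \<Omega>")
    case True
    have "strongly_pos (p - 1) (elem_pos as)" using strongly_pos_elem[of 1 as "p - 1"] as by simp
    from strongly_pos_wedge11[OF psh_levi_psd[OF h(1) \<Omega> h(2) True] this]
    have "strongly_pos p (wedge11 (\<lambda>k l. \<i> * levi H z k l) (elem_pos as))" using p unfolding H_def[abs_def] by simp
    then show ?thesis unfolding wedge_ddcform_fun[OF \<Omega> H F(1)] by (rule strongly_pos_scale[OF F(2)])
  next
    case False
    then show ?thesis unfolding wedge_ddcform_fun[OF \<Omega> H F(1)] test_fun_outside[OF F(1) False]
      by (simp add: strongly_pos_zero)
  qed
  then show ?thesis
    using pos test_form_wedge_ddcform[OF H F(1)]
    unfolding positive_current_def ddc_fun_wedge_def H_def[symmetric, abs_def] nonneg_real_def by blast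
qed

end

subsection \<open>Generic covectors\<close>

lemma cmod_pair_le: "cmod (pair a z) \<le> CARD('n) * (norm a * norm z)"
  for a z :: "(complex, 'n::finite) vec"
proof -
  have "cmod (pair a z) \<le> (\<Sum>k\<in>(UNIV :: 'n set). norm a * norm z)"
    unfolding pair_def
    by (rule order_trans[OF norm_sum], rule sum_mono)
       (simp add: norm_mult mult_mono component_le_norm_cart Finite_Cartesian_Product.norm_nth_le)
  then show ?thesis by simp
qed

lemma pair_diff_right: "pair a (z - w) = pair a z - pair a w"
  by (simp add: pair_def right_diff_distrib sum_subtractf)

lemma pair_axis_left: "pair (axis k c) z = c * z $ k"
proof -
  have "pair (axis k c) z = (\<Sum>i\<in>UNIV. if i = k then c * z $ k else 0)"
    unfolding pair_def by (rule sum.cong) (auto simp: axis_def)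
  then show ?thesis by simp
qed

lemma norm_axis_le: "norm (axis k c :: (complex, 'n::finite) vec) \<le> cmod c"
proof -
  have "norm (axis k c :: (complex, 'n) vec) \<le> (\<Sum>i\<in>UNIV. cmod ((axis k c :: (complex, 'n) vec) $ i))"
    unfolding norm_vec_def by (rule L2_set_le_sum) simp
  also have "\<dots> = (\<Sum>i\<in>(UNIV :: 'n set). if i = k then cmod c else 0)"
    by (rule sum.cong) (auto simp: axis_def)
  finally show ?thesis by simp
qed

lemma continuous_on_pair_left: "continuous_on S (\<lambda>a. pair a z)"
  unfolding pair_def by (intro continuous_intros)

lemma exists_large_component:
  fixes v :: "(complex, 'n::finite) vec"
  shows "\<exists>k. norm v / CARD('n) \<le> cmod (v $ k)"
proof (rule ccontr)
  assume "\<not> ?thesis"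
  then have lt: "cmod (v $ k) < norm v / CARD('n)" for k by (simp add: not_le)
  have "norm v \<le> (\<Sum>k\<in>UNIV. cmod (v $ k))"
    unfolding norm_vec_def by (rule L2_set_le_sum) simp
  also have "\<dots> < (\<Sum>k\<in>(UNIV::'n set). norm v / CARD('n))"
    by (rule sum_strict_mono) (use lt in auto)
  finally show False by simp
qed

text \<open>About \<open>1 / \<eta>\<^sup>2\<close> translates of the slab along a coordinate axis are pairwise disjoint and fit into
  a slightly larger ball.\<close>
lemma slab_volume_pos:
  fixes v :: "(complex, 'n::finite) vec"
  assumes \<rho>: "0 < \<rho>" "\<rho> \<le> norm v" and \<eta>: "0 < \<eta>"
  shows "emeasure lborel {\<xi> \<in> ball 0 S. cmod (pair \<xi> v) \<le> \<eta>}
    \<le> ennreal (144 * (CARD('n) / \<rho>)\<^sup>2 * measure lborel (ball (0 :: (complex, 'n) vec) (S + 1)) * \<eta>\<^sup>2)"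
proof -
  define D where "D = {\<xi> \<in> ball 0 S. cmod (pair \<xi> v) \<le> \<eta>}"
  define V where "V = measure lborel (ball (0 :: (complex, 'n) vec) (S + 1))"
  have V: "emeasure lborel (ball (0 :: (complex, 'n) vec) (S + 1)) = ennreal V"
    unfolding V_def using emeasure_lborel_ball_finite[of "0 :: (complex, 'n) vec" "S + 1"]
    by (intro emeasure_eq_ennreal_measure) (simp add: less_top)
  have D: "D \<in> sets borel"
  proof -
    have "closed {\<xi>. cmod (pair \<xi> v) \<le> \<eta>}"
      by (rule closed_Collect_le) (intro continuous_intros continuous_on_pair_left)+
    moreover have "D = ball 0 S \<inter> {\<xi>. cmod (pair \<xi> v) \<le> \<eta>}" by (auto simp: D_def)
    ultimately show ?thesis by (auto intro: borel_closed)
  qed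
  \<comment> \<open>Along a coordinate axis on which \<open>v\<close> has a component of size at
    least \<open>norm v / CARD('n)\<close>, a short translation changes \<open>pair _ v\<close> by a
    prescribed amount.\<close>
  obtain k where k: "norm v / CARD('n) \<le> cmod (v $ k)" using exists_large_component by blast
  define \<tau> where "\<tau> = \<rho> / CARD('n)"
  have \<tau>: "\<tau> > 0" "\<tau> \<le> cmod (v $ k)"
    using \<rho> k by (auto simp: \<tau>_def intro: order_trans[OF divide_right_mono])
  have vk: "v $ k \<noteq> 0" using \<tau> by auto
  show ?thesis
  \<comment> \<open>For a thick slab 36 \<eta>^2 / \<tau>^2 is at least 1, and the volume of the
    whole ball already satisfies the bound.\<close>
  proof (cases "\<tau> / (6 * \<eta>) < 1")
    case True
    have "emeasure lborel D \<le> emeasure lborel (ball (0 :: (complex, 'n) vec) (S + 1))"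
      by (rule emeasure_mono) (auto simp: D_def)
    also have "\<dots> \<le> ennreal (144 * (1 / \<tau>)\<^sup>2 * V * \<eta>\<^sup>2)"
    proof -
      have "1 \<le> 6 * \<eta> / \<tau>" using True \<eta> \<tau> by (simp add: field_simps)
      then have "1 \<le> (6 * \<eta> / \<tau>)\<^sup>2" by (simp add: one_le_power)
      also have "\<dots> = 36 * ((1 / \<tau>)\<^sup>2 * \<eta>\<^sup>2)" by (simp add: power_mult_distrib power_divide)
      also have "\<dots> \<le> 144 * ((1 / \<tau>)\<^sup>2 * \<eta>\<^sup>2)" by (intro mult_right_mono) auto
      also have "\<dots> = 144 * (1 / \<tau>)\<^sup>2 * \<eta>\<^sup>2" by simp
      finally have "1 * V \<le> 144 * (1 / \<tau>)\<^sup>2 * \<eta>\<^sup>2 * V" by (rule mult_right_mono) (simp add: V_def)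
      then show ?thesis unfolding V by (intro ennreal_leI) (simp add: ac_simps)
    qed
    finally show ?thesis unfolding D_def V_def \<tau>_def by simp
  next
    case False
    \<comment> \<open>The number of translates per real direction. As the floor of a number that is
      at least 1, it is at least half of that number; this gives the 12 below and, squared, the
      constant 144.\<close>
    define N where "N = nat \<lfloor>\<tau> / (6 * \<eta>)\<rfloor>"
    have N: "real N \<le> \<tau> / (6 * \<eta>)" "\<tau> / (12 * \<eta>) \<le> real N"
    proof -
      have 1: "1 \<le> \<tau> / (6 * \<eta>)" using False by simp
      then have fl: "real N = of_int \<lfloor>\<tau> / (6 * \<eta>)\<rfloor>" unfolding N_def by simp
      show "real N \<le> \<tau> / (6 * \<eta>)" unfolding fl by simp
      have "1 \<le> real N" using 1 unfolding fl by simp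
      moreover have "\<tau> / (6 * \<eta>) < real N + 1" unfolding fl by linarith
      moreover have "\<tau> / (6 * \<eta>) = 2 * (\<tau> / (12 * \<eta>))" by simp
      ultimately show "\<tau> / (12 * \<eta>) \<le> real N" by linarith
    qed
    \<comment> \<open>Under \<open>pair _ v\<close> these vectors form a square lattice of mesh 3
      \<eta>. The mesh exceeds 2 \<eta>, so the translated slabs are disjoint; the upper bound on
      \<open>N\<close> keeps the vectors of norm at most 1, whence the ball of radius S + 1.\<close>
    define x :: "nat \<times> nat \<Rightarrow> (complex, 'n) vec" where "x q = axis k (3 * \<eta> * Complex (real (fst q)) (real (snd q)) / v $ k)" for q
    define A where "A q = {\<xi>. \<xi> - x q \<in> D}" for q
    define I where "I = {..<N} \<times> {..<N}"
    have pair_x: "pair (x q) v = 3 * \<eta> * Complex (real (fst q)) (real (snd q))" for q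
      using vk by (simp add: x_def pair_axis_left)
    have norm_x: "norm (x q) \<le> 1" if "q \<in> I" for q
    proof -
      have "norm (x q) \<le> 3 * \<eta> * cmod (Complex (real (fst q)) (real (snd q))) / cmod (v $ k)"
        unfolding x_def by (rule order_trans[OF norm_axis_le]) (use \<eta> in \<open>simp add: norm_mult norm_divide\<close>)
      also have "\<dots> \<le> 3 * \<eta> * (2 * real N) / cmod (v $ k)"
      proof -
        have "cmod (Complex (real (fst q)) (real (snd q))) \<le> real (fst q) + real (snd q)"
          using cmod_le[of "Complex (real (fst q)) (real (snd q))"] by simp
        also have "\<dots> \<le> 2 * real N" using that by (auto simp: I_def)
        finally show ?thesis using \<eta> by (intro divide_right_mono mult_left_mono) auto
      qed
      also have "\<dots> \<le> 3 * \<eta> * (2 * real N) / \<tau>" using \<tau> \<eta> vk by (intro divide_left_mono mult_pos_pos) auto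
      also have "\<dots> \<le> 3 * \<eta> * (2 * (\<tau> / (6 * \<eta>))) / \<tau>"
        using N(1) \<tau> \<eta> by (intro divide_right_mono mult_left_mono) auto
      also have "\<dots> = 1" using \<tau> \<eta> by simp
      finally show ?thesis .
    qed
    have A_sets: "A q \<in> sets borel" for q
    proof -
      have "(\<lambda>\<xi>. \<xi> - x q) \<in> borel_measurable borel" by simp
      from measurable_sets[OF this D] show ?thesis by (simp add: A_def vimage_def)
    qed
    have A_meas: "emeasure lborel (A q) = emeasure lborel D" for q
    proof -
      have "emeasure lborel (A q) = emeasure (distr lborel borel ((+) (x q))) (A q)"
        using lborel_distr_plus[of "x q"] by simp
      also have "\<dots> = emeasure lborel ((+) (x q) -` A q \<inter> space lborel)"
        by (rule emeasure_distr) (use A_sets in auto)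
      also have "(+) (x q) -` A q \<inter> space lborel = D" by (auto simp: A_def)
      finally show ?thesis .
    qed
    have disj: "disjoint_family_on A I"
      unfolding disjoint_family_on_def
    proof (intro ballI impI)
      fix q q' assume "q \<in> I" "q' \<in> I" "q \<noteq> q'"
      show "A q \<inter> A q' = {}"
      proof (rule ccontr)
        assume "A q \<inter> A q' \<noteq> {}"
        then obtain \<xi> where "\<xi> - x q \<in> D" "\<xi> - x q' \<in> D" by (auto simp: A_def)
        then have le: "cmod (pair (\<xi> - x q) v) \<le> \<eta>" "cmod (pair (\<xi> - x q') v) \<le> \<eta>" by (auto simp: D_def)
        have "pair (\<xi> - x q) v - pair (\<xi> - x q') v = pair (x q') v - pair (x q) v"
          by (simp add: pair_def left_diff_distrib sum_subtractf)
        then have "cmod (pair (x q') v - pair (x q) v) \<le> 2 * \<eta>"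
          using norm_triangle_ineq4[of "pair (\<xi> - x q) v" "pair (\<xi> - x q') v"] le by simp
        also have "pair (x q') v - pair (x q) v = 3 * \<eta> * Complex (real (fst q') - real (fst q)) (real (snd q') - real (snd q))"
          unfolding pair_x by (simp add: complex_eq_iff algebra_simps)
        also have "cmod \<dots> = 3 * \<eta> * cmod (Complex (real (fst q') - real (fst q)) (real (snd q') - real (snd q)))"
          using \<eta> by (simp add: norm_mult)
        finally have "cmod (Complex (real (fst q') - real (fst q)) (real (snd q') - real (snd q))) \<le> 2 / 3"
          using \<eta> by (simp add: field_simps)
        then have "\<bar>real (fst q') - real (fst q)\<bar> \<le> 2 / 3" "\<bar>real (snd q') - real (snd q)\<bar> \<le> 2 / 3"
          using abs_Re_le_cmod[of "Complex (real (fst q') - real (fst q)) (real (snd q') - real (snd q))"]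
            abs_Im_le_cmod[of "Complex (real (fst q') - real (fst q)) (real (snd q') - real (snd q))"] by auto
        then have "fst q = fst q'" "snd q = snd q'" by linarith+
        then show False using \<open>q \<noteq> q'\<close> by (simp add: prod_eq_iff)
      qed
    qed
    have "ennreal (real (N * N)) * emeasure lborel D = (\<Sum>q\<in>I. emeasure lborel (A q))"
      unfolding A_meas by (simp add: I_def ennreal_of_nat_eq_real_of_nat)
    also have "\<dots> = emeasure lborel (\<Union>q\<in>I. A q)"
      by (rule sum_emeasure) (use A_sets disj in \<open>auto simp: I_def\<close>)
    also have "\<dots> \<le> emeasure lborel (ball (0 :: (complex, 'n) vec) (S + 1))"
    proof (rule emeasure_mono)
      show "(\<Union>q\<in>I. A q) \<subseteq> ball 0 (S + 1)"
      proof
        fix \<xi> assume "\<xi> \<in> (\<Union>q\<in>I. A q)"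
        then obtain q where q: "q \<in> I" "\<xi> - x q \<in> D" by (auto simp: A_def)
        then have "norm (\<xi> - x q) < S" by (auto simp: D_def)
        then show "\<xi> \<in> ball 0 (S + 1)"
          using norm_x[OF q(1)] norm_triangle_ineq[of "\<xi> - x q" "x q"] by simp
      qed
    qed simp
    also have "\<dots> = ennreal V" by (rule V)
    finally have le: "ennreal (real (N * N)) * emeasure lborel D \<le> ennreal V" .
    have "emeasure lborel D \<le> emeasure lborel (ball (0 :: (complex, 'n) vec) (S + 1))"
      by (rule emeasure_mono) (auto simp: D_def)
    then have "emeasure lborel D \<noteq> top" unfolding V using ennreal_less_top le_less_trans less_top by blast
    then have Dm: "emeasure lborel D = ennreal (measure lborel D)" by (rule emeasure_eq_ennreal_measure)
    have "real (N * N) * measure lborel D \<le> V"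
      using le unfolding Dm by (subst (asm) ennreal_mult[symmetric]) (auto simp: V_def)
    moreover have "(\<tau> / (12 * \<eta>))\<^sup>2 * measure lborel D \<le> real (N * N) * measure lborel D"
    proof (rule mult_right_mono)
      have "(\<tau> / (12 * \<eta>))\<^sup>2 \<le> (real N)\<^sup>2" using N(2) \<tau> \<eta> by (intro power_mono) auto
      then show "(\<tau> / (12 * \<eta>))\<^sup>2 \<le> real (N * N)" by (simp add: power2_eq_square)
    qed simp
    ultimately have "(\<tau> / (12 * \<eta>))\<^sup>2 * measure lborel D \<le> V" by linarith
    then have "measure lborel D \<le> 144 * (1 / \<tau>)\<^sup>2 * V * \<eta>\<^sup>2"
      using \<tau> \<eta> by (simp add: power_divide power_mult_distrib field_simps)
    then show ?thesis unfolding D_def[symmetric] Dm V_def[symmetric] by (intro ennreal_leI) (simp add: \<tau>_def)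
  qed
qed

text \<open>Width zero has to be included because covering sets may have diameter zero; it follows
  from the slabs of width 1/(n+1) in the limit.\<close>

lemma slab_volume:
  fixes v :: "(complex, 'n::finite) vec"
  assumes \<rho>: "0 < \<rho>" "\<rho> \<le> norm v" and \<eta>: "0 \<le> \<eta>"
  shows "emeasure lborel {\<xi> \<in> ball 0 S. cmod (pair \<xi> v) \<le> \<eta>}
    \<le> ennreal (144 * (CARD('n) / \<rho>)\<^sup>2 * measure lborel (ball (0 :: (complex, 'n) vec) (S + 1)) * \<eta>\<^sup>2)"
proof (cases "\<eta> = 0")
  case False
  then show ?thesis using slab_volume_pos[OF \<rho>] \<eta> by simp
next
  case True
  define Q where "Q = 144 * (CARD('n) / \<rho>)\<^sup>2 * measure lborel (ball (0 :: (complex, 'n) vec) (S + 1))"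
  have "emeasure lborel {\<xi> \<in> ball 0 S. cmod (pair \<xi> v) \<le> \<eta>} \<le> ennreal (Q * (inverse (real (Suc n)))\<^sup>2)" for n
  proof -
    have "emeasure lborel {\<xi> \<in> ball 0 S. cmod (pair \<xi> v) \<le> \<eta>}
      \<le> emeasure lborel {\<xi> \<in> ball 0 S. cmod (pair \<xi> v) \<le> inverse (real (Suc n))}"
    proof (rule emeasure_mono)
      have "closed {\<xi>. cmod (pair \<xi> v) \<le> inverse (real (Suc n))}"
        by (rule closed_Collect_le) (intro continuous_intros continuous_on_pair_left)+
      moreover have "{\<xi> \<in> ball 0 S. cmod (pair \<xi> v) \<le> inverse (real (Suc n))} = ball 0 S \<inter> {\<xi>. cmod (pair \<xi> v) \<le> inverse (real (Suc n))}"
        by auto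
      ultimately show "{\<xi> \<in> ball 0 S. cmod (pair \<xi> v) \<le> inverse (real (Suc n))} \<in> sets lborel"
        by (auto intro: borel_closed)
    qed (auto simp: True)
    also have "\<dots> \<le> ennreal (Q * (inverse (real (Suc n)))\<^sup>2)"
      unfolding Q_def by (rule slab_volume_pos[OF \<rho>]) simp
    finally show ?thesis .
  qed
  moreover have "(\<lambda>n. ennreal (Q * (inverse (real (Suc n)))\<^sup>2)) \<longlonglongrightarrow> ennreal (Q * 0\<^sup>2)"
    by (intro tendsto_ennrealI tendsto_intros LIMSEQ_inverse_real_of_nat)
  ultimately have "emeasure lborel {\<xi> \<in> ball 0 S. cmod (pair \<xi> v) \<le> \<eta>} \<le> ennreal (Q * 0\<^sup>2)"
    by (intro LIMSEQ_le_const) auto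
  then show ?thesis by (simp add: True)
qed

text \<open>The supremum over all scales is zero, so the infimum at the single scale 1 is zero as
  well; smallness of the individual sets is governed by the sum.\<close>

lemma hausdorff_measure_0_cover:
  assumes "hausdorff_measure s A = 0" "e > 0"
  shows "\<exists>U. A \<subseteq> (\<Union>i. U i) \<and> (\<forall>i. bounded (U i)) \<and> (\<Sum>i. ennreal (diameter (U i) ^ s)) < e"
proof -
  have "(INF U\<in>{U :: nat \<Rightarrow> 'a set. A \<subseteq> (\<Union>i. U i) \<and> (\<forall>i. bounded (U i) \<and> diameter (U i) \<le> 1)}.
        (\<Sum>i. ennreal (diameter (U i) ^ s))) \<le> hausdorff_measure s A"
    unfolding hausdorff_measure_def by (rule SUP_upper) simp
  then have "(INF U\<in>{U :: nat \<Rightarrow> 'a set. A \<subseteq> (\<Union>i. U i) \<and> (\<forall>i. bounded (U i) \<and> diameter (U i) \<le> 1)}.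
        (\<Sum>i. ennreal (diameter (U i) ^ s))) < e"
    using assms by simp
  then show ?thesis unfolding INF_less_iff by blast
qed

text \<open>Sections of \<open>E\<close> by the common kernel of generic covectors have vanishing one-dimensional
  measure, so they miss almost all spheres.\<close>
lemma generic_covectors:
  fixes E :: "(complex, 'n::finite) vec set" and \<Lambda> :: "nat \<Rightarrow> (complex, 'n) vec"
  assumes E: "hausdorff_measure (2 * m + 1) E = 0" and R: "0 < R" and \<delta>: "0 < \<delta>"
  shows "\<exists>\<Lambda>' r. (\<forall>i<m. norm (\<Lambda>' i - \<Lambda> i) < \<delta>) \<and> 0 < r \<and> r < R \<and>
    (\<forall>z\<in>E. norm (z - a) = r \<longrightarrow> (\<exists>i<m. pair (\<Lambda>' i) (z - a) \<noteq> 0))"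
proof -
  define S where "S = (\<Sum>i<m. norm (\<Lambda> i)) + \<delta>"
  define Q where "Q = 144 * (CARD('n) / (R / 2))\<^sup>2 * measure lborel (ball (0 :: (complex, 'n) vec) (S + 1))"
  define L where "L = CARD('n) * S"
  define M where "M = PiM {..<m} (\<lambda>_. lborel :: (complex, 'n) vec measure)"
  have S: "ball (\<Lambda> i) \<delta> \<subseteq> ball 0 S" if "i < m" for i
  proof
    fix x assume x: "x \<in> ball (\<Lambda> i) \<delta>"
    have "norm (\<Lambda> i) \<le> (\<Sum>i<m. norm (\<Lambda> i))" using that by (intro member_le_sum) auto
    then show "x \<in> ball 0 S"
      using x norm_triangle_sub[of x "\<Lambda> i"] by (simp add: S_def dist_norm norm_minus_commute)
  qed
  have S0: "S \<ge> 0" using \<delta> by (simp add: S_def sum_nonneg)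
  have Q: "Q \<ge> 0" by (simp add: Q_def)
  have L: "L \<ge> 0" using S0 by (simp add: L_def)
  interpret product_sigma_finite "\<lambda>_::nat. lborel :: (complex, 'n) vec measure"
    by standard
  interpret M: sigma_finite_measure M unfolding M_def by (rule sigma_finite) simp
  \<comment> \<open>The box of parameters: covectors close to \<Lambda> together with a radius.
    Radii above \<open>R / 2\<close> keep the relevant vectors away from zero, which is the
    \<open>R / 2\<close> in \<open>Q\<close> and makes the slab estimate uniform.\<close>
  define Bx where "Bx = (\<Pi>\<^sub>E i\<in>{..<m}. ball (\<Lambda> i) \<delta>) \<times> {R / 2<..<R}"
  have Bx_sets: "Bx \<in> sets (M \<Otimes>\<^sub>M lborel)"
    unfolding Bx_def M_def by (intro pair_measureI sets_PiM_I_finite) auto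
  have Bx_pos: "emeasure (M \<Otimes>\<^sub>M lborel) Bx > 0"
  proof -
    have "emeasure (M \<Otimes>\<^sub>M lborel) Bx = emeasure M (\<Pi>\<^sub>E i\<in>{..<m}. ball (\<Lambda> i) \<delta>) * emeasure lborel {R / 2<..<R}"
      unfolding Bx_def by (rule lborel.emeasure_pair_measure_Times) (auto simp: M_def intro!: sets_PiM_I_finite)
    also have "emeasure M (\<Pi>\<^sub>E i\<in>{..<m}. ball (\<Lambda> i) \<delta>) = (\<Prod>i<m. emeasure lborel (ball (\<Lambda> i) \<delta>))"
      unfolding M_def by (rule emeasure_PiM) auto
    finally have eq: "emeasure (M \<Otimes>\<^sub>M lborel) Bx = (\<Prod>i<m. emeasure lborel (ball (\<Lambda> i) \<delta>)) * ennreal (R - R / 2)"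
      using R by simp
    have "emeasure lborel (ball (\<Lambda> i) \<delta>) \<noteq> 0" for i
    proof
      assume "emeasure lborel (ball (\<Lambda> i) \<delta>) = 0"
      then have "ball (\<Lambda> i) \<delta> \<in> null_sets lborel" by auto
      then have "negligible (ball (\<Lambda> i) \<delta>)" using negligible_iff_null_sets null_sets_completionI by blast
      then show False using open_not_negligible[of "ball (\<Lambda> i) \<delta>"] \<delta> by simp
    qed
    then have "(\<Prod>i<m. emeasure lborel (ball (\<Lambda> i) \<delta>)) \<noteq> 0" by simp
    then show ?thesis unfolding eq using R by (simp add: zero_less_iff_neq_zero ennreal_eq_0_iff)
  qed
  \<comment> \<open>For a covering set of diameter d, \<open>m\<close> slabs of volume at most Q (L
    d)^2 and a radius interval of length 2 d have the product C d^(2m+1).\<close>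
  define C where "C = (Q * L\<^sup>2) ^ m * 2"
  have C: "C \<ge> 0" using Q by (simp add: C_def)
  \<comment> \<open>The denominator \<open>C + 1\<close> below also covers
    \<open>C = 0\<close>.\<close>
  obtain e where e: "e > 0" "ennreal C * e < emeasure (M \<Otimes>\<^sub>M lborel) Bx"
  proof (cases "emeasure (M \<Otimes>\<^sub>M lborel) Bx")
    case (real b)
    then have b: "b > 0" using Bx_pos by simp
    show ?thesis
    proof (rule that[of "ennreal (b / (C + 1))"])
      show "ennreal (b / (C + 1)) > 0" using b C by simp
      have "C * (b / (C + 1)) < b" using b C by (simp add: field_simps)
      then show "ennreal C * ennreal (b / (C + 1)) < emeasure (M \<Otimes>\<^sub>M lborel) Bx"
        unfolding real using b C by (subst ennreal_mult[symmetric]) (auto intro!: ennreal_lessI)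
    qed
  next
    case top
    show ?thesis by (rule that[of 1]) (auto simp: top)
  qed
  obtain U where U: "E \<subseteq> (\<Union>i. U i)" "\<And>i. bounded (U i)" "(\<Sum>i. ennreal (diameter (U i) ^ (2 * m + 1))) < e"
    using hausdorff_measure_0_cover[OF E e(1)] by blast
  define W where "W i = {z \<in> U i \<inter> E. R / 2 \<le> norm (z - a)}" for i
  \<comment> \<open>A reference point of the covering set: conditions at an unknown point of it are
    transported to this one at the cost of the diameter.\<close>
  define w where "w i = (SOME z. z \<in> W i)" for i
  have w: "w i \<in> W i" if "W i \<noteq> {}" for i unfolding w_def using that by (simp add: some_in_eq)
  define d where "d i = diameter (U i)" for i
  have d0: "d i \<ge> 0" for i using diameter_ge_0[OF U(2)] by (simp add: d_def)
  \<comment> \<open>Contains all parameters of the box that are bad because of a point z of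
    \<open>U i\<close>: vanishing of \<open>pair\<close> at z - a leaves at most
    \<open>L * d i\<close> at \<open>w i - a\<close>, and the two distances from \<open>a\<close>
    differ by at most \<open>d i\<close>.\<close>
  define X where "X i = (if W i = {} then {} else
     (\<Pi>\<^sub>E j\<in>{..<m}. {\<xi> \<in> ball 0 S. cmod (pair \<xi> (w i - a)) \<le> L * d i}) \<times> {norm (w i - a) - d i..norm (w i - a) + d i})" for i
  have slab: "{\<xi> \<in> ball 0 S. cmod (pair \<xi> (w i - a)) \<le> L * d i} \<in> sets lborel" for i
  proof -
    have "closed {\<xi>. cmod (pair \<xi> (w i - a)) \<le> L * d i}"
      by (rule closed_Collect_le) (intro continuous_intros continuous_on_pair_left)+
    moreover have "{\<xi> \<in> ball 0 S. cmod (pair \<xi> (w i - a)) \<le> L * d i} = ball 0 S \<inter> {\<xi>. cmod (pair \<xi> (w i - a)) \<le> L * d i}"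
      by auto
    ultimately show ?thesis by (auto intro: borel_closed)
  qed
  have X_sets: "X i \<in> sets (M \<Otimes>\<^sub>M lborel)" for i
    unfolding X_def M_def using slab by (auto intro!: pair_measureI sets_PiM_I_finite)
  have X_meas: "emeasure (M \<Otimes>\<^sub>M lborel) (X i) \<le> ennreal C * ennreal (d i ^ (2 * m + 1))" for i
  proof (cases "W i = {}")
    case True
    then show ?thesis by (simp add: X_def)
  next
    case False
    have "emeasure (M \<Otimes>\<^sub>M lborel) (X i) = emeasure M (\<Pi>\<^sub>E j\<in>{..<m}. {\<xi> \<in> ball 0 S. cmod (pair \<xi> (w i - a)) \<le> L * d i})
       * emeasure lborel {norm (w i - a) - d i..norm (w i - a) + d i}"
      unfolding X_def using False
      by (simp, intro lborel.emeasure_pair_measure_Times) (auto simp: M_def slab[simplified] intro!: sets_PiM_I_finite)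
    also have "emeasure M (\<Pi>\<^sub>E j\<in>{..<m}. {\<xi> \<in> ball 0 S. cmod (pair \<xi> (w i - a)) \<le> L * d i})
       = (\<Prod>j<m. emeasure lborel {\<xi> \<in> ball 0 S. cmod (pair \<xi> (w i - a)) \<le> L * d i})"
      unfolding M_def by (rule emeasure_PiM) (use slab in auto)
    also have "emeasure lborel {norm (w i - a) - d i..norm (w i - a) + d i} = ennreal (2 * d i)"
      using d0[of i] by simp
    also have "(\<Prod>j<m. emeasure lborel {\<xi> \<in> ball 0 S. cmod (pair \<xi> (w i - a)) \<le> L * d i})
       \<le> (\<Prod>j<m. ennreal (Q * (L * d i)\<^sup>2))"
    proof -
      have "emeasure lborel {\<xi> \<in> ball 0 S. cmod (pair \<xi> (w i - a)) \<le> L * d i} \<le> ennreal (Q * (L * d i)\<^sup>2)"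
        unfolding Q_def using w[OF False] R L d0[of i] by (intro slab_volume) (auto simp: W_def)
      then show ?thesis by (intro prod_mono_ennreal)
    qed
    also have "(\<Prod>j<m. ennreal (Q * (L * d i)\<^sup>2)) * ennreal (2 * d i) = ennreal C * ennreal (d i ^ (2 * m + 1))"
    proof -
      have "(\<Prod>j<m. ennreal x) * ennreal y = ennreal (x ^ m * y)" if "0 \<le> x" "0 \<le> y" for x y
        using that by (simp add: ennreal_power ennreal_mult)
      then have "(\<Prod>j<m. ennreal (Q * (L * d i)\<^sup>2)) * ennreal (2 * d i) = ennreal ((Q * (L * d i)\<^sup>2) ^ m * (2 * d i))"
        using Q d0[of i] by simp
      also have "(Q * (L * d i)\<^sup>2) ^ m * (2 * d i) = C * d i ^ (2 * m + 1)"
        by (simp add: C_def power_mult_distrib power_mult)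
      finally show ?thesis using C d0[of i] by (simp add: ennreal_mult)
    qed
    finally show ?thesis by (simp add: mult_right_mono)
  qed
  have "emeasure (M \<Otimes>\<^sub>M lborel) (\<Union>i. X i) \<le> (\<Sum>i. emeasure (M \<Otimes>\<^sub>M lborel) (X i))"
    by (rule emeasure_subadditive_countably) (use X_sets in auto)
  also have "\<dots> \<le> (\<Sum>i. ennreal C * ennreal (d i ^ (2 * m + 1)))"
    by (rule suminf_le) (use X_meas in auto)
  also have "\<dots> = ennreal C * (\<Sum>i. ennreal (d i ^ (2 * m + 1)))" by (rule ennreal_suminf_cmult)
  also have "\<dots> \<le> ennreal C * e" using U(3) unfolding d_def by (intro mult_left_mono) auto
  also have "\<dots> < emeasure (M \<Otimes>\<^sub>M lborel) Bx" by (rule e(2))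
  finally have lt: "emeasure (M \<Otimes>\<^sub>M lborel) (\<Union>i. X i) < emeasure (M \<Otimes>\<^sub>M lborel) Bx" .
  have "\<not> Bx \<subseteq> (\<Union>i. X i)"
  proof
    assume "Bx \<subseteq> (\<Union>i. X i)"
    then have "emeasure (M \<Otimes>\<^sub>M lborel) Bx \<le> emeasure (M \<Otimes>\<^sub>M lborel) (\<Union>i. X i)"
      by (rule emeasure_mono) (use X_sets in auto)
    then show False using lt by simp
  qed
  then obtain q where q: "q \<in> Bx" "q \<notin> (\<Union>i. X i)" by blast
  obtain \<Lambda>' r where "q = (\<Lambda>', r)" by (cases q)
  with q have \<Lambda>': "(\<Lambda>', r) \<in> Bx" "\<And>i. (\<Lambda>', r) \<notin> X i" by blast+
  have near: "norm (\<Lambda>' i - \<Lambda> i) < \<delta>" if "i < m" for i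
    using \<Lambda>'(1) that by (auto simp: Bx_def PiE_iff dist_norm norm_minus_commute)
  have r: "R / 2 < r" "r < R" using \<Lambda>'(1) by (auto simp: Bx_def)
  have good: "\<exists>i<m. pair (\<Lambda>' i) (z - a) \<noteq> 0" if z: "z \<in> E" "norm (z - a) = r" for z
  proof (rule ccontr)
    assume "\<not> ?thesis"
    then have zero: "pair (\<Lambda>' j) (z - a) = 0" if "j < m" for j using that by blast
    obtain i where i: "z \<in> U i" using U(1) z(1) by blast
    have zW: "z \<in> W i" using i z r by (simp add: W_def)
    then have W: "W i \<noteq> {}" by auto
    have wU: "w i \<in> U i" using w[OF W] by (simp add: W_def)
    have dz: "norm (w i - z) \<le> d i"
      using diameter_bounded_bound[OF U(2) wU i] by (simp add: d_def dist_norm)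
    have "(\<Lambda>', r) \<in> X i"
      unfolding X_def if_not_P[OF W]
    proof (rule SigmaI)
      show "r \<in> {norm (w i - a) - d i..norm (w i - a) + d i}"
        using dz z(2) norm_triangle_ineq3[of "w i - a" "z - a"] by auto
      show "\<Lambda>' \<in> (\<Pi>\<^sub>E j\<in>{..<m}. {\<xi> \<in> ball 0 S. cmod (pair \<xi> (w i - a)) \<le> L * d i})"
      proof (rule PiE_I)
        fix j assume "j \<in> {..<m}"
        then have j: "j < m" by simp
        have jS: "\<Lambda>' j \<in> ball 0 S" using near[OF j] by (intro subsetD[OF S[OF j]]) (simp add: dist_norm norm_minus_commute)
        have "pair (\<Lambda>' j) (w i - a) = pair (\<Lambda>' j) (w i - z)"
          using zero[OF j] by (simp add: pair_diff_right)
        also have "cmod \<dots> \<le> CARD('n) * (norm (\<Lambda>' j) * norm (w i - z))" by (rule cmod_pair_le)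
        also have "\<dots> \<le> CARD('n) * (S * d i)"
          using jS dz S0 by (intro mult_left_mono mult_mono) auto
        finally show "\<Lambda>' j \<in> {\<xi> \<in> ball 0 S. cmod (pair \<xi> (w i - a)) \<le> L * d i}"
          using jS by (simp add: L_def mult.assoc)
      next
        fix j assume "j \<notin> {..<m}"
        then show "\<Lambda>' j = undefined" using \<Lambda>'(1) by (auto simp: Bx_def PiE_iff extensional_def)
      qed
    qed
    then show False using \<Lambda>'(2) by blast
  qed
  show ?thesis using near good r R by (intro exI[of _ \<Lambda>'] exI[of _ r]) auto
qed

subsection \<open>The currents \<open>dd\<^sup>c G\<^sub>j \<and> T\<close>\<close>

text \<open>The limit function is represented by \<open>L\<close> alone: what is kept of it is that
  the sequence is bounded below off \<open>L\<close>, locally and uniformly in \<open>j\<close>. The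
  dimension is 2p - 1 in the shape that \<open>generic_covectors\<close> takes for m = p -
  1.\<close>

locale psh_product = current_on \<Omega> p T + decreasing_smooth \<Omega> G
  for \<Omega> :: "(complex, 'n::{finite,linorder}) vec set" and p and T :: "'n current" and G +
  fixes L :: "(complex, 'n) vec set"
  assumes pos: "positive_current \<Omega> p T" and psh: "psh_current \<Omega> p T"
    and G_psh: "\<And>j. psh_real \<Omega> (G j)"
    and conv_dc: "\<And>u. test_form \<Omega> u \<Longrightarrow> convergent (\<lambda>j. fun_dc_current (G j) T u)"
    and L_open: "open (\<Omega> - L)"
    and G_below: "\<And>x. x \<in> \<Omega> - L \<Longrightarrow> \<exists>e>0. \<exists>B. \<forall>j. \<forall>y\<in>ball x e \<inter> \<Omega>. - B \<le> G j y"
    and small: "hausdorff_measure (2 * (p - 1) + 1) (L \<inter> current_supp \<Omega> T) = 0"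
begin

abbreviation "E \<equiv> L \<inter> current_supp \<Omega> T"

text \<open>Convergence for all test functions in some ball around the point; compactness of
  supports upgrades it to \<open>conv\<close>, see \<open>conv_of_loc\<close>. The ball may depend
  on the functional, hence on the constant form.\<close>

definition loc :: "(((complex, 'n) vec \<Rightarrow> complex) \<Rightarrow> complex) \<Rightarrow> (complex, 'n) vec \<Rightarrow> bool" where
  "loc N x \<longleftrightarrow> (\<exists>r>0. \<forall>f. test_fun \<Omega> f \<and> (\<forall>z. z \<notin> ball x r \<longrightarrow> f z = 0) \<longrightarrow> conv N f)"

lemma loc_add:
  assumes "loc N x" "loc N' x" "\<And>f. test_fun \<Omega> f \<Longrightarrow> N'' f = N f + N' f"
  shows "loc N'' x"
proof -
  obtain r r' where r: "r > 0" "r' > 0"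
    "\<And>f. test_fun \<Omega> f \<Longrightarrow> (\<forall>z. z \<notin> ball x r \<longrightarrow> f z = 0) \<Longrightarrow> conv N f"
    "\<And>f. test_fun \<Omega> f \<Longrightarrow> (\<forall>z. z \<notin> ball x r' \<longrightarrow> f z = 0) \<Longrightarrow> conv N' f"
    using assms(1,2) unfolding loc_def by blast
  have "conv N'' f" if f: "test_fun \<Omega> f" "\<forall>z. z \<notin> ball x (min r r') \<longrightarrow> f z = 0" for f
  proof -
    have "conv N f" "conv N' f" using f by (auto intro!: r(3,4))
    then show ?thesis unfolding conv_def using assms(3)[OF test_fun_G[OF f(1)]] by (simp add: convergent_add)
  qed
  then show ?thesis unfolding loc_def using r(1,2) by (intro exI[of _ "min r r'"]) auto
qed

lemma loc_cmult:
  assumes "loc N x" "\<And>f. test_fun \<Omega> f \<Longrightarrow> N'' f = c * N f"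
  shows "loc N'' x"
proof -
  obtain r where r: "r > 0" "\<And>f. test_fun \<Omega> f \<Longrightarrow> (\<forall>z. z \<notin> ball x r \<longrightarrow> f z = 0) \<Longrightarrow> conv N f"
    using assms(1) unfolding loc_def by blast
  have "conv N'' f" if f: "test_fun \<Omega> f" "\<forall>z. z \<notin> ball x r \<longrightarrow> f z = 0" for f
    using r(2)[OF f] convergent_mult[OF convergent_const, of _ c] assms(2)[OF test_fun_G[OF f(1)]] unfolding conv_def by auto
  then show ?thesis unfolding loc_def using r(1) by blast
qed

lemma loc_zero: "(\<And>f. test_fun \<Omega> f \<Longrightarrow> N f = 0) \<Longrightarrow> loc N x"
  unfolding loc_def conv_def using test_fun_G by (intro exI[of _ 1]) (auto simp: convergent_const)

section \<open>Dependence on the constant form, and convergence away from E\<close>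

lemma T_scaled_form_add: "test_fun \<Omega> f \<Longrightarrow> T (scaled_form f (\<lambda>IJ. v IJ + w IJ)) = T (scaled_form f v) + T (scaled_form f w)"
  using T_add[OF test_form_scaled_form[OF \<Omega>] test_form_scaled_form[OF \<Omega>], of f f v w] by (simp add: scaled_form_def distrib_left)

lemma T_scaled_form_cmult: "test_fun \<Omega> f \<Longrightarrow> T (scaled_form f (\<lambda>IJ. c * w IJ)) = c * T (scaled_form f w)"
  using T_cmult[OF test_form_scaled_form[OF \<Omega>], of f c w] by (simp add: scaled_form_def mult.left_commute)

lemma T_scaled_form_zero: "T (scaled_form f (\<lambda>_. 0)) = 0"
  using T_zero by (simp add: scaled_form_def)

lemma ddcT_scaled_form_add: "test_fun \<Omega> f \<Longrightarrow> T (ddcform (scaled_form f (\<lambda>IJ. v IJ + w IJ))) = T (ddcform (scaled_form f v)) + T (ddcform (scaled_form f w))"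
  using T_add[OF test_form_ddcform_scaled_form[OF \<Omega>] test_form_ddcform_scaled_form[OF \<Omega>], of f f v w]
  by (simp add: ddcform_scaled_form_test[OF \<Omega>] wedge11_add)

lemma ddcT_scaled_form_cmult: "test_fun \<Omega> f \<Longrightarrow> T (ddcform (scaled_form f (\<lambda>IJ. c * w IJ))) = c * T (ddcform (scaled_form f w))"
  using T_cmult[OF test_form_ddcform_scaled_form[OF \<Omega>], of f c w] by (simp add: ddcform_scaled_form_test[OF \<Omega>] wedge11_cmult)

lemma ddcT_scaled_form_zero: "test_fun \<Omega> f \<Longrightarrow> T (ddcform (scaled_form f (\<lambda>_. 0))) = 0"
  using T_zero by (simp add: ddcform_scaled_form_test[OF \<Omega>] wedge11_zero)

lemma loc_T_span:
  assumes "\<And>as. length as = p \<Longrightarrow> loc (\<lambda>f. T (scaled_form f (elem_pos as))) x" "bideg p p w"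
  shows "loc (\<lambda>f. T (scaled_form f w)) x"
proof (rule elem_pos_span[where P = "\<lambda>w. loc (\<lambda>f. T (scaled_form f w)) x", OF _ _ _ assms])
  show "loc (\<lambda>f. T (scaled_form f (\<lambda>_. 0))) x" by (rule loc_zero) (rule T_scaled_form_zero)
qed (auto intro: loc_add loc_cmult T_scaled_form_add T_scaled_form_cmult)

text \<open>Two unrelated reasons: off \<open>L\<close> the sequence is bounded below near the
  point, and on \<open>L\<close> but off the support of \<open>T\<close> the values near the point
  are all zero.\<close>

lemma loc_T_off_E:
  assumes x: "x \<in> \<Omega> - E" and w: "bideg p p w"
  shows "loc (\<lambda>f. T (scaled_form f w)) x"
proof (cases "x \<in> L")
  case False
  then obtain e B where eB: "e > 0" "\<And>j y. y \<in> ball x e \<inter> \<Omega> \<Longrightarrow> - B \<le> G j y" using G_below x by blast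
  show ?thesis
  proof (rule loc_T_span[OF _ w])
    fix as :: "(complex, 'n) vec list" assume "length as = p"
    then show "loc (\<lambda>f. T (scaled_form f (elem_pos as))) x"
      unfolding loc_def using x by (intro conv_local_bounded_below[OF pos_functional_T[OF pos] _ eB]) auto
  qed
next
  case True
  then have "x \<notin> current_supp \<Omega> T" "x \<in> \<Omega>" using x by auto
  then obtain V where V: "open V" "x \<in> V" "\<And>u. test_form \<Omega> u \<Longrightarrow> form_supp u \<subseteq> V \<Longrightarrow> T u = 0"
    unfolding current_supp_def by blast
  obtain r where r: "r > 0" "cball x r \<subseteq> V" using open_contains_cball V(1,2) by blast
  have "conv (\<lambda>f. T (scaled_form f w)) f" if f: "test_fun \<Omega> f" "\<forall>z. z \<notin> ball x r \<longrightarrow> f z = 0" for f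
  proof -
    have "T (scaled_form (\<lambda>z. complex_of_real (G j z) * f z) w) = 0" for j
    proof (rule V(3)[OF test_form_scaled_form[OF \<Omega> test_fun_G[OF f(1)]]])
      have "{z. scaled_form (\<lambda>z. complex_of_real (G j z) * f z) w z \<noteq> (\<lambda>_. 0)} \<subseteq> cball x r"
        using f(2) by (force simp: scaled_form_def)
      then have "form_supp (scaled_form (\<lambda>z. complex_of_real (G j z) * f z) w) \<subseteq> cball x r"
        unfolding form_supp_def by (rule closure_minimal) simp
      then show "form_supp (scaled_form (\<lambda>z. complex_of_real (G j z) * f z) w) \<subseteq> V" using r(2) by blast
    qed
    then show ?thesis unfolding conv_def by (simp add: convergent_const)
  qed
  then show ?thesis unfolding loc_def using r(1) by blast
qed

lemma conv_of_loc:
  assumes N: "lin_functional \<Omega> N" and K: "compact K" "\<And>x. x \<in> K \<Longrightarrow> loc N x"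
    and f: "test_fun \<Omega> f" "\<And>z. z \<notin> K \<Longrightarrow> f z = 0"
  shows "conv N f"
  by (rule test_fun_localize[of \<Omega> "conv N", OF \<Omega> conv_zero[OF N] conv_add[OF N] K(1) f])
     (use K(2) in \<open>auto simp: loc_def\<close>)

lemma convergent_T_componentwise:
  assumes u: "test_form \<Omega> u"
    and A: "\<And>I J. card I = p \<Longrightarrow> card J = p \<Longrightarrow> conv (\<lambda>f. T (scaled_form f (pf_basis (I, J)))) (\<lambda>z. u z (I, J))"
  shows "convergent (\<lambda>j. T (\<lambda>z IJ. complex_of_real (G j z) * u z IJ))"
proof -
  have t: "test_fun \<Omega> (\<lambda>z. complex_of_real (G j z) * u z A)" for j A
    using u unfolding test_form_iff[OF \<Omega>] by (intro test_fun_G) (cases A, auto)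
  have "T (\<lambda>z IJ. complex_of_real (G j z) * u z IJ) = (\<Sum>A\<in>UNIV. T (scaled_form (\<lambda>z. complex_of_real (G j z) * u z A) (pf_basis A)))" for j
    by (rule T_basis_expand) (simp add: test_form_iff[OF \<Omega>] t del: split_paired_All)
  moreover have "convergent (\<lambda>j. T (scaled_form (\<lambda>z. complex_of_real (G j z) * u z A) (pf_basis A)))" for A
  proof -
    obtain I J where IJ: "A = (I, J)" by (cases A)
    show ?thesis
    proof (cases "card I = p \<and> card J = p")
      case True
      then show ?thesis using A unfolding conv_def IJ by auto
    next
      case False
      have "T (scaled_form (\<lambda>z. complex_of_real (G j z) * u z A) (pf_basis A)) = 0" for j
        by (rule T_other_bideg[OF test_form_scaled_form[OF \<Omega> t], of "card I" "card J"])
           (use False in \<open>auto simp: scaled_form_def IJ intro: bideg_cmult bideg_pf_basis\<close>)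
      then show ?thesis by (simp add: convergent_const)
    qed
  qed
  ultimately show ?thesis by (simp add: convergent_sum)
qed

lemma pf_basis_pp: "card I = p \<Longrightarrow> card J = p \<Longrightarrow> bideg p p (pf_basis (I, J))"
  using bideg_pf_basis[of I J] by simp

lemma convergent_T_off_E:
  assumes u: "test_form \<Omega> u" and K: "compact K" "K \<subseteq> \<Omega> - E" "\<And>z. z \<notin> K \<Longrightarrow> u z = (\<lambda>_. 0)"
  shows "convergent (\<lambda>j. T (\<lambda>z IJ. complex_of_real (G j z) * u z IJ))"
proof (rule convergent_T_componentwise[OF u])
  fix I J :: "'n set" assume c: "card I = p" "card J = p"
  show "conv (\<lambda>f. T (scaled_form f (pf_basis (I, J)))) (\<lambda>z. u z (I, J))"
  proof (rule conv_of_loc[OF lin_functional_T K(1)])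
    show "loc (\<lambda>f. T (scaled_form f (pf_basis (I, J)))) x" if "x \<in> K" for x
      by (rule loc_T_off_E[OF _ pf_basis_pp[OF c]]) (use K(2) that in auto)
    show "test_fun \<Omega> (\<lambda>z. u z (I, J))" using u unfolding test_form_iff[OF \<Omega>] by blast
  qed (simp add: K(3))
qed

text \<open>By the chain rule the two Wirtinger gradients of a function of the squared modulus of
  \<open>pair b\<close> are smooth multiples of \<open>b\<close> and of its conjugate, which is what
  \<open>wedge11_levi_mult_kill\<close> asks for.\<close>

lemma pair_step_kill:
  fixes a b :: "(complex, 'n) vec"
  assumes \<psi>: "smooth_on UNIV \<psi>" and b: "b \<in> set as"
  shows "wedge11 (levi (\<lambda>y. complex_of_real (step \<alpha> \<beta> ((cmod (pair b (y - a)))\<^sup>2)) * \<psi> y) z) (elem_pos as)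
    = (\<lambda>IJ. complex_of_real (step \<alpha> \<beta> ((cmod (pair b (z - a)))\<^sup>2)) * wedge11 (levi \<psi> z) (elem_pos as) IJ)"
proof -
  define s where "s t = complex_of_real (frechet_derivative (step \<alpha> \<beta>) (at t) 1)" for t
  note th = smooth_on_cmod_pair_sq[OF open_UNIV, of b a]
  have sd: "smooth_on UNIV (\<lambda>y. s ((cmod (pair b (y - a)))\<^sup>2))"
    unfolding s_def
    by (rule smooth_on_of_real[OF open_UNIV smooth_on_real_comp[OF open_UNIV smooth_on_frechet[OF step_smooth] th]])
  have d: "(\<lambda>z. (cmod (pair b (z - a)))\<^sup>2) differentiable at y" for y
    by (rule smooth_on_differentiable_at[OF th open_UNIV UNIV_I])
  show ?thesis
  proof (rule wedge11_levi_mult_kill[OF _ \<psi> open_UNIV UNIV_I _ _ _ _ b])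
    show "smooth_on UNIV (\<lambda>y. complex_of_real (step \<alpha> \<beta> ((cmod (pair b (y - a)))\<^sup>2)))"
      by (rule smooth_on_of_real[OF open_UNIV smooth_on_real_comp[OF open_UNIV step_smooth th]])
    show "smooth_on UNIV (\<lambda>y. s ((cmod (pair b (y - a)))\<^sup>2) * cnj (pair b (y - a)))"
      by (rule smooth_on_mult[OF open_UNIV sd smooth_on_cnj[OF open_UNIV smooth_on_pair[OF open_UNIV]]])
    show "smooth_on UNIV (\<lambda>y. s ((cmod (pair b (y - a)))\<^sup>2) * pair b (y - a))"
      by (rule smooth_on_mult[OF open_UNIV sd smooth_on_pair[OF open_UNIV]])
    show "wirt_z k (\<lambda>y. complex_of_real (step \<alpha> \<beta> ((cmod (pair b (y - a)))\<^sup>2))) y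
      = s ((cmod (pair b (y - a)))\<^sup>2) * cnj (pair b (y - a)) * b $ k" for y k
      using wirt_cmod_pair_sq(1)[of k b a y] unfolding wirt_z_eq_wirt wirt_real_comp[OF step_smooth d] s_def by simp
    show "wirt_zbar k (\<lambda>y. complex_of_real (step \<alpha> \<beta> ((cmod (pair b (y - a)))\<^sup>2))) y
      = s ((cmod (pair b (y - a)))\<^sup>2) * pair b (y - a) * cnj (b $ k)" for y k
      using wirt_cmod_pair_sq(2)[of k b a y] unfolding wirt_zbar_eq_wirt wirt_real_comp[OF step_smooth d] s_def by simp
  qed
qed

lemma pair_step_prod_kill:
  fixes a :: "(complex, 'n) vec"
  assumes \<psi>: "smooth_on UNIV \<psi>" and B: "finite B" "B \<subseteq> set as"
  shows "wedge11 (levi (\<lambda>y. (\<Prod>b\<in>B. complex_of_real (step \<alpha> \<beta> ((cmod (pair b (y - a)))\<^sup>2))) * \<psi> y) z) (elem_pos as)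
    = (\<lambda>IJ. (\<Prod>b\<in>B. complex_of_real (step \<alpha> \<beta> ((cmod (pair b (z - a)))\<^sup>2))) * wedge11 (levi \<psi> z) (elem_pos as) IJ)"
  using B
proof (induction B rule: finite_induct)
  case (insert b B)
  have sm: "smooth_on UNIV (\<lambda>y. complex_of_real (step \<alpha> \<beta> ((cmod (pair b (y - a)))\<^sup>2)))" for b
    by (rule smooth_on_of_real[OF open_UNIV smooth_on_real_comp[OF open_UNIV step_smooth smooth_on_cmod_pair_sq[OF open_UNIV]]])
  have sp: "smooth_on UNIV (\<lambda>y. (\<Prod>b\<in>B. complex_of_real (step \<alpha> \<beta> ((cmod (pair b (y - a)))\<^sup>2))) * \<psi> y)"
    by (rule smooth_on_mult[OF open_UNIV smooth_on_prod[OF open_UNIV sm] \<psi>])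
  show ?case
    using pair_step_kill[OF sp, of b as \<alpha> \<beta> a z] insert by (simp add: mult.assoc)
qed simp

text \<open>The transversality of the covectors \<open>as\<close> to \<open>E\<close> on a sphere produces a cutoff \<open>F\<close> such that
  \<open>dd\<^sup>c(F q) - F dd\<^sup>c q\<close>, wedged with \<open>elem_pos as\<close>, is supported off \<open>E\<close>.\<close>
lemma transversal_cutoff:
  assumes a: "a \<in> \<Omega>" and r: "0 < r" "cball a r \<subseteq> \<Omega>"
    and E: "\<And>z. z \<in> E \<Longrightarrow> norm (z - a) = r \<Longrightarrow> \<exists>b\<in>set as. pair b (z - a) \<noteq> 0"
  obtains F s K where "smooth_on UNIV F" "test_fun \<Omega> (\<lambda>z. complex_of_real (F z))" "\<And>z. 0 \<le> F z"
    "0 < s" "\<And>z. z \<in> ball a s \<Longrightarrow> F z = 1" "compact K" "K \<subseteq> \<Omega> - E"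
    "\<And>q z. smooth_on UNIV q \<Longrightarrow> z \<notin> K \<Longrightarrow>
       wedge11 (levi (\<lambda>y. complex_of_real (F y) * q y) z) (elem_pos as) = (\<lambda>IJ. complex_of_real (F z) * wedge11 (levi q z) (elem_pos as) IJ)"
proof -
  define B where "B = set as"
  have B: "finite B" by (simp add: B_def)
  \<comment> \<open>Zero exactly on the sphere of radius \<open>r\<close> inside the common kernel.
    Transversality says that \<open>E\<close> misses this set, and compactness will turn this into a
    positive gap.\<close>
  define \<psi> where "\<psi> z = \<bar>(norm (z - a))\<^sup>2 - r\<^sup>2\<bar> + (\<Sum>b\<in>B. (cmod (pair b (z - a)))\<^sup>2)" for z
  have cont_pair: "continuous_on S (\<lambda>z. pair b (z - a))" for b S
    unfolding pair_def by (intro continuous_intros)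
  have cont: "continuous_on S \<psi>" for S
    unfolding \<psi>_def by (intro continuous_intros cont_pair)
  have \<psi>0: "\<psi> z > 0" if zE: "z \<in> E" for z
  proof -
    have nn: "0 \<le> (\<Sum>b\<in>B. (cmod (pair b (z - a)))\<^sup>2)" by (intro sum_nonneg) auto
    show ?thesis
    proof (cases "norm (z - a) = r")
      case True
      then obtain b where b: "b \<in> B" "pair b (z - a) \<noteq> 0" using E[OF zE] B_def by blast
      have "(cmod (pair b (z - a)))\<^sup>2 \<le> (\<Sum>b\<in>B. (cmod (pair b (z - a)))\<^sup>2)"
        by (rule member_le_sum[OF b(1)]) (use B in auto)
      moreover have "0 < (cmod (pair b (z - a)))\<^sup>2" using b(2) by simp
      ultimately show ?thesis unfolding \<psi>_def by linarith
    next
      case False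
      then have "(norm (z - a))\<^sup>2 \<noteq> r\<^sup>2" using r(1) by (simp add: power2_eq_iff_nonneg)
      then show ?thesis unfolding \<psi>_def using nn by linarith
    qed
  qed
  have opE: "open (\<Omega> - E)"
  proof -
    have "\<Omega> - E = (\<Omega> - L) \<union> \<Union>{V. open V \<and> V \<subseteq> \<Omega> \<and> (\<forall>u. test_form \<Omega> u \<and> form_supp u \<subseteq> V \<longrightarrow> T u = 0)}"
      unfolding current_supp_def by auto
    then show ?thesis using L_open by (auto intro!: open_Un open_Union)
  qed
  \<comment> \<open>The part of \<open>E\<close> in the closed ball, written as a difference so that
    openness of \<open>\<Omega> - E\<close> yields compactness.\<close>
  define K0 where "K0 = cball a r - (\<Omega> - E)"
  have K0: "compact K0" unfolding K0_def by (rule compact_diff[OF compact_cball opE])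
  have K0E: "K0 \<subseteq> E" and EK0: "z \<in> E \<Longrightarrow> z \<in> cball a r \<Longrightarrow> z \<in> K0" for z using r(2) by (auto simp: K0_def)
  obtain \<mu> where \<mu>: "\<mu> > 0" "\<And>z. z \<in> K0 \<Longrightarrow> \<mu> \<le> \<psi> z"
  proof (cases "K0 = {}")
    case True
    then show ?thesis using that[of 1] by simp
  next
    case False
    obtain x where "x \<in> K0" "\<And>z. z \<in> K0 \<Longrightarrow> \<psi> x \<le> \<psi> z" using continuous_attains_inf[OF K0 False cont] by blast
    then show ?thesis using that[of "\<psi> x"] \<psi>0 K0E by blast
  qed
  \<comment> \<open>On the set \<open>K\<close> below each of the \<open>card B + 1\<close> summands
    of \<psi> is at most \<epsilon>, so \<psi> stays below the gap \<mu> and \<open>K\<close> misses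
    \<open>E\<close>. The second argument of the minimum leaves a ball around \<open>a\<close> on
    which the radial cutoff is 1.\<close>
  define \<epsilon> where "\<epsilon> = min (\<mu> / (2 * (real (card B) + 1))) (r\<^sup>2 / 2)"
  have \<epsilon>: "0 < \<epsilon>" "\<epsilon> < r\<^sup>2" "(real (card B) + 1) * \<epsilon> < \<mu>"
  proof -
    show "0 < \<epsilon>" using \<mu>(1) r(1) by (simp add: \<epsilon>_def add_nonneg_pos)
    show "\<epsilon> < r\<^sup>2" using r(1) by (simp add: \<epsilon>_def min_less_iff_disj)
    have "(real (card B) + 1) * \<epsilon> \<le> (real (card B) + 1) * (\<mu> / (2 * (real (card B) + 1)))"
      by (intro mult_left_mono) (auto simp: \<epsilon>_def)
    also have "\<dots> = \<mu> / 2" by (simp add: field_simps)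
    finally show "(real (card B) + 1) * \<epsilon> < \<mu>" using \<mu>(1) by linarith
  qed
  define \<rho> where "\<rho> z = step (r\<^sup>2 - \<epsilon>) (r\<^sup>2) ((norm (z - a))\<^sup>2)" for z
  define X where "X z = (\<Prod>b\<in>B. step (\<epsilon> / 2) \<epsilon> ((cmod (pair b (z - a)))\<^sup>2))" for z
  define F where "F z = X z * \<rho> z" for z
  \<comment> \<open>The only region where the radial cutoff may vary while no factor of
    \<open>X\<close> has to vanish.\<close>
  define K where "K = {z \<in> cball a r. r\<^sup>2 - \<epsilon> \<le> (norm (z - a))\<^sup>2 \<and> (\<forall>b\<in>B. (cmod (pair b (z - a)))\<^sup>2 \<le> \<epsilon>)}"
  have sm\<rho>: "smooth_on UNIV \<rho>"
    unfolding \<rho>_def[abs_def] by (rule smooth_on_real_comp[OF open_UNIV step_smooth smooth_on_norm_sq[OF open_UNIV]])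
  have smX: "smooth_on UNIV X"
    unfolding X_def[abs_def]
    by (rule smooth_on_prod[OF open_UNIV smooth_on_real_comp[OF open_UNIV step_smooth smooth_on_cmod_pair_sq[OF open_UNIV]]])
  have smF: "smooth_on UNIV F" unfolding F_def[abs_def] by (rule smooth_on_mult[OF open_UNIV smX sm\<rho>])
  have \<rho>_out: "\<rho> z = 0" if "norm (z - a) \<ge> r" for z
    unfolding \<rho>_def using that r(1) \<epsilon>(1) by (intro step_eq_0) (auto intro: power_mono)
  have tF: "test_fun \<Omega> (\<lambda>z. complex_of_real (F z))"
  proof (rule test_funI[OF smooth_on_of_real[OF \<Omega> smooth_on_subset[OF subset_UNIV smF]] compact_cball r(2)])
    fix x assume "x \<notin> cball a r"
    then show "complex_of_real (F x) = 0" using \<rho>_out[of x] by (simp add: F_def dist_norm norm_minus_commute)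
  qed
  have F0: "0 \<le> F z" for z unfolding F_def X_def \<rho>_def by (intro mult_nonneg_nonneg prod_nonneg step_nonneg ballI)
  define V where "V = {z. (norm (z - a))\<^sup>2 < r\<^sup>2 - \<epsilon>} \<inter> (\<Inter>b\<in>B. {z. (cmod (pair b (z - a)))\<^sup>2 < \<epsilon> / 2})"
  have opV: "open V" unfolding V_def
    by (intro open_Int open_INT B ballI open_Collect_less continuous_intros cont_pair)
  have "a \<in> V" using \<epsilon> by (auto simp: V_def pair_def)
  then obtain s where s: "s > 0" "ball a s \<subseteq> V" using opV openE by blast
  have F1: "F z = 1" if "z \<in> ball a s" for z
  proof -
    have z: "z \<in> V" using that s by auto
    have "\<rho> z = 1" unfolding \<rho>_def by (rule step_eq_1) (use z \<epsilon> in \<open>auto simp: V_def\<close>)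
    moreover have "X z = 1" unfolding X_def by (intro prod.neutral ballI step_eq_1) (use z \<epsilon> in \<open>auto simp: V_def intro: less_imp_le\<close>)
    ultimately show ?thesis by (simp add: F_def)
  qed
  have "K = cball a r \<inter> ({z. r\<^sup>2 - \<epsilon> \<le> (norm (z - a))\<^sup>2} \<inter> (\<Inter>b\<in>B. {z. (cmod (pair b (z - a)))\<^sup>2 \<le> \<epsilon>}))"
    unfolding K_def by auto
  moreover have "closed ({z. r\<^sup>2 - \<epsilon> \<le> (norm (z - a))\<^sup>2} \<inter> (\<Inter>b\<in>B. {z. (cmod (pair b (z - a)))\<^sup>2 \<le> \<epsilon>}))"
    by (intro closed_Int closed_INT ballI closed_Collect_le continuous_intros cont_pair)
  ultimately have K: "compact K" by (metis compact_Int_closed compact_cball)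
  have KE: "K \<subseteq> \<Omega> - E"
  proof
    fix z assume z: "z \<in> K"
    then have zr: "norm (z - a) \<le> r" by (simp add: K_def dist_norm norm_minus_commute)
    have "(norm (z - a))\<^sup>2 \<le> r\<^sup>2" using zr by (intro power_mono) auto
    then have "\<psi> z \<le> \<epsilon> + (\<Sum>b\<in>B. \<epsilon>)"
      unfolding \<psi>_def using z by (intro add_mono sum_mono) (auto simp: K_def)
    also have "\<dots> = (real (card B) + 1) * \<epsilon>" by (simp add: algebra_simps)
    also have "\<dots> < \<mu>" by (rule \<epsilon>(3))
    finally have "z \<notin> K0" using \<mu>(2)[of z] by auto
    then show "z \<in> \<Omega> - E" using z EK0[of z] r(2) by (auto simp: K_def)
  qed
  have kill: "wedge11 (levi (\<lambda>y. complex_of_real (F y) * q y) z) (elem_pos as) = (\<lambda>IJ. complex_of_real (F z) * wedge11 (levi q z) (elem_pos as) IJ)"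
    if q: "smooth_on UNIV q" and z: "z \<notin> K" for q z
  proof -
    have s\<rho>q: "smooth_on UNIV (\<lambda>y. complex_of_real (\<rho> y) * q y)"
      by (rule smooth_on_mult[OF open_UNIV smooth_on_of_real[OF open_UNIV sm\<rho>] q])
    have Xeq: "wedge11 (levi (\<lambda>y. complex_of_real (F y) * q y) z) (elem_pos as)
      = (\<lambda>IJ. complex_of_real (X z) * wedge11 (levi (\<lambda>y. complex_of_real (\<rho> y) * q y) z) (elem_pos as) IJ)"
      using pair_step_prod_kill[OF s\<rho>q B, of as "\<epsilon> / 2" \<epsilon> a z] by (simp add: F_def X_def B_def mult.assoc)
    \<comment> \<open>Off \<open>K\<close> either \<open>X\<close> vanishes at \<open>z\<close>, or
      the radial cutoff is constantly 1 or constantly 0 near \<open>z\<close>. In the first case the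
      value at \<open>z\<close> alone is enough, because by \<open>Xeq\<close> the factor
      \<open>X\<close> enters undifferentiated.\<close>
    consider "\<exists>b\<in>B. (cmod (pair b (z - a)))\<^sup>2 > \<epsilon>" | "(norm (z - a))\<^sup>2 < r\<^sup>2 - \<epsilon>" | "norm (z - a) > r"
      using z by (force simp: K_def dist_norm norm_minus_commute not_le)
    then show ?thesis
    proof cases
      case 1
      then obtain b where b: "b \<in> B" "(cmod (pair b (z - a)))\<^sup>2 > \<epsilon>" by blast
      then have "step (\<epsilon> / 2) \<epsilon> ((cmod (pair b (z - a)))\<^sup>2) = 0" using \<epsilon> by (intro step_eq_0) auto
      then have "X z = 0" unfolding X_def using B b(1) by (auto simp: prod_zero_iff)
      then show ?thesis unfolding Xeq by (simp add: F_def)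
    next
      case 2
      have op: "open {y. (norm (y - a))\<^sup>2 < r\<^sup>2 - \<epsilon>}" by (intro open_Collect_less continuous_intros)
      have \<rho>1: "\<rho> y = 1" if "(norm (y - a))\<^sup>2 < r\<^sup>2 - \<epsilon>" for y
        unfolding \<rho>_def by (rule step_eq_1) (use that \<epsilon> in auto)
      have "levi (\<lambda>y. complex_of_real (\<rho> y) * q y) z k l = levi q z k l" for k l
        by (rule levi_cong[OF op]) (use 2 \<rho>1 in auto)
      then have "levi (\<lambda>y. complex_of_real (\<rho> y) * q y) z = levi q z" by (auto simp: fun_eq_iff)
      then show ?thesis unfolding Xeq using \<rho>1[OF 2] by (simp add: F_def)
    next
      case 3
      have op: "open {y. r < norm (y - a)}" by (intro open_Collect_less continuous_intros)
      have "levi (\<lambda>y. complex_of_real (\<rho> y) * q y) z k l = 0" for k l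
        by (rule levi_eq_0_outside[OF op]) (use 3 \<rho>_out in auto)
      then have "wedge11 (levi (\<lambda>y. complex_of_real (\<rho> y) * q y) z) (elem_pos as) = (\<lambda>IJ. 0)" by (simp add: wedge11_def)
      then show ?thesis unfolding Xeq using \<rho>_out[of z] 3 by (simp add: F_def)
    qed
  qed
  show ?thesis by (rule that[OF smF tF F0 s(1) F1 K KE kill])
qed

section \<open>Lower bounds from the positivity of dd^c G_j wedge T\<close>

lemma levi_eq_0_const: "levi (\<lambda>z::(complex, 'n) vec. c) z k l = 0"
proof -
  have "wirt d m (\<lambda>_. c) = (\<lambda>_. 0)" for d c and m :: 'n by (rule ext) simp
  then show ?thesis by (simp add: levi_def wirt_z_eq_wirt wirt_zbar_eq_wirt)
qed

text \<open>The error form \<open>v\<close> is supported in \<open>K\<close>, off \<open>E\<close>,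
  so its pairings along the sequence converge and are bounded. Constancy of the Levi matrix
  \<open>M\<close> makes the main part a scalar function times one fixed form.\<close>

lemma wedge11_levi_split:
  assumes f: "test_fun \<Omega> (\<lambda>y. complex_of_real (F y) * q y)"
    and F: "test_fun \<Omega> (\<lambda>z. complex_of_real (F z))" and q: "smooth_on UNIV q" "\<And>z. levi q z = M"
    and K: "compact K" "K \<subseteq> \<Omega> - E" "\<And>z. z \<notin> K \<Longrightarrow>
       wedge11 (levi (\<lambda>y. complex_of_real (F y) * q y) z) w = (\<lambda>IJ. complex_of_real (F z) * wedge11 M w IJ)"
  shows "\<exists>B. \<forall>j. Re (T (\<lambda>z IJ. complex_of_real (G j z) * ddcform (scaled_form (\<lambda>y. complex_of_real (F y) * q y) w) z IJ))
     \<le> B + Re (T (scaled_form (\<lambda>z. complex_of_real (G j z * F z)) (wedge11 (\<lambda>k l. \<i> * M k l) w)))"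
proof -
  define D where "D = ddcform (scaled_form (\<lambda>y. complex_of_real (F y) * q y) w)"
  define m where "m = wedge11 (\<lambda>k l. \<i> * M k l) w"
  define v where "v z IJ = D z IJ + (-1) * scaled_form (\<lambda>z. complex_of_real (F z)) m z IJ" for z IJ
  have tD: "test_form \<Omega> D" unfolding D_def by (rule test_form_ddcform_scaled_form[OF \<Omega> f])
  have tv: "test_form \<Omega> v"
    unfolding v_def[abs_def] by (intro test_form_add test_form_cmult test_form_scaled_form \<Omega> tD F)
  have v0: "v z = (\<lambda>_. 0)" if "z \<notin> K" for z
  proof -
    have "D z IJ = \<i> * wedge11 (levi (\<lambda>y. complex_of_real (F y) * q y) z) w IJ" for IJ
      unfolding D_def ddcform_scaled_form_test[OF \<Omega> f] wedge11_cmult_left ..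
    then show ?thesis unfolding v_def scaled_form_def m_def wedge11_cmult_left K(3)[OF that] by (auto simp: fun_eq_iff)
  qed
  have tGv: "test_form \<Omega> (\<lambda>z IJ. complex_of_real (G j z) * v z IJ)" for j
    by (rule test_form_mult[OF \<Omega> smooth_on_of_real[OF \<Omega> G_smooth] tv])
  have tGF: "test_form \<Omega> (scaled_form (\<lambda>z. complex_of_real (G j z * F z)) m)" for j
    by (rule test_form_scaled_form[OF \<Omega> test_fun_G_real[OF F]])
  have split: "T (\<lambda>z IJ. complex_of_real (G j z) * D z IJ) = T (\<lambda>z IJ. complex_of_real (G j z) * v z IJ)
     + T (scaled_form (\<lambda>z. complex_of_real (G j z * F z)) m)" for j
  proof -
    have "(\<lambda>z IJ. complex_of_real (G j z) * D z IJ) = (\<lambda>z IJ. complex_of_real (G j z) * v z IJ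
       + scaled_form (\<lambda>z. complex_of_real (G j z * F z)) m z IJ)"
      by (simp add: v_def scaled_form_def fun_eq_iff algebra_simps)
    then show ?thesis using T_add[OF tGv tGF] by simp
  qed
  have "Bseq (\<lambda>j. T (\<lambda>z IJ. complex_of_real (G j z) * v z IJ))"
    by (rule convergent_imp_Bseq[OF convergent_T_off_E[OF tv K(1,2) v0]])
  then obtain B where "\<And>j. cmod (T (\<lambda>z IJ. complex_of_real (G j z) * v z IJ)) \<le> B" unfolding Bseq_def by blast
  then have "Re (T (\<lambda>z IJ. complex_of_real (G j z) * v z IJ)) \<le> B" for j
    using complex_Re_le_cmod order_trans by blast
  then show ?thesis
    unfolding D_def[symmetric] m_def[symmetric] split by (intro exI[of _ B] allI) simp
qed

text \<open>Since \<open>dd\<^sup>c G\<^sub>j \<and> T \<ge> 0\<close>, the sum of the two remaining terms of the integration by parts is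
  bounded below.\<close>
lemma ddcT_plus_T_bounded_below:
  assumes as: "length as = p - 1" and F: "smooth_on UNIV F" "test_fun \<Omega> (\<lambda>z. complex_of_real (F z))" "\<And>z. 0 \<le> F z"
    and q: "smooth_on UNIV q" "\<And>z. 0 \<le> q z" "\<And>z. levi (\<lambda>z. complex_of_real (q z)) z = M"
    and K: "compact K" "K \<subseteq> \<Omega> - E" "\<And>z. z \<notin> K \<Longrightarrow>
       wedge11 (levi (\<lambda>y. complex_of_real (F y) * complex_of_real (q y)) z) (elem_pos as) = (\<lambda>IJ. complex_of_real (F z) * wedge11 M (elem_pos as) IJ)"
  shows "\<exists>B. \<forall>j. - B \<le> Re (T (ddcform (scaled_form (\<lambda>z. complex_of_real (G j z * (F z * q z))) (elem_pos as))))
     + Re (T (scaled_form (\<lambda>z. complex_of_real (G j z * F z)) (wedge11 (\<lambda>k l. \<i> * M k l) (elem_pos as))))"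
proof -
  define w where "w = elem_pos as"
  define f where "f z = complex_of_real (F z) * complex_of_real (q z)" for z
  have w: "bideg (p - 1) (p - 1) w" using bideg_elem_pos[of as] as by (simp add: w_def)
  have sq: "smooth_on UNIV (\<lambda>z. complex_of_real (q z))" by (rule smooth_on_of_real[OF open_UNIV q(1)])
  have f: "test_fun \<Omega> f"
    using test_fun_mult[OF \<Omega> smooth_on_subset[OF subset_UNIV sq] F(2)] by (simp add: f_def[abs_def] mult.commute)
  obtain B1 where B1: "\<And>j. Re (T (\<lambda>z IJ. complex_of_real (G j z) * ddcform (scaled_form f w) z IJ))
     \<le> B1 + Re (T (scaled_form (\<lambda>z. complex_of_real (G j z * F z)) (wedge11 (\<lambda>k l. \<i> * M k l) w)))"
    using wedge11_levi_split[OF f[unfolded f_def[abs_def]] F(2) sq q(3) K(1,2), of w] K(3) unfolding f_def[abs_def] w_def by blast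
  have "Bseq (\<lambda>j. fun_dc_current (G j) T (dform (scaled_form f w)))"
    by (rule convergent_imp_Bseq[OF conv_dc[OF test_form_dform_scaled_form[OF f]]])
  then obtain B2 where "\<And>j. cmod (fun_dc_current (G j) T (dform (scaled_form f w))) \<le> B2" unfolding Bseq_def by blast
  then have B2: "\<bar>Re (fun_dc_current (G j) T (dform (scaled_form f w)))\<bar> \<le> B2" for j
    using abs_Re_le_cmod order_trans by blast
  have "- (B1 + 2 * B2) \<le> Re (T (ddcform (scaled_form (\<lambda>z. complex_of_real (G j z * (F z * q z))) w)))
     + Re (T (scaled_form (\<lambda>z. complex_of_real (G j z * F z)) (wedge11 (\<lambda>k l. \<i> * M k l) w)))" for j
  proof -
    have "0 \<le> Re (ddc_fun_wedge (G j) T (scaled_form f w))"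
      using ddc_fun_wedge_nonneg[OF pos G_smooth G_psh, of "\<lambda>z. F z * q z" as] f F(3) q(2) as
      by (simp add: f_def[abs_def] w_def)
    also have "\<dots> = Re (T (ddcform (scaled_form (\<lambda>z. complex_of_real (G j z) * f z) w))) - 2 * Re (fun_dc_current (G j) T (dform (scaled_form f w)))
      + Re (T (\<lambda>z IJ. complex_of_real (G j z) * ddcform (scaled_form f w) z IJ))"
      unfolding ddc_fun_wedge_identity[OF G_smooth f w] by simp
    also have "(\<lambda>z. complex_of_real (G j z) * f z) = (\<lambda>z. complex_of_real (G j z * (F z * q z)))"
      by (simp add: f_def)
    finally show ?thesis using B1[of j] B2[of j] by linarith
  qed
  then show ?thesis unfolding w_def by blast
qed

lemma loc_transversal:
  assumes a: "a \<in> \<Omega>" and r: "0 < r" "cball a r \<subseteq> \<Omega>" and as: "length as = p - 1"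
    and E: "\<And>z. z \<in> E \<Longrightarrow> norm (z - a) = r \<Longrightarrow> \<exists>b\<in>set as. pair b (z - a) \<noteq> 0"
  shows "loc (\<lambda>f. T (ddcform (scaled_form f (elem_pos as)))) a" "loc (\<lambda>f. T (scaled_form f (elem_pos (b # as)))) a"
proof -
  obtain F s K where F: "smooth_on UNIV F" "test_fun \<Omega> (\<lambda>z. complex_of_real (F z))" "\<And>z. 0 \<le> F z"
    and s: "0 < s" "\<And>z. z \<in> ball a s \<Longrightarrow> F z = 1" and K: "compact K" "K \<subseteq> \<Omega> - E"
    and kill: "\<And>q z. smooth_on UNIV q \<Longrightarrow> z \<notin> K \<Longrightarrow>
       wedge11 (levi (\<lambda>y. complex_of_real (F y) * q y) z) (elem_pos as) = (\<lambda>IJ. complex_of_real (F z) * wedge11 (levi q z) (elem_pos as) IJ)"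
    by (rule transversal_cutoff[OF a r E]) (assumption, assumption, rule that)
  have locI: "loc N a" if N: "pos_functional \<Omega> N" and B: "\<And>j. - B \<le> Re (N (\<lambda>z. complex_of_real (G j z * F z)))" for N B
    unfolding loc_def
  proof (intro exI[of _ s] conjI s(1) allI impI)
    fix f assume f: "test_fun \<Omega> f \<and> (\<forall>z. z \<notin> ball a s \<longrightarrow> f z = 0)"
    show "conv N f"
      by (rule conv_dominated[OF N F(2,3) B]) (use f s(2) in force)+
  qed
  have bounded: "\<exists>B. \<forall>j. - B \<le> Re (T (ddcform (scaled_form (\<lambda>z. complex_of_real (G j z * (F z * q z))) (elem_pos as))))
     + Re (T (scaled_form (\<lambda>z. complex_of_real (G j z * F z)) (wedge11 (\<lambda>k l. \<i> * M k l) (elem_pos as))))"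
    if q: "smooth_on UNIV q" "\<And>z. 0 \<le> q z" "\<And>z. levi (\<lambda>z. complex_of_real (q z)) z = M" for q M
  proof (rule ddcT_plus_T_bounded_below[OF as F q K])
    fix z assume "z \<notin> K"
    from kill[OF smooth_on_of_real[OF open_UNIV q(1)] this]
    show "wedge11 (levi (\<lambda>y. complex_of_real (F y) * complex_of_real (q y)) z) (elem_pos as) = (\<lambda>IJ. complex_of_real (F z) * wedge11 M (elem_pos as) IJ)"
      unfolding q(3) .
  qed
  note S = pos_functional_ddcT[OF psh as]
  show "loc (\<lambda>f. T (ddcform (scaled_form f (elem_pos as)))) a"
  proof -
    have "levi (\<lambda>z. complex_of_real 1) z = (\<lambda>k l. 0)" for z :: "(complex, 'n) vec"
      by (intro ext) (rule levi_eq_0_const)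
    then obtain B where "\<And>j. - B \<le> Re (T (ddcform (scaled_form (\<lambda>z. complex_of_real (G j z * (F z * 1))) (elem_pos as))))
      + Re (T (scaled_form (\<lambda>z. complex_of_real (G j z * F z)) (wedge11 (\<lambda>k l. \<i> * 0) (elem_pos as))))"
      using bounded[of "\<lambda>_. 1" "\<lambda>k l. 0"] smooth_on_const[of UNIV "1 :: real"] by auto
    moreover have "wedge11 (\<lambda>k l. \<i> * 0) (elem_pos as) = (\<lambda>_. 0)" by (simp add: wedge11_def)
    ultimately show ?thesis by (intro locI[OF S, of B]) (simp add: T_scaled_form_zero)
  qed
  show "loc (\<lambda>f. T (scaled_form f (elem_pos (b # as)))) a"
  proof -
    define q where "q z = (cmod (pair b (z - a)))\<^sup>2" for z
    have q: "smooth_on UNIV q" "\<And>z. 0 \<le> q z" "\<And>z. levi (\<lambda>z. complex_of_real (q z)) z = (\<lambda>k l. 2 * (b $ k * cnj (b $ l)))"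
      unfolding q_def[abs_def] levi_cmod_pair_sq[abs_def] by (auto intro: smooth_on_cmod_pair_sq simp: fun_eq_iff levi_cmod_pair_sq)
    obtain B where B: "\<And>j. - B \<le> Re (T (ddcform (scaled_form (\<lambda>z. complex_of_real (G j z * (F z * q z))) (elem_pos as))))
      + Re (T (scaled_form (\<lambda>z. complex_of_real (G j z * F z)) (wedge11 (\<lambda>k l. \<i> * (2 * (b $ k * cnj (b $ l)))) (elem_pos as))))"
      using bounded[OF q] by blast
    have Fq: "test_fun \<Omega> (\<lambda>z. complex_of_real (F z * q z))"
      using test_fun_mult[OF \<Omega> smooth_on_subset[OF subset_UNIV smooth_on_of_real[OF open_UNIV q(1)]] F(2)]
      by (simp add: mult.commute)
    have m: "wedge11 (\<lambda>k l. \<i> * (2 * (b $ k * cnj (b $ l)))) (elem_pos as) = (\<lambda>IJ. 2 * elem_pos (b # as) IJ)"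
      unfolding elem_pos_Cons wedge11_cmult_left[symmetric] by (simp add: mult.left_commute)
    \<comment> \<open>By monotonicity and nonnegativity of \<open>F\<close> and \<open>q\<close> the
      dd^c term is at most its value for \<open>G 0\<close>, so the lower bound of the sum passes to
      the other term. Halving the constant undoes the factor 2 in \<open>m\<close>.\<close>
    define B' where "B' = B + Re (T (ddcform (scaled_form (\<lambda>z. complex_of_real (G 0 z * (F z * q z))) (elem_pos as))))"
    have "- (B' / 2) \<le> Re (T (scaled_form (\<lambda>z. complex_of_real (G j z * F z)) (elem_pos (b # as))))" for j
    proof -
      have "Re (T (ddcform (scaled_form (\<lambda>z. complex_of_real (G j z * (F z * q z))) (elem_pos as))))
        \<le> Re (T (ddcform (scaled_form (\<lambda>z. complex_of_real (G 0 z * (F z * q z))) (elem_pos as))))"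
      proof (rule Re_pos_mono[OF S test_fun_G_real[OF Fq] test_fun_G_real[OF Fq]])
        fix z show "G j z * (F z * q z) \<le> G 0 z * (F z * q z)"
        proof (cases "z \<in> \<Omega>")
          case True
          show ?thesis by (rule mult_right_mono[OF G_le_0[OF True]]) (simp add: F(3) q(2))
        next
          case False
          then show ?thesis using test_fun_outside[OF F(2)] by simp
        qed
      qed
      moreover have "Re (T (scaled_form (\<lambda>z. complex_of_real (G j z * F z)) (\<lambda>IJ. 2 * elem_pos (b # as) IJ)))
         = 2 * Re (T (scaled_form (\<lambda>z. complex_of_real (G j z * F z)) (elem_pos (b # as))))"
        using T_scaled_form_cmult[OF test_fun_G_real[OF F(2)], of j 2 "elem_pos (b # as)"] by simp
      ultimately show ?thesis using B[of j, unfolded m] unfolding B'_def by argo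
    qed
    then show ?thesis
      by (intro locI[OF pos_functional_T[OF pos], of _ "B' / 2"]) (use as p in auto)
  qed
qed

text \<open>Genericity constrains only p - 1 covectors and never the additional \<open>b\<close>. So
  \<open>b\<close> stays fixed while the density argument runs over \<open>w\<close>, and this
  covers every product of \<open>p\<close> factors.\<close>

lemma loc_everywhere:
  assumes a: "a \<in> \<Omega>" and w: "bideg (p - 1) (p - 1) w"
  shows "loc (\<lambda>f. T (ddcform (scaled_form f w))) a" "loc (\<lambda>f. T (scaled_form f (wedge11 (\<lambda>k l. \<i> * (b $ k * cnj (b $ l))) w))) a"
proof -
  obtain R where R: "R > 0" "cball a R \<subseteq> \<Omega>" using open_contains_cball \<Omega> a by blast
  have dense: "\<exists>\<Lambda>'. (\<forall>i<p - 1. norm (\<Lambda>' i - \<Lambda> i) < e) \<and>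
      loc (\<lambda>f. T (ddcform (scaled_form f (elem_pos (map \<Lambda>' [0..<p - 1]))))) a \<and>
      (\<forall>b. loc (\<lambda>f. T (scaled_form f (elem_pos (b # map \<Lambda>' [0..<p - 1])))) a)"
    if e: "e > 0" for \<Lambda> :: "nat \<Rightarrow> (complex, 'n) vec" and e
  proof -
    obtain \<Lambda>' r where \<Lambda>': "\<And>i. i < p - 1 \<Longrightarrow> norm (\<Lambda>' i - \<Lambda> i) < e" and r: "0 < r" "r < R"
      and E: "\<And>z. z \<in> E \<Longrightarrow> norm (z - a) = r \<Longrightarrow> \<exists>i<p - 1. pair (\<Lambda>' i) (z - a) \<noteq> 0"
      using generic_covectors[OF small R(1) e, of \<Lambda> a] by metis
    have "cball a r \<subseteq> \<Omega>" using R(2) r(2) by auto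
    moreover have "\<exists>b\<in>set (map \<Lambda>' [0..<p - 1]). pair b (z - a) \<noteq> 0" if "z \<in> E" "norm (z - a) = r" for z
      using E[OF that] by auto
    ultimately show ?thesis
      using loc_transversal[OF a r(1), of "map \<Lambda>' [0..<p - 1]"] \<Lambda>' by auto
  qed
  show "loc (\<lambda>f. T (ddcform (scaled_form f w))) a"
  proof (rule elem_pos_dense_span[where P = "\<lambda>w. loc (\<lambda>f. T (ddcform (scaled_form f w))) a", OF _ _ _ _ w])
    show "loc (\<lambda>f. T (ddcform (scaled_form f (\<lambda>_. 0)))) a" by (rule loc_zero) (rule ddcT_scaled_form_zero)
    show "\<exists>\<Lambda>'. (\<forall>i<p - 1. norm (\<Lambda>' i - \<Lambda> i) < e) \<and> loc (\<lambda>f. T (ddcform (scaled_form f (elem_pos (map \<Lambda>' [0..<p - 1]))))) a"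
      if "e > 0" for \<Lambda> e using dense[OF that, of \<Lambda>] by blast
  qed (auto intro: loc_add loc_cmult ddcT_scaled_form_add ddcT_scaled_form_cmult)
  show "loc (\<lambda>f. T (scaled_form f (wedge11 (\<lambda>k l. \<i> * (b $ k * cnj (b $ l))) w))) a"
  proof (rule elem_pos_dense_span[where P = "\<lambda>w. loc (\<lambda>f. T (scaled_form f (wedge11 (\<lambda>k l. \<i> * (b $ k * cnj (b $ l))) w))) a", OF _ _ _ _ w])
    show "loc (\<lambda>f. T (scaled_form f (wedge11 (\<lambda>k l. \<i> * (b $ k * cnj (b $ l))) (\<lambda>_. 0)))) a"
      unfolding wedge11_zero by (rule loc_zero) (rule T_scaled_form_zero)
    show "\<exists>\<Lambda>'. (\<forall>i<p - 1. norm (\<Lambda>' i - \<Lambda> i) < e) \<and>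
        loc (\<lambda>f. T (scaled_form f (wedge11 (\<lambda>k l. \<i> * (b $ k * cnj (b $ l))) (elem_pos (map \<Lambda>' [0..<p - 1]))))) a"
      if "e > 0" for \<Lambda> e using dense[OF that, of \<Lambda>] unfolding elem_pos_Cons by blast
  qed (auto intro: loc_add loc_cmult T_scaled_form_add T_scaled_form_cmult simp: wedge11_add wedge11_cmult)
qed

section \<open>From local convergence to all test forms\<close>

lemma conv_ddcT:
  assumes f: "test_fun \<Omega> f" and w: "bideg (p - 1) (p - 1) w"
  shows "conv (\<lambda>f. T (ddcform (scaled_form f w))) f"
proof -
  obtain K where K: "compact K" "K \<subseteq> \<Omega>" "\<And>x. x \<notin> K \<Longrightarrow> f x = 0" using f unfolding test_fun_def by blast
  show ?thesis
    by (rule conv_of_loc[OF lin_functional_ddcT K(1) _ f K(3)]) (use K(2) loc_everywhere(1)[OF _ w] in auto)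
qed

lemma conv_T:
  assumes f: "test_fun \<Omega> f" and w: "bideg p p w"
  shows "conv (\<lambda>f. T (scaled_form f w)) f"
proof -
  obtain K where K: "compact K" "K \<subseteq> \<Omega>" "\<And>x. x \<notin> K \<Longrightarrow> f x = 0" using f unfolding test_fun_def by blast
  have "loc (\<lambda>f. T (scaled_form f w)) x" if "x \<in> K" for x
  proof (rule loc_T_span[OF _ w])
    fix as :: "(complex, 'n) vec list" assume "length as = p"
    then obtain b bs where as: "as = b # bs" "length bs = p - 1" using p by (cases as) auto
    have "bideg (p - 1) (p - 1) (elem_pos bs)" using bideg_elem_pos[of bs] as by simp
    then show "loc (\<lambda>f. T (scaled_form f (elem_pos as))) x"
      unfolding as(1) elem_pos_Cons using K(2) that by (intro loc_everywhere(2)) auto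
  qed
  then show ?thesis by (intro conv_of_loc[OF lin_functional_T K(1) _ f K(3)])
qed

lemma convergent_T:
  "test_form \<Omega> u \<Longrightarrow> convergent (\<lambda>j. T (\<lambda>z IJ. complex_of_real (G j z) * u z IJ))"
proof (rule convergent_T_componentwise)
  fix I J :: "'n set" assume "test_form \<Omega> u" and c: "card I = p" "card J = p"
  then have "test_fun \<Omega> (\<lambda>z. u z (I, J))" unfolding test_form_iff[OF \<Omega>] by blast
  then show "conv (\<lambda>f. T (scaled_form f (pf_basis (I, J)))) (\<lambda>z. u z (I, J))" by (rule conv_T[OF _ pf_basis_pp[OF c]])
qed

lemma convergent_ddc_fun_wedge_scaled_form:
  assumes f: "test_fun \<Omega> f" and w: "bideg (p - 1) (p - 1) w"
  shows "convergent (\<lambda>j. ddc_fun_wedge (G j) T (scaled_form f w))"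
proof -
  have "convergent (\<lambda>j. T (ddcform (scaled_form (\<lambda>z. complex_of_real (G j z) * f z) w)))"
    using conv_ddcT[OF f w] unfolding conv_def .
  moreover have "convergent (\<lambda>j. 2 * fun_dc_current (G j) T (dform (scaled_form f w)))"
    by (rule convergent_mult[OF convergent_const conv_dc[OF test_form_dform_scaled_form[OF f]]])
  moreover have "convergent (\<lambda>j. T (\<lambda>z IJ. complex_of_real (G j z) * ddcform (scaled_form f w) z IJ))"
    by (rule convergent_T[OF test_form_ddcform_scaled_form[OF \<Omega> f]])
  ultimately show ?thesis
    unfolding ddc_fun_wedge_identity[OF G_smooth f w] by (intro convergent_add convergent_diff)
qed

text \<open>Wedging with dd^c of \<open>G j\<close> raises the bidegree by (1,1), so of the finitely
  many components of \<open>u\<close> only those of bidegree (p-1,p-1) are seen by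
  \<open>T\<close>.\<close>

lemma convergent_ddc_fun_wedge:
  assumes u: "test_form \<Omega> u"
  shows "convergent (\<lambda>j. ddc_fun_wedge (G j) T u)"
proof -
  define H where "H j z = complex_of_real (G j z)" for j z
  have H: "smooth_on \<Omega> (H j)" for j unfolding H_def[abs_def] by (rule smooth_on_of_real[OF \<Omega> G_smooth])
  have t: "test_fun \<Omega> (\<lambda>z. u z A)" for A using u unfolding test_form_iff[OF \<Omega>] by (cases A) auto
  have "ddc_fun_wedge (G j) T u = (\<Sum>A\<in>UNIV. ddc_fun_wedge (G j) T (scaled_form (\<lambda>z. u z A) (pf_basis A)))" for j
  proof -
    have "wedge (ddcform (fun_form (H j))) u = (\<lambda>z IJ. \<Sum>A\<in>UNIV. wedge (ddcform (fun_form (H j))) (scaled_form (\<lambda>z. u z A) (pf_basis A)) z IJ)"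
    proof
      fix z
      have "u z = (\<lambda>IJ. \<Sum>A\<in>UNIV. scaled_form (\<lambda>z. u z A) (pf_basis A) z IJ)"
        using fun_cong[OF form_basis_expand[of u], of z] .
      from arg_cong[OF this, of "pf_wedge (ddcform (fun_form (H j)) z)"]
      show "wedge (ddcform (fun_form (H j))) u z = (\<lambda>IJ. \<Sum>A\<in>UNIV. wedge (ddcform (fun_form (H j))) (scaled_form (\<lambda>z. u z A) (pf_basis A)) z IJ)"
        unfolding wedge_def pf_wedge_sum_right .
    qed
    then show ?thesis
      unfolding ddc_fun_wedge_def H_def[symmetric, abs_def]
      using T_sum[OF test_form_wedge_ddcform[OF H t]] by simp
  qed
  moreover have "convergent (\<lambda>j. ddc_fun_wedge (G j) T (scaled_form (\<lambda>z. u z A) (pf_basis A)))" for A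
  proof -
    obtain I J where IJ: "A = (I, J)" by (cases A)
    show ?thesis
    proof (cases "card I = p - 1 \<and> card J = p - 1")
      case True
      then show ?thesis using bideg_pf_basis[of I J] unfolding IJ by (intro convergent_ddc_fun_wedge_scaled_form t) auto
    next
      case False
      have "ddc_fun_wedge (G j) T (scaled_form (\<lambda>z. u z A) (pf_basis A)) = 0" for j
        unfolding ddc_fun_wedge_def H_def[symmetric, abs_def]
      proof (rule T_other_bideg[OF test_form_wedge_ddcform[OF H t]])
        show "bideg (Suc (card I)) (Suc (card J)) (wedge (ddcform (fun_form (H j))) (scaled_form (\<lambda>z. u z A) (pf_basis A)) z)" for z
          unfolding wedge_ddcform_fun[OF \<Omega> H t] IJ by (intro bideg_cmult bideg_wedge11 bideg_pf_basis)
        show "(Suc (card I), Suc (card J)) \<noteq> (p, p)" using False by auto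
      qed
      then show ?thesis by (simp add: convergent_const)
    qed
  qed
  ultimately show ?thesis by (simp add: convergent_sum)
qed

end

theorem theorem3p2:
  fixes \<Omega> :: "(complex, 'n::{finite,linorder}) vec set"
    and p :: nat
    and T :: "'n current"
    and g :: "(complex, 'n) vec \<Rightarrow> ereal"
  assumes "open \<Omega>"
    and "1 \<le> p" and "p \<le> CARD('n)"
    and "is_current \<Omega> p T"
    and "positive_current \<Omega> p T"
    and "psh_current \<Omega> p T"
    and "neg_psh \<Omega> g"
    and "C1_on (\<Omega> - unbdd_locus \<Omega> g) (\<lambda>z. real_of_ereal (g z))"
    and "gdcT_well_defined \<Omega> g T"
    and "hausdorff_measure (2 * p - 1) (unbdd_locus \<Omega> g \<inter> current_supp \<Omega> T) = 0"
  shows "ddcgT_well_defined \<Omega> g T"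
  unfolding ddcgT_well_defined_def weak_star_convergent_def
proof (intro allI impI)
  fix G u assume G: "admissible_seq \<Omega> g G" and u: "test_form \<Omega> u"
  have bounded: "\<exists>e>0. \<exists>M::real. \<forall>y\<in>ball x e \<inter> \<Omega>. ereal M \<le> g y" if "x \<in> \<Omega> - unbdd_locus \<Omega> g" for x
    using that unfolding unbdd_locus_def by (auto simp: not_less)
  \<comment> \<open>A decreasing sequence stays above its limit, so a local lower bound for
    \<open>g\<close> serves all \<open>G j\<close> at once.\<close>
  have mono: "g y \<le> ereal (G j y)" if "y \<in> \<Omega>" for j y
  proof -
    have "decseq (\<lambda>j. ereal (G j y))" using G that unfolding admissible_seq_def by (intro decseq_SucI) auto
    moreover have "(\<lambda>j. ereal (G j y)) \<longlonglongrightarrow> g y" using G that unfolding admissible_seq_def by blast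
    ultimately show ?thesis by (rule decseq_ge)
  qed
  interpret psh_product \<Omega> p T G "unbdd_locus \<Omega> g"
  proof unfold_locales
    show "open (\<Omega> - unbdd_locus \<Omega> g)"
      unfolding open_contains_ball
    proof
      fix x assume x: "x \<in> \<Omega> - unbdd_locus \<Omega> g"
      obtain e M where e: "e > 0" "\<forall>y\<in>ball x e \<inter> \<Omega>. ereal M \<le> g y" using bounded[OF x] by blast
      have o: "open (ball x e \<inter> \<Omega>)" using assms(1) by auto
      have "ball x e \<inter> \<Omega> \<subseteq> \<Omega> - unbdd_locus \<Omega> g"
      proof
        fix y assume y: "y \<in> ball x e \<inter> \<Omega>"
        obtain d where d: "d > 0" "ball y d \<subseteq> ball x e \<inter> \<Omega>" using o y openE by blast
        have "\<forall>z\<in>ball y d \<inter> \<Omega>. \<not> g z < ereal M" using d(2) e(2) by (auto simp: not_less)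
        then show "y \<in> \<Omega> - unbdd_locus \<Omega> g" using y d(1) unfolding unbdd_locus_def by blast
      qed
      moreover obtain d where "d > 0" "ball x d \<subseteq> ball x e \<inter> \<Omega>" using o e(1) x openE[of "ball x e \<inter> \<Omega>" x] by auto
      ultimately show "\<exists>d>0. ball x d \<subseteq> \<Omega> - unbdd_locus \<Omega> g" by blast
    qed
  next
    fix x assume "x \<in> \<Omega> - unbdd_locus \<Omega> g"
    then obtain e M where e: "e > 0" "\<forall>y\<in>ball x e \<inter> \<Omega>. ereal M \<le> g y" using bounded by blast
    \<comment> \<open>The locale states lower bounds as \<open>- B\<close>; here \<open>B\<close> is
      \<open>- M\<close>.\<close>
    have "- (- M) \<le> G j y" if "y \<in> ball x e \<inter> \<Omega>" for j y
      using order_trans[OF e(2)[rule_format, OF that] mono[of y j]] that by simp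
    then show "\<exists>e>0. \<exists>B. \<forall>j. \<forall>y\<in>ball x e \<inter> \<Omega>. - B \<le> G j y" using e(1) by blast
  next
    have "2 * (p - 1) + 1 = 2 * p - 1" using assms(2) by simp
    then show "hausdorff_measure (2 * (p - 1) + 1) (unbdd_locus \<Omega> g \<inter> current_supp \<Omega> T) = 0"
      using assms(10) by (simp only:)
  next
    show "convergent (\<lambda>j. fun_dc_current (G j) T u)" if "test_form \<Omega> u" for u
      using assms(9) G that unfolding gdcT_well_defined_def weak_star_convergent_def by blast
  qed (use assms G in \<open>auto simp: admissible_seq_def\<close>)
  show "convergent (\<lambda>j. ddc_fun_wedge (G j) T u)" by (rule convergent_ddc_fun_wedge[OF u])
qed

end
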